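(* There is a polynomial-time algorithm that, for every SAP instance in which $|K_b|\le 2$ for all $b\in B$, outputs a feasible seminar assignment whose profit is at least $(1-e^{-1})$ times the maximum profit of a feasible seminar assignment.
   Context: SAP instance: finite set $B$ of seminars, finite set $I$ of students, for each $b\in B$ a set $K_b\subseteq\mathbb{N}$ of allowable numbers of students with $0\in K_b$ (so here $K_b=\{0\}$ or $K_b=\{0,k_b\}$), and profits $p(i,b)\ge 0$ for $i\in I$, $b\in B$. A seminar assignment is a function $\mathcal{A}:J\to B$ with $J\subseteq I$; it is feasible if $|\mathcal{A}^{-1}(b)|\in K_b$ for all $b\in B$; its profit is $p(\mathcal{A})=\sum_{i\in J}p(i,\mathcal{A}(i))$. *)

theory Defs
  imports
    Complex_Main
    "HOL-Library.Log_Nat"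
    "HOL-Computational_Algebra.Polynomial"
begin

section \<open>The seminar assignment problem\<close>

text \<open>Profits are rational, so that an instance is a finite object.\<close>

record ('i, 'b) sap =
  students :: "'i set"
  seminars :: "'b set"
  allowed :: "'b \<Rightarrow> nat set"
  profit :: "'i \<Rightarrow> 'b \<Rightarrow> rat"

definition sap_instance :: "('i, 'b) sap \<Rightarrow> bool" where
  "sap_instance S \<longleftrightarrow>
     finite (students S) \<and> finite (seminars S) \<and>
     (\<forall>b\<in>seminars S. 0 \<in> allowed S b) \<and>
     (\<forall>i\<in>students S. \<forall>b\<in>seminars S. 0 \<le> profit S i b)"

text \<open>A function from a subset \<open>J\<close> of the students to the seminars is a partial map with
  domain \<open>J\<close>.\<close>

definition seminar_assignment :: "('i, 'b) sap \<Rightarrow> ('i \<rightharpoonup> 'b) \<Rightarrow> bool" where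
  "seminar_assignment S A \<longleftrightarrow> dom A \<subseteq> students S \<and> ran A \<subseteq> seminars S"

definition feasible :: "('i, 'b) sap \<Rightarrow> ('i \<rightharpoonup> 'b) \<Rightarrow> bool" where
  "feasible S A \<longleftrightarrow>
     seminar_assignment S A \<and> (\<forall>b\<in>seminars S. card {i. A i = Some b} \<in> allowed S b)"

definition assignment_profit :: "('i, 'b) sap \<Rightarrow> ('i \<rightharpoonup> 'b) \<Rightarrow> rat" where
  "assignment_profit S A = (\<Sum>i\<in>dom A. profit S i (the (A i)))"

definition max_profit :: "('i, 'b) sap \<Rightarrow> rat" where
  "max_profit S = Max (assignment_profit S ` {A. feasible S A})"

text \<open>The maximum is taken over a finite nonempty set.\<close>

lemma finite_feasible:
  assumes "sap_instance S"
  shows "finite {A. feasible S A}"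
proof (rule finite_subset)
  show "{A. feasible S A} \<subseteq>
          (\<Union>J\<in>Pow (students S). {A. dom A = J \<and> ran A \<subseteq> seminars S})"
    by (auto simp: feasible_def seminar_assignment_def)
  have "finite {A. dom A = J \<and> ran A \<subseteq> seminars S}" if "J \<in> Pow (students S)" for J
    using that assms finite_subset[of J "students S"]
    by (intro finite_set_of_finite_maps) (simp_all add: sap_instance_def)
  then show "finite (\<Union>J\<in>Pow (students S). {A. dom A = J \<and> ran A \<subseteq> seminars S})"
    using assms by (simp add: sap_instance_def)
qed

lemma feasible_empty:
  assumes "sap_instance S"
  shows "feasible S Map.empty"
  using assms by (auto simp: feasible_def seminar_assignment_def sap_instance_def)


section \<open>Random access machines with logarithmic cost\<close>

text \<open>
  A structured random access machine over the natural numbers. Its memory consists of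
  arrays of unbounded length, of which a program can address only the finitely many that occur
  literally in it; a scalar variable is cell 0 of an array. As usual for the
  logarithmic cost criterion, every operation is charged the bit lengths of its operands, and
  every memory access the bit lengths of the address and of the value. This makes
  running times polynomially related to those of Turing machines, multiplication and
  division included.
\<close>

definition bit_length :: "nat \<Rightarrow> nat" where
  "bit_length n = max 1 (floorlog 2 n)"

type_synonym store = "nat \<Rightarrow> nat \<Rightarrow> nat"

datatype aexp =
    Const nat
  | Cell nat aexp
  | Add aexp aexp
  | Sub aexp aexp
  | Mul aexp aexp
  | Div aexp aexp

text \<open>Subtraction is truncated, and division by 0 yields 0.\<close>

fun aval :: "aexp \<Rightarrow> store \<Rightarrow> nat" where
  "aval (Const n) s = n"
| "aval (Cell a e) s = s a (aval e s)"
| "aval (Add e f) s = aval e s + aval f s"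
| "aval (Sub e f) s = aval e s - aval f s"
| "aval (Mul e f) s = aval e s * aval f s"
| "aval (Div e f) s = aval e s div aval f s"

fun acost :: "aexp \<Rightarrow> store \<Rightarrow> nat" where
  "acost (Const n) s = bit_length n"
| "acost (Cell a e) s = acost e s + bit_length (aval e s) + bit_length (s a (aval e s))"
| "acost (Add e f) s = acost e s + acost f s + bit_length (aval e s) + bit_length (aval f s)"
| "acost (Sub e f) s = acost e s + acost f s + bit_length (aval e s) + bit_length (aval f s)"
| "acost (Mul e f) s = acost e s + acost f s + bit_length (aval e s) + bit_length (aval f s)"
| "acost (Div e f) s = acost e s + acost f s + bit_length (aval e s) + bit_length (aval f s)"

text \<open>\<open>Assign a e f\<close> is \<open>a[e] := f\<close>; conditions hold when they are nonzero.\<close>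

datatype com =
    Skip
  | Assign nat aexp aexp
  | Seq com com
  | If aexp com com
  | While aexp com

text \<open>\<open>run c s t s'\<close>: started in \<open>s\<close>, the program \<open>c\<close> halts in \<open>s'\<close> at cost \<open>t\<close>.\<close>

inductive run :: "com \<Rightarrow> store \<Rightarrow> nat \<Rightarrow> store \<Rightarrow> bool" where
  Skip: "run Skip s 1 s"
| Assign: "run (Assign a e f) s
     (acost e s + acost f s + bit_length (aval e s) + bit_length (aval f s))
     (s(a := (s a)(aval e s := aval f s)))"
| Seq: "\<lbrakk> run c s t s'; run d s' u s'' \<rbrakk> \<Longrightarrow> run (Seq c d) s (t + u) s''"
| IfTrue: "\<lbrakk> aval e s \<noteq> 0; run c s t s' \<rbrakk>
     \<Longrightarrow> run (If e c d) s (acost e s + bit_length (aval e s) + t) s'"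
| IfFalse: "\<lbrakk> aval e s = 0; run d s t s' \<rbrakk>
     \<Longrightarrow> run (If e c d) s (acost e s + bit_length (aval e s) + t) s'"
| WhileFalse: "aval e s = 0 \<Longrightarrow> run (While e c) s (acost e s + bit_length (aval e s)) s"
| WhileTrue: "\<lbrakk> aval e s \<noteq> 0; run c s t s'; run (While e c) s' u s'' \<rbrakk>
     \<Longrightarrow> run (While e c) s (acost e s + bit_length (aval e s) + t + u) s''"

lemma run_deterministic:
  "run c s t s' \<Longrightarrow> run c s u s'' \<Longrightarrow> u = t \<and> s'' = s'"
proof (induction arbitrary: u s'' rule: run.induct)
  case Skip
  then show ?case by (cases rule: run.cases) simp_all
next
  case Assign
  then show ?case by (cases rule: run.cases) simp_all
next
  case (Seq c s t s' d t' s3)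
  from Seq.prems obtain v w r where "run c s v r" "run d r w s''" "u = v + w"
    by (cases rule: run.cases) simp_all
  with Seq.IH show ?case by blast
next
  case (IfTrue e s c t s' d)
  from IfTrue.prems IfTrue.hyps obtain v where
    "run c s v s''" "u = acost e s + bit_length (aval e s) + v"
    by (cases rule: run.cases) simp_all
  with IfTrue.IH show ?case by blast
next
  case (IfFalse e s d t s' c)
  from IfFalse.prems IfFalse.hyps obtain v where
    "run d s v s''" "u = acost e s + bit_length (aval e s) + v"
    by (cases rule: run.cases) simp_all
  with IfFalse.IH show ?case by blast
next
  case (WhileFalse e s c)
  from WhileFalse.prems WhileFalse.hyps show ?case
    by (cases rule: run.cases) simp_all
next
  case (WhileTrue e s c t s' t' s3)
  from WhileTrue.prems WhileTrue.hyps(1) obtain v w r where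
    "run c s v r" "run (While e c) r w s''"
    "u = acost e s + bit_length (aval e s) + v + w"
    by (cases rule: run.cases) simp_all
  with WhileTrue.IH show ?case by blast
qed

text \<open>The input is placed in array 0; all other cells are initially 0.\<close>

definition initial_store :: "nat list \<Rightarrow> store" where
  "initial_store xs = (\<lambda>a j. if a = 0 \<and> j < length xs then xs ! j else 0)"

definition input_size :: "nat list \<Rightarrow> nat" where
  "input_size xs = (\<Sum>x\<leftarrow>xs. bit_length x)"


section \<open>Encoding of instances and assignments\<close>

text \<open>
  Students and seminars are represented by their positions in enumerations \<open>js\<close> and \<open>bs\<close>. The
  input consists of the numbers of students and seminars, the profit matrix row by row with every
  profit given by its reduced numerator and denominator, and the sets of allowable numbers, each
  as its cardinality followed by its elements in increasing order. The sets must be finite.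
\<close>

definition enumerates :: "'a list \<Rightarrow> 'a set \<Rightarrow> bool" where
  "enumerates xs X \<longleftrightarrow> distinct xs \<and> set xs = X"

definition encode_rat :: "rat \<Rightarrow> nat list" where
  "encode_rat r = (case quotient_of r of (n, d) \<Rightarrow> [nat n, nat d])"

definition encode_set :: "nat set \<Rightarrow> nat list" where
  "encode_set K = card K # sorted_list_of_set K"

definition encode_sap :: "'i list \<Rightarrow> 'b list \<Rightarrow> ('i, 'b) sap \<Rightarrow> nat list" where
  "encode_sap js bs S =
     [length js, length bs]
     @ concat (map (\<lambda>i. concat (map (\<lambda>b. encode_rat (profit S i b)) bs)) js)
     @ concat (map (\<lambda>b. encode_set (allowed S b)) bs)"

text \<open>The result is read off array 1: cell \<open>j\<close> holds 0 if the student at position \<open>j\<close> is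
  unassigned, and \<open>k + 1\<close> if that student is assigned to the seminar at position \<open>k\<close>.\<close>

definition outputs_assignment ::
  "'i list \<Rightarrow> 'b list \<Rightarrow> store \<Rightarrow> ('i \<rightharpoonup> 'b) \<Rightarrow> bool" where
  "outputs_assignment js bs s A \<longleftrightarrow>
     dom A \<subseteq> set js \<and>
     (\<forall>j<length js. case A (js ! j) of
          None \<Rightarrow> s 1 j = 0
        | Some b \<Rightarrow> \<exists>k<length bs. bs ! k = b \<and> s 1 j = Suc k)"

end

theory Submission
  imports Defs
begin

text \<open>
  Once the set \<open>S\<close> of open seminars is fixed, with total size \<open>\<Sum>b\<in>S. k b\<close> at most the number
  \<open>N\<close> of students, the best way to fill them exactly is a bipartite assignment problem. It is
  solved by an auction in which the vacant places bid for students and every bid raises a price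
  by 1. This is off by at most \<open>N\<close>, hence exact if all profits are multiples of \<open>N + 1\<close>; it
  is fast if they are small. By linear programming duality the optimal value is a submodular
  function of \<open>S\<close>, because the dual objective is submodular in the prices.

  It remains to maximise a monotone submodular function under a knapsack constraint, which the
  greedy algorithm of Sviridenko (greedy by density, started from every set of at most three items)
  achieves up to the factor \<open>1 - 1/e\<close>. As sizes are integers and \<open>N\<close> is polynomial in the input
  size, an item that does not fit exceeds the budget by at least 1. This improves the factor
  by a term of order \<open>1/N\<close>, which pays for rounding the profits to small multiples of \<open>N + 1\<close>.
\<close>

section \<open>Bounding the cost of programs\<close>

text \<open>With at most two allowable numbers per seminar, a feasible assignment is an exact fill
  of the set of seminars it uses, so the optimum is a maximum over such sets. The value of a set is
  defined as the optimum of the dual program and not as the best gain of a fill. It is then monotone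
  and submodular on all sets, even on those exceeding the budget, which have no fill at all; only
  within the budget must a fill attain it. The ratio has to be exactly \<open>1 - exp (-1)\<close>
  for rational profits of any size, while the number of bids grows with the profits themselves and
  not with their bit lengths. Hence profits are rounded, and the greedy algorithm must deliver a
  little more than the ratio. On the machine side a single number \<open>X\<close>, polynomial in
  the input size, bounds both the iterations of every loop and the bits of every cell. The cost is
  then bounded by recursion over the program text; what remains to be shown for each program are
  loop variants of at most \<open>X\<close> and stored values below \<open>2 ^ X\<close>.\<close>

lemma bit_length_pos: "1 \<le> bit_length n"
  by (simp add: bit_length_def)

lemma less_power_bit_length: "n < 2 ^ bit_length n"
proof -
  have "n < 2 ^ floorlog 2 n"
    by (cases "n = 0") (use floorlog_bounds[of n 2] in auto)
  also have "\<dots> \<le> 2 ^ bit_length n"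
    by (intro power_increasing) (auto simp: bit_length_def)
  finally show ?thesis .
qed

lemma bit_length_le:
  assumes "n < 2 ^ k" "1 \<le> k"
  shows "bit_length n \<le> k"
proof (cases "n = 0")
  case True
  then show ?thesis using assms by (simp add: bit_length_def floorlog_def)
next
  case False
  then have "2 ^ (floorlog 2 n - 1) \<le> n"
    using floorlog_bounds[of n 2] by simp
  then have "(2::nat) ^ (floorlog 2 n - 1) < 2 ^ k"
    using assms(1) by linarith
  then have "floorlog 2 n - 1 < k"
    by (simp add: power_strict_increasing_iff)
  then show ?thesis
    using assms(2) by (simp add: bit_length_def)
qed

lemma bit_length_mono: "a \<le> b \<Longrightarrow> bit_length a \<le> bit_length b"
  by (meson bit_length_le bit_length_pos less_power_bit_length order_le_less_trans)

lemma bit_length_mult: "bit_length (a * b) \<le> bit_length a + bit_length b"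
proof (rule bit_length_le)
  show "a * b < 2 ^ (bit_length a + bit_length b)"
    unfolding power_add
    by (intro mult_strict_mono) (auto simp: less_power_bit_length)
qed (use bit_length_pos[of a] in linarith)

text \<open>Two numbers that are at least 2 have a sum of at most their product, so the crude bound
  for products also serves sums. Bit lengths are at least 1, which makes both powers at least
  2.\<close>

lemma bit_length_add: "bit_length (a + b) \<le> bit_length a + bit_length b"
proof (rule bit_length_le)
  have "(2::nat) ^ 1 \<le> 2 ^ bit_length a" "(2::nat) ^ 1 \<le> 2 ^ bit_length b"
    by (intro power_increasing bit_length_pos; simp)+
  moreover have "a + b < 2 ^ bit_length a + 2 ^ bit_length b"
    using less_power_bit_length by (rule add_strict_mono) (rule less_power_bit_length)
  moreover have "(x::nat) + y \<le> x * y" if "2 \<le> x" "2 \<le> y" for x y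
    using mult_le_mono1[OF that(1), of y] mult_le_mono2[OF that(2), of x] by linarith
  ultimately show "a + b < 2 ^ (bit_length a + bit_length b)"
    unfolding power_add by (metis order_less_le_trans power_one_right)
qed (use bit_length_pos[of a] in linarith)

text \<open>Bounds the bit length of a value when all cells hold at most \<open>X\<close> bits. A
  cell counts \<open>X + 1\<close> because even 0 has bit length 1, which \<open>X\<close> would
  miss for \<open>X = 0\<close>. Sums in place of maxima keep the bound polynomial in
  \<open>X\<close>.\<close>

fun value_length :: "nat \<Rightarrow> aexp \<Rightarrow> nat" where
  "value_length X (Const n) = bit_length n"
| "value_length X (Cell a e) = X + 1"
| "value_length X (Add e f) = value_length X e + value_length X f"
| "value_length X (Sub e f) = value_length X e"
| "value_length X (Mul e f) = value_length X e + value_length X f"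
| "value_length X (Div e f) = value_length X e"

fun aexp_cost :: "nat \<Rightarrow> aexp \<Rightarrow> nat" where
  "aexp_cost X (Const n) = bit_length n"
| "aexp_cost X (Cell a e) = aexp_cost X e + value_length X e + X + 1"
| "aexp_cost X (Add e f) = aexp_cost X e + aexp_cost X f + value_length X e + value_length X f"
| "aexp_cost X (Sub e f) = aexp_cost X e + aexp_cost X f + value_length X e + value_length X f"
| "aexp_cost X (Mul e f) = aexp_cost X e + aexp_cost X f + value_length X e + value_length X f"
| "aexp_cost X (Div e f) = aexp_cost X e + aexp_cost X f + value_length X e + value_length X f"

text \<open>An upper bound on the running time when every loop makes at most \<open>X\<close> iterations and
  all cells always hold values of at most \<open>X\<close> bits.\<close>

fun com_cost :: "nat \<Rightarrow> com \<Rightarrow> nat" where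
  "com_cost X Skip = 1"
| "com_cost X (Assign a e f) =
     aexp_cost X e + aexp_cost X f + value_length X e + value_length X f"
| "com_cost X (Seq c d) = com_cost X c + com_cost X d"
| "com_cost X (If e c d) = aexp_cost X e + value_length X e + com_cost X c + com_cost X d"
| "com_cost X (While e c) =
     aexp_cost X e + value_length X e + X * (aexp_cost X e + value_length X e + com_cost X c)"

definition bounded_store :: "nat \<Rightarrow> store \<Rightarrow> bool" where
  "bounded_store X s \<longleftrightarrow> (\<forall>a j. s a j < 2 ^ X)"

lemma bit_length_cell:
  assumes "bounded_store X s"
  shows "bit_length (s a j) \<le> Suc X"
proof (rule bit_length_le)
  have "s a j < 2 ^ X" using assms by (simp add: bounded_store_def)
  then show "s a j < 2 ^ Suc X" by simp
qed simp

lemma bit_length_aval: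
  assumes "bounded_store X s"
  shows "bit_length (aval e s) \<le> value_length X e"
proof (induction e)
  case (Cell a e)
  then show ?case by (simp add: assms bit_length_cell)
next
  case (Add e f)
  then show ?case using bit_length_add[of "aval e s" "aval f s"] by simp
next
  case (Sub e f)
  then show ?case using bit_length_mono[of "aval e s - aval f s" "aval e s"] by simp
next
  case (Mul e f)
  then show ?case using bit_length_mult[of "aval e s" "aval f s"] by simp
next
  case (Div e f)
  then show ?case using bit_length_mono[of "aval e s div aval f s" "aval e s"] by simp
qed simp

lemma acost_le:
  assumes "bounded_store X s"
  shows "acost e s \<le> aexp_cost X e"
proof (induction e)
  case (Cell a e)
  then show ?case
    using bit_length_aval[OF assms, of e] bit_length_cell[OF assms, of a "aval e s"] by simp
next
  case (Add e f)
  then show ?case using bit_length_aval[OF assms, of e] bit_length_aval[OF assms, of f] by simp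
next
  case (Sub e f)
  then show ?case using bit_length_aval[OF assms, of e] bit_length_aval[OF assms, of f] by simp
next
  case (Mul e f)
  then show ?case using bit_length_aval[OF assms, of e] bit_length_aval[OF assms, of f] by simp
next
  case (Div e f)
  then show ?case using bit_length_aval[OF assms, of e] bit_length_aval[OF assms, of f] by simp
qed simp

section \<open>Polynomial growth of the cost bound\<close>

definition is_poly :: "(nat \<Rightarrow> nat) \<Rightarrow> bool" where
  "is_poly f \<longleftrightarrow> (\<exists>q. \<forall>x. f x = poly q x)"

lemma is_poly_const [intro]: "is_poly (\<lambda>x. c)"
  unfolding is_poly_def by (rule exI[of _ "[:c:]"]) simp

lemma is_poly_id [intro]: "is_poly (\<lambda>x. x)"
  unfolding is_poly_def by (rule exI[of _ "[:0, 1:]"]) simp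

lemma is_poly_add [intro]: "is_poly f \<Longrightarrow> is_poly g \<Longrightarrow> is_poly (\<lambda>x. f x + g x)"
  unfolding is_poly_def by (metis poly_add)

lemma is_poly_mult [intro]: "is_poly f \<Longrightarrow> is_poly g \<Longrightarrow> is_poly (\<lambda>x. f x * g x)"
  unfolding is_poly_def by (metis poly_mult)

lemma is_poly_power [intro]: "is_poly f \<Longrightarrow> is_poly (\<lambda>x. f x ^ n)"
  unfolding is_poly_def by (metis poly_power)

lemma is_poly_compose: "is_poly f \<Longrightarrow> is_poly g \<Longrightarrow> is_poly (\<lambda>x. f (g x))"
  unfolding is_poly_def by (metis poly_pcompose)

lemma is_poly_value_length: "is_poly (\<lambda>X. value_length X e)"
  by (induction e) (auto simp del: add_Suc_right)

lemma is_poly_aexp_cost: "is_poly (\<lambda>X. aexp_cost X e)"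
  by (induction e) (auto simp del: add_Suc_right intro!: is_poly_add is_poly_value_length)

lemma is_poly_com_cost: "is_poly (\<lambda>X. com_cost X c)"
  by (induction c)
    (auto simp del: add_Suc_right intro!: is_poly_add is_poly_mult is_poly_value_length is_poly_aexp_cost)

section \<open>Frame conditions and total correctness with cost\<close>

fun reads :: "aexp \<Rightarrow> nat set" where
  "reads (Const n) = {}"
| "reads (Cell a e) = insert a (reads e)"
| "reads (Add e f) = reads e \<union> reads f"
| "reads (Sub e f) = reads e \<union> reads f"
| "reads (Mul e f) = reads e \<union> reads f"
| "reads (Div e f) = reads e \<union> reads f"

fun writes :: "com \<Rightarrow> nat set" where
  "writes Skip = {}"
| "writes (Assign a e f) = {a}"
| "writes (Seq c d) = writes c \<union> writes d"
| "writes (If e c d) = writes c \<union> writes d"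
| "writes (While e c) = writes c"

lemma aval_cong: "(\<And>a. a \<in> reads e \<Longrightarrow> s a = s' a) \<Longrightarrow> aval e s = aval e s'"
  by (induction e) simp_all

text \<open>The frame condition of all program proofs: it lets loop invariants leave out the arrays
  that a loop does not write.\<close>

definition agree_off :: "nat set \<Rightarrow> store \<Rightarrow> store \<Rightarrow> bool" where
  "agree_off A s s' \<longleftrightarrow> (\<forall>a. a \<notin> A \<longrightarrow> s' a = s a)"

lemma run_agree_off: "run c s t s' \<Longrightarrow> agree_off (writes c) s s'"
  by (induction rule: run.induct) (auto simp: agree_off_def)

text \<open>Termination, static cost and preservation of the bound on cells in one predicate. No
  cost is tracked along the way, as it is fixed by \<open>c\<close> and \<open>X\<close>. A
  postcondition may itself be a \<open>wp\<close>, which gives sequential composition.\<close>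

definition wp :: "nat \<Rightarrow> com \<Rightarrow> (store \<Rightarrow> bool) \<Rightarrow> store \<Rightarrow> bool" where
  "wp X c Q s \<longleftrightarrow>
     (bounded_store X s \<longrightarrow>
       (\<exists>t s'. run c s t s' \<and> t \<le> com_cost X c \<and> bounded_store X s' \<and> Q s'))"

lemma wp_conseq:
  assumes "wp X c R s" "\<And>s'. agree_off (writes c) s s' \<Longrightarrow> R s' \<Longrightarrow> Q s'"
  shows "wp X c Q s"
  using assms run_agree_off[of c s] unfolding wp_def by blast

lemma wp_Skip: "Q s \<Longrightarrow> wp X Skip Q s"
  unfolding wp_def using run.Skip[of s] by fastforce

definition store_upd :: "nat \<Rightarrow> nat \<Rightarrow> nat \<Rightarrow> store \<Rightarrow> store" where
  "store_upd a j v s = s(a := (s a)(j := v))"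

lemma store_upd_apply [simp]:
  "store_upd a j v s b = (if b = a then (s a)(j := v) else s b)"
  by (simp add: store_upd_def)

text \<open>Only the stored value has to be below \<open>2 ^ X\<close>; intermediate values may be
  larger, since \<open>value_length\<close> already accounts for them.\<close>

lemma wp_Assign:
  assumes "bounded_store X s \<Longrightarrow> aval f s < 2 ^ X" "Q (store_upd a (aval e s) (aval f s) s)"
  shows "wp X (Assign a e f) Q s"
  unfolding wp_def
proof
  assume b: "bounded_store X s"
  have "acost e s + acost f s + bit_length (aval e s) + bit_length (aval f s) \<le>
      com_cost X (Assign a e f)"
    using acost_le[OF b] bit_length_aval[OF b] by (auto intro!: add_mono)
  moreover have "bounded_store X (store_upd a (aval e s) (aval f s) s)"
    using b assms(1)[OF b] by (auto simp: bounded_store_def)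
  ultimately show "\<exists>t s'. run (Assign a e f) s t s' \<and> t \<le> com_cost X (Assign a e f) \<and>
      bounded_store X s' \<and> Q s'"
    using run.Assign[of a e f s] assms(2) unfolding store_upd_def by blast
qed

lemma wp_Seq: "wp X c (wp X d Q) s \<Longrightarrow> wp X (Seq c d) Q s"
  unfolding wp_def by (fastforce intro: run.Seq)

lemma wp_If:
  assumes "aval e s \<noteq> 0 \<Longrightarrow> wp X c Q s" "aval e s = 0 \<Longrightarrow> wp X d Q s"
  shows "wp X (If e c d) Q s"
  unfolding wp_def
proof
  assume b: "bounded_store X s"
  have le: "acost e s + bit_length (aval e s) \<le> aexp_cost X e + value_length X e"
    using acost_le[OF b, of e] bit_length_aval[OF b, of e] by linarith
  show "\<exists>t s'. run (If e c d) s t s' \<and> t \<le> com_cost X (If e c d) \<and> bounded_store X s' \<and> Q s'"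
  proof (cases "aval e s = 0")
    case True
    then obtain t s' where "run d s t s'" "t \<le> com_cost X d" "bounded_store X s'" "Q s'"
      using assms(2) b unfolding wp_def by blast
    then show ?thesis
      using run.IfFalse[OF True] le by (intro exI[of _ "_ + t"] exI[of _ s']) auto
  next
    case False
    then obtain t s' where "run c s t s'" "t \<le> com_cost X c" "bounded_store X s'" "Q s'"
      using assms(1) b unfolding wp_def by blast
    then show ?thesis
      using run.IfTrue[OF False] le by (intro exI[of _ "_ + t"] exI[of _ s']) auto
  qed
qed

text \<open>The initial value of the variant bounds the number of iterations, so
  \<open>\<mu> s0 \<le> X\<close> pays for the factor \<open>X\<close> in \<open>com_cost\<close>;
  the summand outside of it pays for the last evaluation of the condition.\<close>

lemma wp_While:
  assumes init: "I s0" "\<mu> s0 \<le> X"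
    and step: "\<And>s. agree_off (writes c) s0 s \<Longrightarrow> I s \<Longrightarrow> aval e s \<noteq> 0 \<Longrightarrow>
      wp X c (\<lambda>s'. I s' \<and> (\<mu> s' :: nat) < \<mu> s) s"
    and exit: "\<And>s. agree_off (writes c) s0 s \<Longrightarrow> I s \<Longrightarrow> aval e s = 0 \<Longrightarrow> Q s"
  shows "wp X (While e c) Q s0"
  unfolding wp_def
proof
  let ?C = "aexp_cost X e + value_length X e"
  have *: "\<exists>t s'. run (While e c) s t s' \<and> t \<le> ?C + n * (?C + com_cost X c) \<and>
      bounded_store X s' \<and> Q s'"
    if "bounded_store X s" "agree_off (writes c) s0 s" "I s" "\<mu> s \<le> n" for s n
    using that
  proof (induction n arbitrary: s rule: less_induct)
    case (less n)
    have le: "acost e s + bit_length (aval e s) \<le> ?C"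
      using acost_le[OF less.prems(1), of e] bit_length_aval[OF less.prems(1), of e] by linarith
    show ?case
    proof (cases "aval e s = 0")
      case True
      then show ?thesis
        using run.WhileFalse[OF True] less.prems exit le trans_le_add1 by blast
    next
      case False
      obtain t s' where 1: "run c s t s'" "t \<le> com_cost X c" "bounded_store X s'" "I s'"
        "\<mu> s' < \<mu> s"
        using step[OF less.prems(2,3) False] less.prems(1) unfolding wp_def by blast
      from 1(5) less.prems(4) obtain n' where n: "n = Suc n'" "\<mu> s' \<le> n'"
        by (cases n) auto
      have "agree_off (writes c) s0 s'"
        using run_agree_off[OF 1(1)] less.prems(2) by (simp add: agree_off_def)
      then obtain u s'' where 2: "run (While e c) s' u s''" "u \<le> ?C + n' * (?C + com_cost X c)"
        "bounded_store X s''" "Q s''"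
        using less.IH[of n' s'] 1 n by auto
      have "acost e s + bit_length (aval e s) + t + u \<le> ?C + n * (?C + com_cost X c)"
        using le 1(2) 2(2) n(1) by simp
      then show ?thesis
        using run.WhileTrue[OF False 1(1) 2(1)] 2 by blast
    qed
  qed
  assume "bounded_store X s0"
  then obtain t s' where 1: "run (While e c) s0 t s'" "t \<le> ?C + \<mu> s0 * (?C + com_cost X c)"
      "bounded_store X s'" "Q s'"
    using *[of s0 "\<mu> s0"] init by (auto simp: agree_off_def)
  have "t \<le> com_cost X (While e c)"
    using 1(2) mult_le_mono1[OF init(2), of "?C + com_cost X c"]
    unfolding com_cost.simps by linarith
  with 1 show "\<exists>t s'. run (While e c) s0 t s' \<and> t \<le> com_cost X (While e c) \<and>
      bounded_store X s' \<and> Q s'" by blast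
qed

abbreviation Var :: "nat \<Rightarrow> aexp" where
  "Var v \<equiv> Cell v (Const 0)"

abbreviation Set :: "nat \<Rightarrow> aexp \<Rightarrow> com" where
  "Set v \<equiv> Assign v (Const 0)"

definition For :: "nat \<Rightarrow> aexp \<Rightarrow> com \<Rightarrow> com" where
  "For v e c = Seq (Set v (Const 0)) (While (Sub e (Var v)) (Seq c (Set v (Add (Var v) (Const 1)))))"

lemma writes_For [simp]: "writes (For v e c) = insert v (writes c)"
  by (auto simp: For_def)

lemma le_imp_less_power: "n \<le> X \<Longrightarrow> n < (2::nat) ^ X"
  using less_exp order_le_less_trans by blast

text \<open>The bound \<open>e\<close> is evaluated anew in every round; it keeps its value because
  it reads neither the counter nor an array written by the body. The invariant refers to stores
  whose counter is already updated, hence the \<open>store_upd\<close> in the obligation for the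
  body.\<close>

lemma wp_For:
  assumes v: "v \<notin> writes c" "insert v (writes c) \<inter> reads e = {}"
    and n: "aval e s0 = n" "n \<le> X"
    and init: "I 0 (store_upd v 0 0 s0)"
    and step: "\<And>k s. k < n \<Longrightarrow> s v 0 = k \<Longrightarrow> agree_off (insert v (writes c)) s0 s \<Longrightarrow> I k s \<Longrightarrow>
      wp X c (\<lambda>s'. I (Suc k) (store_upd v 0 (Suc k) s')) s"
    and exit: "\<And>s. agree_off (insert v (writes c)) s0 s \<Longrightarrow> I n s \<Longrightarrow> Q s"
  shows "wp X (For v e c) Q s0"
  unfolding For_def
proof (rule wp_Seq, rule wp_Assign)
  let ?s = "store_upd v 0 0 s0"
  have val: "aval e s = n" if "agree_off (insert v (writes c)) s0 s" for s
    unfolding n(1)[symmetric]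
    by (rule aval_cong) (use that v(2) in \<open>unfold agree_off_def, blast\<close>)
  show "wp X (While (Sub e (Var v)) (Seq c (Set v (Add (Var v) (Const 1))))) Q
     (store_upd v (aval (Const 0) s0) (aval (Const 0) s0) s0)"
  proof (rule wp_While[where I = "\<lambda>s. s v 0 \<le> n \<and> I (s v 0) s" and \<mu> = "\<lambda>s. n - s v 0"],
      goal_cases)
    case 1
    then show ?case using init by simp
  next
    case 2
    then show ?case using n by simp
  next
    case (3 s)
    have a: "agree_off (insert v (writes c)) s0 s"
      using 3(1) by (auto simp: agree_off_def split: if_splits)
    have lt: "s v 0 < n" using 3(2,3) val[OF a] by simp
    show ?case
    proof (rule wp_Seq, rule wp_conseq[OF step[OF lt refl a]])
      show "I (s v 0) s" using 3 by simp
      fix s' assume s': "agree_off (writes c) s s'" "I (Suc (s v 0)) (store_upd v 0 (Suc (s v 0)) s')"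
      have eq: "s' v 0 = s v 0" using s' v(1) by (simp add: agree_off_def)
      show "wp X (Set v (Add (Var v) (Const 1)))
          (\<lambda>s'. (s' v 0 \<le> n \<and> I (s' v 0) s') \<and> n - s' v 0 < n - s v 0) s'"
        using lt eq s'(2) n(2) le_imp_less_power[of "Suc (s v 0)" X]
        by (intro wp_Assign) auto
    qed
  next
    case (4 s)
    have a: "agree_off (insert v (writes c)) s0 s"
      using 4(1) by (auto simp: agree_off_def split: if_splits)
    have "s v 0 = n" using 4(2,3) val[OF a] by simp
    then show ?case using exit[OF a] 4(2) by simp
  qed
qed (simp_all add: init)

section \<open>Greedy maximisation of a submodular function under a budget\<close>

lemma finite_maximizer:
  fixes g :: "'a \<Rightarrow> 'b :: linorder"
  assumes "finite A" "A \<noteq> {}"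
  obtains x where "x \<in> A" "\<And>y. y \<in> A \<Longrightarrow> g y \<le> g x"
proof -
  have "Max (g ` A) \<in> g ` A" using assms by (intro Max_in) auto
  then obtain x where x: "x \<in> A" "Max (g ` A) = g x" by blast
  have "g y \<le> g x" if "y \<in> A" for y
    unfolding x(2)[symmetric] using assms(1) that by (intro Max_ge) auto
  with x(1) show ?thesis using that by blast
qed

locale budgeted_submodular =
  fixes m :: nat and k :: "nat \<Rightarrow> nat" and N :: nat and f :: "nat set \<Rightarrow> real"
  assumes size_pos: "b < m \<Longrightarrow> 0 < k b"
    and f_empty: "f {} = 0"
    and f_mono: "X \<subseteq> Y \<Longrightarrow> Y \<subseteq> {..<m} \<Longrightarrow> f X \<le> f Y"
    and f_submodular: "X \<subseteq> {..<m} \<Longrightarrow> Y \<subseteq> {..<m} \<Longrightarrow> f (X \<union> Y) + f (X \<inter> Y) \<le> f X + f Y"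
begin

abbreviation cost :: "nat set \<Rightarrow> nat" where
  "cost S \<equiv> sum k S"

abbreviation marginal :: "nat set \<Rightarrow> nat \<Rightarrow> real" where
  "marginal S b \<equiv> f (insert b S) - f S"

definition fits :: "nat set \<Rightarrow> nat \<Rightarrow> bool" where
  "fits S b \<longleftrightarrow> b < m \<and> b \<notin> S \<and> cost S + k b \<le> N"

text \<open>Densities are compared after cross multiplication, the form in which the program
  compares them in natural numbers.\<close>

definition best_fit :: "nat set \<Rightarrow> nat \<Rightarrow> bool" where
  "best_fit S b \<longleftrightarrow> fits S b \<and>
     (\<forall>b'. fits S b' \<longrightarrow> marginal S b' * real (k b) \<le> marginal S b * real (k b'))"

text \<open>A relation and not a function, since ties may be broken in any way. It also contains
  unfinished runs; completion is stated separately as \<open>\<not> fits S b\<close> for all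
  \<open>b\<close>.\<close>

inductive greedy :: "nat set \<Rightarrow> nat set \<Rightarrow> bool" for Y where
  refl: "greedy Y Y"
| step: "greedy Y S \<Longrightarrow> best_fit S b \<Longrightarrow> greedy Y (insert b S)"

lemma marginal_nonneg: "b < m \<Longrightarrow> S \<subseteq> {..<m} \<Longrightarrow> 0 \<le> marginal S b"
  using f_mono[of S "insert b S"] by auto

lemma f_nonneg: "S \<subseteq> {..<m} \<Longrightarrow> 0 \<le> f S"
  using f_mono[of "{}" S] f_empty by simp

text \<open>Diminishing returns: submodularity is applied to \<open>insert b X\<close> and
  \<open>Y\<close>, whose intersection is \<open>X\<close> unless \<open>b\<close> lies in
  \<open>Y\<close>; if it does, the left side is 0.\<close>

lemma marginal_antimono:
  assumes "X \<subseteq> Y" "Y \<subseteq> {..<m}" "b < m"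
  shows "marginal Y b \<le> marginal X b"
proof (cases "b \<in> Y")
  case True
  then show ?thesis using marginal_nonneg[of b X] assms by (simp add: insert_absorb)
next
  case False
  have "insert b X \<union> Y = insert b Y" "insert b X \<inter> Y = X"
    using assms(1) False by auto
  moreover have "f (insert b X \<union> Y) + f (insert b X \<inter> Y) \<le> f (insert b X) + f Y"
    by (rule f_submodular) (use assms in auto)
  ultimately show ?thesis by simp
qed

text \<open>When the elements of \<open>U\<close> are added to \<open>S\<close> one at a time, each
  gains at most what it would gain at \<open>S\<close> itself.\<close>

lemma sum_marginals:
  assumes "S \<subseteq> {..<m}" "U \<subseteq> {..<m}"
  shows "f U - f S \<le> (\<Sum>b\<in>U - S. marginal S b)"
proof -
  have "finite U" using assms(2) finite_subset by blast
  then have "f (S \<union> U) - f S \<le> (\<Sum>b\<in>U - S. marginal S b)" using assms(2)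
  proof (induction U rule: finite_induct)
    case (insert x U)
    show ?case
    proof (cases "x \<in> S")
      case True
      then have "S \<union> insert x U = S \<union> U" "insert x U - S = U - S" by auto
      then show ?thesis using insert by simp
    next
      case False
      then have "(\<Sum>b\<in>insert x U - S. marginal S b) = marginal S x + (\<Sum>b\<in>U - S. marginal S b)"
        using insert by (simp add: insert_Diff_if)
      moreover have "marginal (S \<union> U) x \<le> marginal S x"
        using marginal_antimono[of S "S \<union> U" x] insert.prems assms(1) by auto
      ultimately show ?thesis using insert by simp
    qed
  qed simp
  moreover have "f U \<le> f (S \<union> U)" using f_mono[of U "S \<union> U"] assms by auto
  ultimately show ?thesis by simp
qed

lemma greedy_subset: "greedy Y S \<Longrightarrow> Y \<subseteq> {..<m} \<Longrightarrow> Y \<subseteq> S \<and> S \<subseteq> {..<m}"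
  by (induction rule: greedy.induct) (auto simp: best_fit_def fits_def)

text \<open>The gap \<open>f U - f S\<close> is at most the sum of the marginals of
  \<open>U - S\<close>, hence at most the density of \<open>b\<close> times
  \<open>cost (U - S)\<close>, and this cost is at most \<open>N - cost Y\<close>. So
  \<open>b\<close> closes at least the share \<open>k b / (N - cost Y)\<close> of the gap, and
  \<open>1 - t \<le> exp (- t)\<close> holds for every real \<open>t\<close>. The item
  \<open>b\<close> may exceed the budget: the statement is applied to the first item that does not
  fit as well.\<close>

lemma dense_item_progress:
  assumes S: "Y \<subseteq> S" "S \<subseteq> {..<m}" and U: "Y \<subseteq> U" "U \<subseteq> {..<m}" "cost U \<le> N"
    and b: "b < m"
    and dense: "\<And>u. u \<in> U - S \<Longrightarrow> marginal S u * real (k b) \<le> marginal S b * real (k u)"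
    and room: "cost Y < N"
    and S_bound: "f U - f S \<le> exp (- x) * (f U - f Y)"
  shows "f U - f (insert b S) \<le> exp (- (x + real (k b) / real (N - cost Y))) * (f U - f Y)"
proof -
  define B where "B = real (N - cost Y)"
  have B: "0 < B" using room unfolding B_def of_nat_0_less_iff by simp
  have kb: "0 < real (k b)" using size_pos[OF b] by simp
  have G: "0 \<le> f U - f Y" using f_mono[OF U(1,2)] by simp
  have marg: "0 \<le> marginal S b" using marginal_nonneg[OF b S(2)] .
  have fin: "finite U" using U(2) finite_subset by blast
  show ?thesis
  proof (cases "f U \<le> f S")
    case True
    then have "f U - f (insert b S) \<le> 0" using marg by simp
    also have "0 \<le> exp (- (x + real (k b) / real (N - cost Y))) * (f U - f Y)"
      using G by simp
    finally show ?thesis .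
  next
    case False
    have "(f U - f S) * real (k b) \<le> (\<Sum>u\<in>U - S. marginal S u) * real (k b)"
      using sum_marginals[OF S(2) U(2)] by (intro mult_right_mono) auto
    also have "\<dots> \<le> (\<Sum>u\<in>U - S. marginal S b * real (k u))"
      unfolding sum_distrib_right by (intro sum_mono dense)
    also have "\<dots> = marginal S b * real (cost (U - S))"
      by (simp add: sum_distrib_left)
    also have "\<dots> \<le> marginal S b * B"
    proof (intro mult_left_mono marg)
      have "cost (U - S) \<le> cost (U - Y)"
        using S(1) fin by (intro sum_mono2) auto
      also have "\<dots> = cost U - cost Y"
        by (intro sum_diff_nat U finite_subset[OF U(1) fin])
      finally show "real (cost (U - S)) \<le> B" using U(3) unfolding B_def by linarith
    qed
    finally have "(f U - f S) * (real (k b) / B) \<le> marginal S b"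
      using B by (simp add: field_simps)
    then have "f U - f (insert b S) \<le> (1 - real (k b) / B) * (f U - f S)"
      by (simp add: algebra_simps)
    also have "\<dots> \<le> exp (- (real (k b) / B)) * (f U - f S)"
      using False exp_ge_add_one_self[of "- (real (k b) / B)"] by (intro mult_right_mono) auto
    also have "\<dots> \<le> exp (- (real (k b) / B)) * (exp (- x) * (f U - f Y))"
      using S_bound by (intro mult_left_mono) auto
    also have "\<dots> = exp (- (x + real (k b) / B)) * (f U - f Y)"
      unfolding mult.assoc[symmetric] exp_add[symmetric] by (simp add: add.commute)
    finally show ?thesis by (simp add: B_def)
  qed
qed

text \<open>As long as the densest missing item of \<open>U\<close> fits, the gap to \<open>f U\<close> shrinks exponentially. Once it
  does not fit, adding it would use more than the whole budget and thus close the gap up to the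
  factor \<open>exp (-1) * (N / (N + 1))\<close>; leaving it out loses at most \<open>f Y / 3\<close>.\<close>

lemma greedy_invariant:
  assumes U: "Y \<subseteq> U" "U \<subseteq> {..<m}" "cost U \<le> N"
    and small: "\<And>r. r \<in> U - Y \<Longrightarrow> marginal Y r \<le> f Y / 3"
    and greedy: "greedy Y S"
  shows "2 / 3 * f Y + (1 - exp (-1) * (N / (N + 1))) * (f U - f Y) \<le> f S \<or>
    (f U - f S \<le> exp (- (real (cost S - cost Y) / real (N - cost Y))) * (f U - f Y) \<and>
     (U \<subseteq> S \<or> (\<exists>b. fits S b)))"
proof -
  define D where "D = 2 / 3 * f Y + (1 - exp (-1) * (N / (N + 1))) * (f U - f Y)"
  define A where "A S \<longleftrightarrow>
    f U - f S \<le> exp (- (real (cost S - cost Y) / real (N - cost Y))) * (f U - f Y)" for S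
  have G: "0 \<le> f U - f Y" using f_mono[OF U(1,2)] by simp
  have fin: "finite U" using U(2) finite_subset by blast
  have costY: "cost Y \<le> cost U" using sum_mono2[OF fin U(1), where f = k] by simp
  \<comment> \<open>The second alternative arises only for \<open>U \<subseteq> S\<close>, where it
    is vacuous. The third one provides the densest missing item of \<open>U\<close> for the
    comparison with the best fit.\<close>
  have key: "D \<le> f S \<or> (\<forall>u\<in>U - S. fits S u) \<or>
      (\<exists>r. fits S r \<and> (\<forall>u\<in>U - S. marginal S u * real (k r) \<le> marginal S r * real (k u)))"
    if S: "Y \<subseteq> S" "S \<subseteq> {..<m}" and AS: "A S" for S
  proof (cases "U - S = {}")
    case False
    have finS: "finite S" using S(2) finite_subset by blast
    define ratio where "ratio u = marginal S u / real (k u)" for u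
    obtain r where r: "r \<in> U - S" and rmax: "\<And>u. u \<in> U - S \<Longrightarrow> ratio u \<le> ratio r"
      using finite_maximizer[OF finite_Diff[OF fin] False, where g = ratio] by blast
    have rm: "r < m" using r U(2) by blast
    have dense: "marginal S u * real (k r) \<le> marginal S r * real (k u)" if "u \<in> U - S" for u
      using rmax[OF that] that size_pos[OF rm] size_pos[of u] U(2) by (auto simp: ratio_def field_simps)
    show ?thesis
    proof (cases "fits S r")
      case True
      then show ?thesis using dense by blast
    next
      case False
      then have over: "N < cost S + k r" using r rm by (auto simp: fits_def)
      have "r \<in> U - Y" using r S by auto
      then have "insert r Y \<subseteq> U" "r \<notin> Y" using U by auto
      then have "cost (insert r Y) \<le> cost U" using sum_mono2[OF fin] by blast
      moreover have "finite Y" using fin U(1) finite_subset by blast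
      ultimately have "cost Y + k r \<le> N" using U(3) \<open>r \<notin> Y\<close> by simp
      then have room: "cost Y < N" using size_pos[OF rm] by simp
      define B where "B = real (N - cost Y)"
      have B: "1 \<le> B" "B \<le> N" using room unfolding B_def by linarith+
      have le: "cost Y \<le> cost S" using sum_mono2[OF finS S(1), where f = k] by simp
      have "f U - f (insert r S) \<le>
          exp (- (real (cost S - cost Y) / real (N - cost Y) + real (k r) / real (N - cost Y))) * (f U - f Y)"
        using AS unfolding A_def by (intro dense_item_progress[OF S U rm dense room]) auto
      also have "real (cost S - cost Y) / real (N - cost Y) + real (k r) / real (N - cost Y) =
          real (cost S - cost Y + k r) / B"
        by (simp add: B_def add_divide_distrib)
      also have "exp (- (real (cost S - cost Y + k r) / B)) * (f U - f Y) \<le>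
          exp (-1) * (N / (N + 1)) * (f U - f Y)"
      proof (intro mult_right_mono G)
        \<comment> \<open>This 1 raises the exponent to \<open>1 + 1 / B\<close>, and
          \<open>exp (1 / B) \<ge> 1 + 1 / B\<close> turns it into the factor
          \<open>B / (B + 1)\<close>.\<close>
        have "real (N - cost Y) + 1 \<le> real (cost S - cost Y + k r)"
          using over le room by linarith
        then have "(B + 1) / B \<le> real (cost S - cost Y + k r) / B"
          using B by (intro divide_right_mono) (simp_all add: B_def del: of_nat_sum of_nat_diff)
        then have "exp (- (real (cost S - cost Y + k r) / B)) \<le> exp (- ((B + 1) / B))"
          by simp
        also have "(B + 1) / B = 1 + 1 / B" using B by (simp add: field_simps)
        also have "exp (- (1 + 1 / B)) = exp (-1) * inverse (exp (1 / B))"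
          by (simp add: exp_minus[symmetric] exp_add[symmetric])
        also have "\<dots> \<le> exp (-1) * inverse (1 + 1 / B)"
          using exp_ge_add_one_self[of "1 / B"] B
          by (intro mult_left_mono le_imp_inverse_le) (auto intro: add_pos_nonneg)
        also have "inverse (1 + 1 / B) = B / (B + 1)" using B by (simp add: field_simps)
        also have "exp (-1) * (B / (B + 1)) \<le> exp (-1) * (N / (N + 1))"
          using B by (intro mult_left_mono) (auto simp: field_simps)
        finally show "exp (- (real (cost S - cost Y + k r) / B)) \<le> exp (-1) * (N / (N + 1))" .
      qed
      finally have "f U - f (insert r S) \<le> exp (-1) * (N / (N + 1)) * (f U - f Y)" .
      moreover have "marginal S r \<le> f Y / 3"
        using marginal_antimono[OF S rm] small[OF \<open>r \<in> U - Y\<close>] by simp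
      ultimately have "D \<le> f S" unfolding D_def by (simp add: algebra_simps)
      then show ?thesis by blast
    qed
  qed auto
  from greedy have "D \<le> f S \<or> A S"
  proof (induction rule: greedy.induct)
    case refl
    then show ?case by (simp add: A_def)
  next
    case (step S b)
    have S: "Y \<subseteq> S" "S \<subseteq> {..<m}" using greedy_subset[OF step.hyps(1)] U by auto
    have b: "b < m" "b \<notin> S" "cost S + k b \<le> N"
      using step.hyps(2) by (auto simp: best_fit_def fits_def)
    have finS: "finite S" using S(2) finite_subset by blast
    have mono: "f S \<le> f (insert b S)" using marginal_nonneg[OF b(1) S(2)] by simp
    consider "D \<le> f S" | "A S" "\<forall>u\<in>U - S. fits S u"
      | r where "A S" "fits S r" "\<forall>u\<in>U - S. marginal S u * real (k r) \<le> marginal S r * real (k u)"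
      using step.IH key[OF S] by blast
    then show ?case
    proof cases
      case 1
      then show ?thesis using mono by linarith
    next
      have *: "A (insert b S)" if AS: "A S" and
        dense: "\<And>u. u \<in> U - S \<Longrightarrow> marginal S u * real (k b) \<le> marginal S b * real (k u)"
      proof -
        have le: "cost Y \<le> cost S" using sum_mono2[OF finS S(1), where f = k] by simp
        have room: "cost Y < N" using le b(3) size_pos[OF b(1)] by linarith
        have eq: "cost (insert b S) - cost Y = (cost S - cost Y) + k b" using finS b le by simp
        show ?thesis
          unfolding A_def eq of_nat_add add_divide_distrib
          using AS[unfolded A_def] dense b(1) by (intro dense_item_progress[OF S U _ _ room]) auto
      qed
      {
        case 2
        then show ?thesis using * step.hyps(2) by (auto simp: best_fit_def)
      next
        case 3
        have "marginal S u * real (k b) \<le> marginal S b * real (k u)" if u: "u \<in> U - S" for u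
        proof -
          have r: "r < m" using 3 by (simp add: fits_def)
          have pos: "0 < real (k r)" using size_pos[OF r] by simp
          \<comment> \<open>\<open>b\<close> is at least as dense as \<open>r\<close>, and
            \<open>r\<close> at least as dense as \<open>u\<close>; the positive \<open>k r\<close>
            cancels at the end.\<close>
          have "marginal S u * real (k r) * real (k b) \<le> marginal S r * real (k u) * real (k b)"
            using 3(3) u by (intro mult_right_mono) auto
          also have "\<dots> = marginal S r * real (k b) * real (k u)" by simp
          also have "\<dots> \<le> marginal S b * real (k r) * real (k u)"
            using 3(2) step.hyps(2) by (intro mult_right_mono) (auto simp: best_fit_def)
          finally have "marginal S u * real (k b) * real (k r) \<le> marginal S b * real (k u) * real (k r)"
            by (simp add: mult_ac)
          then show ?thesis using pos by simp
        qed
        then show ?thesis using * 3(1) by blast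
      }
    qed
  qed
  then show ?thesis
    using key[of S] greedy_subset[OF greedy] U
    unfolding D_def[symmetric] A_def[symmetric] by blast
qed

text \<open>The constant is chosen for \<open>1 - 103 / 300 + 1 / 100 = 2 / 3\<close>, exactly what
  the coefficient of \<open>f Y\<close> in the greedy bound allows. The tenth power of
  \<open>9 / 10\<close>, about 0.349, is just good enough.\<close>

lemma exp_minus_one_ge: "103 / 300 \<le> exp (-1 :: real)"
proof -
  have "(9 / 10) ^ 10 \<le> exp (- (1 / 10) :: real) ^ 10"
    using exp_ge_add_one_self[of "- (1 / 10) :: real"] by (intro power_mono) auto
  also have "\<dots> = exp (-1)" by (simp add: exp_of_nat_mult[symmetric])
  finally show ?thesis by (simp add: power_divide)
qed

text \<open>With \<open>f U\<close> split into \<open>f Y\<close> and \<open>f U - f Y\<close>, both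
  coefficients of the invariant, \<open>2 / 3\<close> and
  \<open>1 - exp (-1) * (N / (N + 1))\<close>, are at least the ratio. The second one exceeds
  \<open>1 - exp (-1)\<close> by \<open>exp (-1) / (N + 1)\<close>, which is more than the surplus
  claimed.\<close>

lemma greedy_ratio:
  assumes U: "Y \<subseteq> U" "U \<subseteq> {..<m}" "cost U \<le> N"
    and small: "\<And>r. r \<in> U - Y \<Longrightarrow> marginal Y r \<le> f Y / 3"
    and greedy: "greedy Y S" and stop: "\<And>b. \<not> fits S b"
  shows "(1 - exp (-1) + 1 / (100 * (real N + 1))) * f U \<le> f S"
proof -
  let ?c = "1 - exp (-1) + 1 / (100 * (real N + 1)) :: real"
  have e: "103 / 300 \<le> exp (-1 :: real)" by (rule exp_minus_one_ge)
  have G: "0 \<le> f U - f Y" using f_mono[OF U(1,2)] by simp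
  have Y: "0 \<le> f Y" using f_nonneg U by blast
  have d: "1 / (100 * (real N + 1)) \<le> 1 / 100" by (simp add: field_simps)
  have c1: "?c \<le> 2 / 3" using e d by linarith
  have "1 / 100 * (1 / (real N + 1)) \<le> exp (-1) * (1 / (real N + 1))"
    using e by (intro mult_right_mono) auto
  then have c2: "?c \<le> 1 - exp (-1) * (N / (N + 1))" by (simp add: field_simps)
  have c3: "?c \<le> 1" using c1 by linarith
  from greedy_invariant[OF U small greedy] stop
  consider "2 / 3 * f Y + (1 - exp (-1) * (N / (N + 1))) * (f U - f Y) \<le> f S" | "U \<subseteq> S"
    by blast
  then show ?thesis
  proof cases
    case 1
    have "?c * f U = ?c * f Y + ?c * (f U - f Y)" unfolding distrib_left[symmetric] by simp
    also have "\<dots> \<le> 2 / 3 * f Y + (1 - exp (-1) * (N / (N + 1))) * (f U - f Y)"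
      using c1 c2 G Y by (intro add_mono mult_right_mono) auto
    finally show ?thesis using 1 by linarith
  next
    case 2
    have "?c * f U \<le> 1 * f U" using c3 f_nonneg[OF U(2)] by (intro mult_right_mono) auto
    also have "\<dots> \<le> f S" using f_mono[OF 2] greedy_subset[OF greedy] U by auto
    finally show ?thesis .
  qed
qed

text \<open>Picking each of the three items to maximise the value gained so far bounds the marginal
  of any other item by each of the three successive gains, hence by their average.\<close>

lemma seed_triple:
  assumes U: "U \<subseteq> {..<m}" "U \<noteq> {}"
  obtains y1 y2 y3 where "y1 \<in> U" "y2 \<in> U" "y3 \<in> U"
    "\<And>r. r \<in> U \<Longrightarrow> marginal {y1, y2, y3} r \<le> f {y1, y2, y3} / 3"
proof -
  have fin: "finite U" using U(1) finite_subset by blast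
  have best: "\<exists>y\<in>U. \<forall>r\<in>U. f (insert r S) \<le> f (insert y S)" for S
  proof (rule finite_maximizer[OF fin U(2), where g = "\<lambda>y. f (insert y S)"])
    fix x assume "x \<in> U" "\<And>y. y \<in> U \<Longrightarrow> f (insert y S) \<le> f (insert x S)"
    then show ?thesis by (intro bexI ballI)
  qed
  obtain y1 where y1: "y1 \<in> U" "\<And>r. r \<in> U \<Longrightarrow> f {r} \<le> f {y1}"
    using best[of "{}"] by blast
  obtain y2 where y2: "y2 \<in> U" "\<And>r. r \<in> U \<Longrightarrow> f {r, y1} \<le> f {y2, y1}"
    using best[of "{y1}"] by blast
  obtain y3 where y3: "y3 \<in> U" "\<And>r. r \<in> U \<Longrightarrow> f {r, y2, y1} \<le> f {y3, y2, y1}"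
    using best[of "{y2, y1}"] by blast
  have eq: "{y1, y2, y3} = {y3, y2, y1}" by auto
  have "marginal {y1, y2, y3} r \<le> f {y1, y2, y3} / 3" if r: "r \<in> U" for r
  proof -
    have r': "r < m" and sub: "{y3, y2, y1} \<subseteq> {..<m}" using r y1 y2 y3 U by auto
    \<comment> \<open>Each right side is at most the gain of one pick, and the three gains add up to
      \<open>f {y1, y2, y3}\<close> because \<open>f {} = 0\<close>. The picks may coincide, which
      covers sets \<open>U\<close> of one or two items.\<close>
    have "marginal {y3, y2, y1} r \<le> marginal {} r"
      "marginal {y3, y2, y1} r \<le> marginal {y1} r"
      "marginal {y3, y2, y1} r \<le> marginal {y2, y1} r"
      by (intro marginal_antimono[OF _ sub r']; blast)+
    then show ?thesis
      using y1(2)[OF r] y2(2)[OF r] y3(2)[OF r] f_empty unfolding eq by simp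
  qed
  with y1(1) y2(1) y3(1) show ?thesis using that by blast
qed

end

section \<open>Filling seminars by an auction\<close>

type_synonym profits = "nat \<Rightarrow> nat \<Rightarrow> nat"

text \<open>As in array 1, \<open>w i = 0\<close> means that student \<open>i\<close> is unassigned, and \<open>w i = b + 1\<close> that
  \<open>i\<close> attends seminar \<open>b\<close>.\<close>

definition attendance :: "nat \<Rightarrow> (nat \<Rightarrow> nat) \<Rightarrow> nat \<Rightarrow> nat" where
  "attendance N w b = card {i\<in>{..<N}. w i = Suc b}"

definition exact_fill :: "nat \<Rightarrow> nat \<Rightarrow> (nat \<Rightarrow> nat) \<Rightarrow> nat set \<Rightarrow> (nat \<Rightarrow> nat) \<Rightarrow> bool" where
  "exact_fill N m k S w \<longleftrightarrow>
     (\<forall>i<N. w i \<le> m) \<and> (\<forall>b<m. attendance N w b = (if b \<in> S then k b else 0))"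

definition gain :: "nat \<Rightarrow> profits \<Rightarrow> (nat \<Rightarrow> nat) \<Rightarrow> nat" where
  "gain N P w = (\<Sum>i<N. if w i = 0 then 0 else P i (w i - 1))"

text \<open>The dual variable of a place in \<open>b\<close>, eliminated: the least nonnegative
  number that covers all net profits at the prices \<open>\<pi>\<close>.\<close>

definition utility :: "nat \<Rightarrow> profits \<Rightarrow> (nat \<Rightarrow> real) \<Rightarrow> nat \<Rightarrow> real" where
  "utility N P \<pi> b = Max (insert 0 ((\<lambda>i. real (P i b) - \<pi> i) ` {..<N}))"

text \<open>The objective of the linear programming dual, with prices \<open>\<pi>\<close> on the students.\<close>

definition dual_value ::
  "nat \<Rightarrow> profits \<Rightarrow> (nat \<Rightarrow> nat) \<Rightarrow> nat set \<Rightarrow> (nat \<Rightarrow> real) \<Rightarrow> real" where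
  "dual_value N P k S \<pi> = (\<Sum>b\<in>S. real (k b) * utility N P \<pi> b) + (\<Sum>i<N. \<pi> i)"

definition fill_value :: "nat \<Rightarrow> profits \<Rightarrow> (nat \<Rightarrow> nat) \<Rightarrow> nat set \<Rightarrow> real" where
  "fill_value N P k S = Inf (dual_value N P k S ` {\<pi>. \<forall>i. 0 \<le> \<pi> i})"

section \<open>Weak duality and submodularity of the dual optimum\<close>

lemma utility_nonneg: "0 \<le> utility N P \<pi> b"
  unfolding utility_def by (intro Max_ge) auto

lemma utility_ge: "i < N \<Longrightarrow> real (P i b) - \<pi> i \<le> utility N P \<pi> b"
  unfolding utility_def by (intro Max_ge) auto

lemma utility_le:
  assumes "0 \<le> c" "\<And>i. i < N \<Longrightarrow> real (P i b) - \<pi> i \<le> c"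
  shows "utility N P \<pi> b \<le> c"
  unfolding utility_def using assms by (subst Max_le_iff) auto

lemma dual_value_nonneg: "(\<And>i. 0 \<le> \<pi> i) \<Longrightarrow> 0 \<le> dual_value N P k S \<pi>"
  unfolding dual_value_def by (intro add_nonneg_nonneg sum_nonneg mult_nonneg_nonneg utility_nonneg) auto

lemma fill_value_le: "(\<And>i. 0 \<le> \<pi> i) \<Longrightarrow> fill_value N P k S \<le> dual_value N P k S \<pi>"
  unfolding fill_value_def
  by (intro cInf_lower) (auto intro!: bdd_belowI[of _ 0] dual_value_nonneg)

lemma le_fill_value:
  assumes "\<And>\<pi>. (\<And>i. 0 \<le> \<pi> i) \<Longrightarrow> c \<le> dual_value N P k S \<pi>"
  shows "c \<le> fill_value N P k S"
  unfolding fill_value_def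
  by (intro cInf_greatest) (use assms in \<open>auto intro!: exI[of _ "\<lambda>_. 0"]\<close>)

lemma fill_value_nonneg: "0 \<le> fill_value N P k S"
  by (intro le_fill_value dual_value_nonneg)

lemma fill_value_empty: "fill_value N P k {} = 0"
  using fill_value_le[of "\<lambda>_. 0" N P k "{}"] fill_value_nonneg[of N P k "{}"]
  by (simp add: dual_value_def)

lemma fill_value_mono:
  assumes "X \<subseteq> Y" "finite Y"
  shows "fill_value N P k X \<le> fill_value N P k Y"
proof (rule le_fill_value)
  fix \<pi> :: "nat \<Rightarrow> real" assume \<pi>: "\<And>i. 0 \<le> \<pi> i"
  have "fill_value N P k X \<le> dual_value N P k X \<pi>" using \<pi> by (rule fill_value_le)
  also have "\<dots> \<le> dual_value N P k Y \<pi>"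
    unfolding dual_value_def using assms
    by (intro add_mono sum_mono2) (auto intro!: mult_nonneg_nonneg utility_nonneg)
  finally show "fill_value N P k X \<le> dual_value N P k Y \<pi>" .
qed

lemma utility_antimono:
  assumes "\<And>i. \<pi> i \<le> \<rho> i"
  shows "utility N P \<rho> b \<le> utility N P \<pi> b"
proof (intro utility_le utility_nonneg)
  fix i assume "i < N"
  then show "real (P i b) - \<rho> i \<le> utility N P \<pi> b"
    using utility_ge[of i N P b \<pi>] assms[of i] by linarith
qed

text \<open>The larger prices give at most the smaller of the two utilities. At the smaller prices
  every net profit is the larger of two net profits, so the utility is at most the larger one.
  Minimum and maximum add up to the sum.\<close>

lemma utility_max_min:
  "utility N P (\<lambda>i. max (\<pi> i) (\<rho> i)) b + utility N P (\<lambda>i. min (\<pi> i) (\<rho> i)) b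
     \<le> utility N P \<pi> b + utility N P \<rho> b"
proof -
  let ?u = "utility N P \<pi> b" and ?v = "utility N P \<rho> b"
  have "utility N P (\<lambda>i. max (\<pi> i) (\<rho> i)) b \<le> min ?u ?v"
    by (simp add: utility_antimono)
  moreover have "utility N P (\<lambda>i. min (\<pi> i) (\<rho> i)) b \<le> max ?u ?v"
  proof (intro utility_le)
    fix i assume "i < N"
    then show "real (P i b) - min (\<pi> i) (\<rho> i) \<le> max ?u ?v"
      using utility_ge[of i N P b \<pi>] utility_ge[of i N P b \<rho>] by linarith
  qed (simp add: utility_nonneg le_max_iff_disj)
  ultimately show ?thesis by linarith
qed

text \<open>Seminars in only one of the sets see prices that are no lower than before, seminars in
  both are covered by \<open>utility_max_min\<close>, and the prices themselves balance, as maximum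
  and minimum have the same sum as the two prices.\<close>

lemma dual_value_submodular:
  assumes fin: "finite X" "finite Y"
  shows "dual_value N P k (X \<union> Y) (\<lambda>i. max (\<pi> i) (\<rho> i)) +
    dual_value N P k (X \<inter> Y) (\<lambda>i. min (\<pi> i) (\<rho> i))
    \<le> dual_value N P k X \<pi> + dual_value N P k Y \<rho>"
proof -
  let ?M = "\<lambda>i. max (\<pi> i) (\<rho> i)" and ?L = "\<lambda>i. min (\<pi> i) (\<rho> i)"
  let ?u = "\<lambda>\<pi> b. real (k b) * utility N P \<pi> b"
  have "sum (?u ?M) (X \<union> Y) + sum (?u ?L) (X \<inter> Y) =
      sum (?u ?M) (X - Y) + sum (?u ?M) (Y - X) + (\<Sum>b\<in>X \<inter> Y. ?u ?M b + ?u ?L b)"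
  proof -
    have "X \<union> Y = ((X - Y) \<union> (Y - X)) \<union> (X \<inter> Y)" by auto
    then have "sum (?u ?M) (X \<union> Y) = sum (?u ?M) (X - Y) + sum (?u ?M) (Y - X) + sum (?u ?M) (X \<inter> Y)"
      using fin by (simp only:) (subst sum.union_disjoint; auto)+
    then show ?thesis by (simp add: sum.distrib)
  qed
  also have "\<dots> \<le> sum (?u \<pi>) (X - Y) + sum (?u \<rho>) (Y - X) + (\<Sum>b\<in>X \<inter> Y. ?u \<pi> b + ?u \<rho> b)"
    unfolding distrib_left[symmetric]
    by (intro add_mono sum_mono mult_left_mono utility_max_min utility_antimono) auto
  also have "\<dots> = sum (?u \<pi>) X + sum (?u \<rho>) Y"
    using sum.Int_Diff[OF fin(1), of "?u \<pi>" Y] sum.Int_Diff[OF fin(2), of "?u \<rho>" X]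
    by (simp add: sum.distrib Int_commute)
  finally have *: "sum (?u ?M) (X \<union> Y) + sum (?u ?L) (X \<inter> Y) \<le> sum (?u \<pi>) X + sum (?u \<rho>) Y" .
  have "sum ?M {..<N} + sum ?L {..<N} = sum \<pi> {..<N} + sum \<rho> {..<N}"
    unfolding sum.distrib[symmetric] by (intro sum.cong) auto
  with * show ?thesis unfolding dual_value_def by linarith
qed

lemma fill_value_approx:
  assumes "0 < e"
  obtains \<pi> where "\<And>i. 0 \<le> \<pi> i" "dual_value N P k S \<pi> < fill_value N P k S + e"
proof -
  have "\<exists>v\<in>dual_value N P k S ` {\<pi>. \<forall>i. 0 \<le> \<pi> i}. v < fill_value N P k S + e"
    using assms unfolding fill_value_def
    by (intro cInf_lessD) (auto intro!: exI[of _ "\<lambda>_. 0"])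
  then show ?thesis using that by auto
qed

lemma fill_value_submodular:
  assumes fin: "finite X" "finite Y"
  shows "fill_value N P k (X \<union> Y) + fill_value N P k (X \<inter> Y) \<le> fill_value N P k X + fill_value N P k Y"
proof (rule field_le_epsilon)
  fix e :: real assume "0 < e"
  \<comment> \<open>The infimum is not known to be attained, so prices within \<open>e / 2\<close>
    of it are taken for each of the two sets.\<close>
  then have e2: "0 < e / 2" by simp
  obtain \<pi> where \<pi>: "\<And>i. 0 \<le> \<pi> i" "dual_value N P k X \<pi> < fill_value N P k X + e / 2"
    using fill_value_approx[OF e2, of N P k X] by blast
  obtain \<rho> where \<rho>: "\<And>i. 0 \<le> \<rho> i" "dual_value N P k Y \<rho> < fill_value N P k Y + e / 2"
    using fill_value_approx[OF e2, of N P k Y] by blast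
  have "fill_value N P k (X \<union> Y) \<le> dual_value N P k (X \<union> Y) (\<lambda>i. max (\<pi> i) (\<rho> i))"
    by (rule fill_value_le) (simp add: \<pi> le_max_iff_disj)
  moreover have "fill_value N P k (X \<inter> Y) \<le> dual_value N P k (X \<inter> Y) (\<lambda>i. min (\<pi> i) (\<rho> i))"
    by (rule fill_value_le) (simp add: \<pi> \<rho>)
  ultimately show "fill_value N P k (X \<union> Y) + fill_value N P k (X \<inter> Y)
      \<le> fill_value N P k X + fill_value N P k Y + e"
    using dual_value_submodular[OF fin, of N P k \<pi> \<rho>] \<pi>(2) \<rho>(2) by linarith
qed

text \<open>Double counting of the pairs of a student and the seminar attended.\<close>

lemma sum_over_attendees:
  fixes g :: "nat \<Rightarrow> 'a :: semiring_1"
  assumes "\<And>i. i < N \<Longrightarrow> w i \<le> m"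
  shows "(\<Sum>i<N. if w i = 0 then 0 else g (w i - 1)) = (\<Sum>b<m. of_nat (attendance N w b) * g b)"
proof -
  have "(if w i = 0 then 0 else g (w i - 1)) = (\<Sum>b<m. if w i = Suc b then g b else 0)"
    if "i < N" for i
    using assms[OF that] by (cases "w i") (auto simp: sum.delta')
  then have "(\<Sum>i<N. if w i = 0 then 0 else g (w i - 1)) =
      (\<Sum>i<N. \<Sum>b<m. if w i = Suc b then g b else 0)"
    by (intro sum.cong) auto
  also have "\<dots> = (\<Sum>b<m. \<Sum>i<N. if w i = Suc b then g b else 0)"
    by (rule sum.swap)
  also have "\<dots> = (\<Sum>b<m. of_nat (attendance N w b) * g b)"
    unfolding attendance_def
    by (intro sum.cong refl) (simp add: sum.If_cases Int_def conj_commute)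
  finally show ?thesis .
qed

lemma sum_attendance:
  assumes "\<And>i. i < N \<Longrightarrow> w i \<le> m"
  shows "(\<Sum>b<m. attendance N w b) = card {i\<in>{..<N}. w i \<noteq> 0}"
  using sum_over_attendees[OF assms, where g = "\<lambda>_. 1 :: nat"]
  by (simp add: sum.If_cases Int_def conj_commute if_distrib cong: if_cong)

lemma sum_over_fill:
  fixes g :: "nat \<Rightarrow> 'a :: semiring_1"
  assumes "exact_fill N m k S w" "S \<subseteq> {..<m}"
  shows "(\<Sum>i<N. if w i = 0 then 0 else g (w i - 1)) = (\<Sum>b\<in>S. of_nat (k b) * g b)"
proof -
  have "(\<Sum>i<N. if w i = 0 then 0 else g (w i - 1)) = (\<Sum>b<m. of_nat (attendance N w b) * g b)"
    using assms(1) by (intro sum_over_attendees) (auto simp: exact_fill_def)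
  also have "\<dots> = (\<Sum>b<m. if b \<in> S then of_nat (k b) * g b else 0)"
    using assms(1) by (intro sum.cong) (auto simp: exact_fill_def)
  also have "\<dots> = (\<Sum>b\<in>S. of_nat (k b) * g b)"
    using assms(2) by (simp add: sum.If_cases Int_absorb1)
  finally show ?thesis .
qed

text \<open>Weak duality: the profit of an assigned student is at most the utility of the seminar
  plus the student's price, and an unassigned student adds a nonnegative price. Exact attendance
  turns the utilities into the first sum of the dual objective.\<close>

lemma gain_le_dual_value:
  assumes fill: "exact_fill N m k S w" "S \<subseteq> {..<m}" and \<pi>: "\<And>i. 0 \<le> \<pi> i"
  shows "real (gain N P w) \<le> dual_value N P k S \<pi>"
proof -
  have "real (gain N P w) = (\<Sum>i<N. if w i = 0 then 0 else real (P i (w i - 1)))"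
    unfolding gain_def of_nat_sum by (intro sum.cong) auto
  also have "\<dots> \<le> (\<Sum>i<N. (if w i = 0 then 0 else utility N P \<pi> (w i - 1)) + \<pi> i)"
  proof (intro sum_mono)
    fix i assume "i \<in> {..<N}"
    then show "(if w i = 0 then 0 else real (P i (w i - 1)))
        \<le> (if w i = 0 then 0 else utility N P \<pi> (w i - 1)) + \<pi> i"
      using utility_ge[of i N P "w i - 1" \<pi>] \<pi>[of i] by auto
  qed
  also have "\<dots> = dual_value N P k S \<pi>"
    unfolding dual_value_def sum.distrib using sum_over_fill[OF fill, of "utility N P \<pi>"] by simp
  finally show ?thesis .
qed

lemma gain_le_fill_value:
  "exact_fill N m k S w \<Longrightarrow> S \<subseteq> {..<m} \<Longrightarrow> real (gain N P w) \<le> fill_value N P k S"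
  by (intro le_fill_value gain_le_dual_value)

text \<open>The invariant of the auction in which a vacant place of seminar \<open>c - 1\<close> is bidding if
  \<open>c \<noteq> 0\<close>, and \<open>n b\<close> places of seminar \<open>b\<close> have been opened. A student taken by a seminar is,
  up to 1, the most profitable one at the current prices.\<close>

definition auction_inv :: "nat \<Rightarrow> nat \<Rightarrow> profits \<Rightarrow> (nat \<Rightarrow> nat) \<Rightarrow> nat \<Rightarrow>
    (nat \<Rightarrow> nat) \<Rightarrow> (nat \<Rightarrow> nat) \<Rightarrow> bool" where
  "auction_inv N m P n c w \<pi> \<longleftrightarrow>
     (\<forall>i<N. w i \<le> m) \<and> c \<le> m \<and>
     (\<forall>b<m. attendance N w b + (if c = Suc b then 1 else 0) = n b) \<and>
     (\<forall>i<N. w i = 0 \<longrightarrow> \<pi> i = 0) \<and>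
     (\<forall>i<N. \<forall>b. w i = Suc b \<longrightarrow>
        \<pi> i \<le> P i b + 1 \<and> (\<forall>j<N. P j b + \<pi> i \<le> P i b + \<pi> j + 1))"

section \<open>The invariant of the auction and its termination\<close>

lemma auction_inv_start: "auction_inv N m P (\<lambda>_. 0) 0 (\<lambda>_. 0) (\<lambda>_. 0)"
  by (simp add: auction_inv_def attendance_def)

lemma attendance_cong: "(\<And>i. i < N \<Longrightarrow> w i = w' i) \<Longrightarrow> attendance N w b = attendance N w' b"
  unfolding attendance_def by (intro arg_cong[where f = card]) auto

lemma auction_inv_cong:
  assumes "auction_inv N m P n c w \<pi>"
    "\<And>b. b < m \<Longrightarrow> n b = n' b" "\<And>i. i < N \<Longrightarrow> w i = w' i" "\<And>i. i < N \<Longrightarrow> \<pi> i = \<pi>' i"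
  shows "auction_inv N m P n' c w' \<pi>'"
  using assms attendance_cong[of N w w'] unfolding auction_inv_def by auto

lemma auction_inv_open:
  assumes "auction_inv N m P n 0 w \<pi>" "b < m"
  shows "auction_inv N m P (n(b := Suc (n b))) (Suc b) w \<pi>"
  using assms unfolding auction_inv_def by auto

text \<open>The bidding place is counted in \<open>n\<close> but attended by nobody, so fewer than
  \<open>N\<close> students are assigned. That a free student has price 0 is what bounds the
  bids.\<close>

lemma auction_free_student:
  assumes inv: "auction_inv N m P n (Suc b) w \<pi>" and le: "(\<Sum>b<m. n b) \<le> N"
  obtains i where "i < N" "w i = 0" "\<pi> i = 0"
proof -
  have b: "b < m" using inv by (auto simp: auction_inv_def)
  have "(\<Sum>b<m. n b) = (\<Sum>b'<m. attendance N w b' + (if b' = b then 1 else 0))"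
    using inv by (intro sum.cong) (auto simp: auction_inv_def)
  also have "\<dots> = card {i\<in>{..<N}. w i \<noteq> 0} + 1"
    using sum_attendance[of N w m] inv b by (simp add: sum.distrib auction_inv_def)
  finally have "card {i\<in>{..<N}. w i \<noteq> 0} < card {..<N}" using le by simp
  then have "{i\<in>{..<N}. w i \<noteq> 0} \<noteq> {..<N}" by force
  then obtain i where "i < N" "w i = 0" by auto
  then show ?thesis using that inv by (auto simp: auction_inv_def)
qed

lemma attendance_upd:
  assumes "i < N" "w i \<noteq> Suc c"
  shows "attendance N (w(i := Suc c)) b + (if w i = Suc b then 1 else 0) =
    attendance N w b + (if b = c then 1 else 0)"
proof -
  let ?A = "{j\<in>{..<N}. w j = Suc b}"
  have fin: "finite ?A" by simp
  consider "b = c" | "b \<noteq> c" "w i = Suc b" | "b \<noteq> c" "w i \<noteq> Suc b" by blast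
  then show ?thesis
  proof cases
    case 1
    then have "{j\<in>{..<N}. (w(i := Suc c)) j = Suc b} = insert i ?A" "i \<notin> ?A"
      using assms by auto
    then show ?thesis using 1 assms fin by (simp add: attendance_def)
  next
    case 2
    then have "{j\<in>{..<N}. (w(i := Suc c)) j = Suc b} = ?A - {i}" "i \<in> ?A"
      using assms by auto
    then show ?thesis
      using 2 card_Suc_Diff1[OF fin \<open>i \<in> ?A\<close>] by (simp add: attendance_def)
  next
    case 3
    then have "{j\<in>{..<N}. (w(i := Suc c)) j = Suc b} = ?A"
      using assms by auto
    then show ?thesis using 3 by (simp add: attendance_def)
  qed
qed

text \<open>Comparison with a free student of price 0 yields \<open>\<pi> i \<le> P i b\<close>, so
  the raised price stays within \<open>P i b + 1\<close>. The slack of 1 in the optimality condition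
  absorbs the raise; for other attendees the prices of competitors only grow. The displaced place
  \<open>w i\<close> bids next, and \<open>w i = 0\<close> means that none is left. A seminar may
  also outbid itself, which changes nothing but the price.\<close>

lemma auction_inv_bid:
  assumes inv: "auction_inv N m P n (Suc b) w \<pi>" and le: "(\<Sum>b<m. n b) \<le> N"
    and i: "i < N" and best: "\<And>j. j < N \<Longrightarrow> P j b + \<pi> i \<le> P i b + \<pi> j"
  shows "auction_inv N m P n (w i) (w(i := Suc b)) (\<pi>(i := Suc (\<pi> i)))"
proof -
  obtain f where f: "f < N" "\<pi> f = 0"
    using auction_free_student[OF inv le] by blast
  have price: "\<pi> i \<le> P i b" using best[OF f(1)] f(2) by simp
  have count: "attendance N (w(i := Suc b)) b' + (if w i = Suc b' then 1 else 0) = n b'"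
    if "b' < m" for b'
  proof (cases "w i = Suc b")
    case True
    then have "w(i := Suc b) = w" by auto
    then show ?thesis using inv that True by (auto simp: auction_inv_def)
  next
    case False
    then show ?thesis
      using attendance_upd[OF i, of w b b'] inv that by (auto simp: auction_inv_def)
  qed
  show ?thesis
    unfolding auction_inv_def
  proof (intro conjI allI impI)
    fix j b' assume j: "j < N" and w: "(w(i := Suc b)) j = Suc b'"
    show "(\<pi>(i := Suc (\<pi> i))) j \<le> P j b' + 1"
      using w price inv j by (auto simp: auction_inv_def split: if_splits)
    fix j' assume j': "j' < N"
    show "P j' b' + (\<pi>(i := Suc (\<pi> i))) j \<le> P j b' + (\<pi>(i := Suc (\<pi> i))) j' + 1"
    proof (cases "j = i")
      case True
      then show ?thesis using w best[OF j'] by auto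
    next
      case False
      then have "P j' b' + \<pi> j \<le> P j b' + \<pi> j' + 1"
        using w inv j j' by (auto simp: auction_inv_def)
      then show ?thesis using False by auto
    qed
  qed (use inv i count in \<open>auto simp: auction_inv_def split: if_splits\<close>)
qed

text \<open>Only an assigned student can have a positive price, and it exceeds the student's profit
  at the seminar attended by at most 1. Thus profits at opened seminars are all that
  matters.\<close>

lemma auction_price_le:
  assumes inv: "auction_inv N m P n c w \<pi>" and i: "i < N"
    and bound: "\<And>b. b < m \<Longrightarrow> n b \<noteq> 0 \<Longrightarrow> P i b \<le> p"
  shows "\<pi> i \<le> Suc p"
proof (cases "w i")
  case 0
  then show ?thesis using inv i by (simp add: auction_inv_def)
next
  case (Suc b)
  then have "b < m" using inv i by (auto simp: auction_inv_def Suc_le_eq)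
  moreover have "attendance N w b \<noteq> 0"
    using Suc i by (auto simp: attendance_def)
  ultimately have "n b \<noteq> 0" using inv by (auto simp: auction_inv_def)
  then show ?thesis
    using bound[OF \<open>b < m\<close>] inv i Suc by (fastforce simp: auction_inv_def)
qed

lemma auction_price_sum_le:
  assumes inv: "auction_inv N m P n c w \<pi>"
    and bound: "\<And>i b. i < N \<Longrightarrow> b < m \<Longrightarrow> n b \<noteq> 0 \<Longrightarrow> P i b \<le> p"
  shows "(\<Sum>i<N. \<pi> i) \<le> N * Suc p"
  using sum_bounded_above[of "{..<N}" \<pi> "Suc p"] auction_price_le[OF inv _ bound] by simp

text \<open>Every bid raises the sum of the prices by 1, and the invariant bounds this sum by
  \<open>N * Suc p\<close>.\<close>

lemma auction_complete:
  assumes "auction_inv N m P n c w \<pi>" "(\<Sum>b<m. n b) \<le> N"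
  shows "\<exists>w \<pi>. auction_inv N m P n 0 w \<pi>"
proof -
  define p where "p = (\<Sum>i<N. \<Sum>b<m. P i b)"
  have p: "P i b \<le> p" if "i < N" "b < m" for i b
  proof -
    have "P i b \<le> (\<Sum>b<m. P i b)" using that by (intro member_le_sum) auto
    also have "\<dots> \<le> p" unfolding p_def
      using that by (intro member_le_sum[of i _ "\<lambda>i. \<Sum>b<m. P i b"]) auto
    finally show ?thesis .
  qed
  show ?thesis using assms(1)
  proof (induction "N * Suc p - (\<Sum>i<N. \<pi> i)" arbitrary: c w \<pi> rule: less_induct)
    case less
    show ?case
    proof (cases c)
      case 0
      then show ?thesis using less.prems by blast
    next
      case (Suc b)
      note inv = less.prems[unfolded Suc]
      have "{..<N} \<noteq> {}" using auction_free_student[OF inv assms(2)] by auto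
      then obtain i where i: "i \<in> {..<N}"
        and best: "\<And>j. j \<in> {..<N} \<Longrightarrow> int (P j b) - int (\<pi> j) \<le> int (P i b) - int (\<pi> i)"
        using finite_maximizer[of "{..<N}" "\<lambda>j. int (P j b) - int (\<pi> j)"] by auto
      have "P j b + \<pi> i \<le> P i b + \<pi> j" if "j < N" for j
        using best[of j] that by simp
      then have inv': "auction_inv N m P n (w i) (w(i := Suc b)) (\<pi>(i := Suc (\<pi> i)))"
        using i by (intro auction_inv_bid[OF inv assms(2)]) auto
      have "(\<Sum>j<N. (\<pi>(i := Suc (\<pi> i))) j) = Suc (\<Sum>j<N. \<pi> j)"
        using i by (simp add: sum.remove[of "{..<N}" i])
      moreover have "(\<Sum>j<N. (\<pi>(i := Suc (\<pi> i))) j) \<le> N * Suc p"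
        using auction_price_sum_le[OF inv'] p by blast
      ultimately show ?thesis by (intro less.hyps[OF _ inv']) linarith
    qed
  qed
qed

text \<open>Places are opened one at a time; the assignment and the prices reached so far are a
  valid start for the next bidding.\<close>

lemma auction_exists:
  assumes "(\<Sum>b<m. n b) \<le> N"
  shows "\<exists>w \<pi>. auction_inv N m P n 0 w \<pi>"
  using assms
proof (induction "\<Sum>b<m. n b" arbitrary: n)
  case 0
  then have "n b = 0" if "b < m" for b using that by simp
  then have "auction_inv N m P n 0 (\<lambda>_. 0) (\<lambda>_. 0)"
    by (intro auction_inv_cong[OF auction_inv_start]) auto
  then show ?case by blast
next
  case (Suc x)
  then obtain b where b: "b < m" "n b \<noteq> 0"
    by (metis (no_types, lifting) Zero_not_Suc lessThan_iff sum.neutral)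
  let ?n = "n(b := n b - 1)"
  have eq: "sum n {..<m} = Suc (sum ?n {..<m})"
    using b by (simp add: sum.remove[of "{..<m}" b])
  then obtain w \<pi> where "auction_inv N m P ?n 0 w \<pi>"
    using Suc.hyps(1)[of ?n] Suc.hyps(2) Suc.prems by auto
  from auction_inv_open[OF this b(1)] have "auction_inv N m P n (Suc b) w \<pi>"
    using b by (simp add: fun_upd_idem)
  then show ?case using auction_complete Suc.prems by blast
qed

text \<open>Complementary slackness up to 1 per student: the utility of the seminar attended plus
  the student's price is at most the profit plus 1, and unassigned students have price 0. This is
  the source of the additive error \<open>N\<close>.\<close>

lemma auction_dual_le:
  assumes inv: "auction_inv N m P (\<lambda>b. if b \<in> S then k b else 0) 0 w \<pi>" and S: "S \<subseteq> {..<m}"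
  shows "exact_fill N m k S w" "dual_value N P k S (\<lambda>i. real (\<pi> i)) \<le> real (gain N P w + N)"
proof -
  show fill: "exact_fill N m k S w"
    using inv by (auto simp: exact_fill_def auction_inv_def)
  let ?u = "utility N P (\<lambda>i. real (\<pi> i))"
  have "dual_value N P k S (\<lambda>i. real (\<pi> i)) =
      (\<Sum>i<N. (if w i = 0 then 0 else ?u (w i - 1)) + real (\<pi> i))"
    unfolding dual_value_def sum.distrib using sum_over_fill[OF fill S, of ?u] by simp
  also have "\<dots> \<le> (\<Sum>i<N. real (if w i = 0 then 0 else P i (w i - 1)) + 1)"
  proof (intro sum_mono)
    fix i assume "i \<in> {..<N}"
    then have i: "i < N" by simp
    show "(if w i = 0 then 0 else ?u (w i - 1)) + real (\<pi> i)
        \<le> real (if w i = 0 then 0 else P i (w i - 1)) + 1"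
    proof (cases "w i")
      case 0
      then show ?thesis using inv i by (auto simp: auction_inv_def)
    next
      case (Suc b)
      have "?u b \<le> real (P i b) - real (\<pi> i) + 1"
      proof (intro utility_le)
        show "0 \<le> real (P i b) - real (\<pi> i) + 1"
          using inv i Suc by (fastforce simp: auction_inv_def)
        fix j assume "j < N"
        then have "P j b + \<pi> i \<le> P i b + \<pi> j + 1"
          using inv i Suc by (auto simp: auction_inv_def)
        then show "real (P j b) - real (\<pi> j) \<le> real (P i b) - real (\<pi> i) + 1" by linarith
      qed
      then show ?thesis using Suc by simp
    qed
  qed
  also have "\<dots> = real (gain N P w + N)"
    by (simp add: gain_def sum.distrib)
  finally show "dual_value N P k S (\<lambda>i. real (\<pi> i)) \<le> real (gain N P w + N)" .
qed

text \<open>There are infinitely many \<open>w\<close>, as values beyond \<open>N\<close> are free,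
  but their gains are natural numbers bounded by \<open>fill_value\<close>.\<close>

lemma finite_maximal_fill:
  assumes "exact_fill N m k S w0" "S \<subseteq> {..<m}"
  obtains w where "exact_fill N m k S w" "\<And>w'. exact_fill N m k S w' \<Longrightarrow> gain N P w' \<le> gain N P w"
proof -
  let ?G = "gain N P ` {w. exact_fill N m k S w}"
  have "g \<le> nat \<lfloor>fill_value N P k S\<rfloor>" if "g \<in> ?G" for g
    using that gain_le_fill_value[OF _ assms(2), of N k _ P] by (auto simp: le_nat_floor)
  then have fin: "finite ?G" by (meson finite_nat_set_iff_bounded_le)
  then have "Max ?G \<in> ?G" using assms by (intro Max_in) auto
  then obtain w where w: "exact_fill N m k S w" "Max ?G = gain N P w" by auto
  have "gain N P w' \<le> gain N P w" if "exact_fill N m k S w'" for w'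
    unfolding w(2)[symmetric] using fin that by (intro Max_ge) auto
  with w show ?thesis using that by blast
qed

text \<open>The factor \<open>c\<close> can be taken out of every net profit once the prices are
  divided by \<open>c\<close>.\<close>

lemma dual_value_scale:
  assumes "0 < c"
  shows "dual_value N (\<lambda>i b. c * P i b) k S \<pi> = real c * dual_value N P k S (\<lambda>i. \<pi> i / real c)"
proof -
  have "utility N (\<lambda>i b. c * P i b) \<pi> b = real c * utility N P (\<lambda>i. \<pi> i / real c) b" for b
  proof (rule antisym)
    show "utility N (\<lambda>i b. c * P i b) \<pi> b \<le> real c * utility N P (\<lambda>i. \<pi> i / real c) b"
    proof (intro utility_le mult_nonneg_nonneg utility_nonneg)
      fix i assume "i < N"
      have "real (c * P i b) - \<pi> i = real c * (real (P i b) - \<pi> i / real c)"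
        using assms by (simp add: field_simps)
      also have "\<dots> \<le> real c * utility N P (\<lambda>i. \<pi> i / real c) b"
        using utility_ge[OF \<open>i < N\<close>] by (intro mult_left_mono) auto
      finally show "real (c * P i b) - \<pi> i \<le> real c * utility N P (\<lambda>i. \<pi> i / real c) b" .
    qed simp
    have "utility N P (\<lambda>i. \<pi> i / real c) b \<le> utility N (\<lambda>i b. c * P i b) \<pi> b / real c"
    proof (intro utility_le divide_nonneg_nonneg utility_nonneg)
      fix i assume "i < N"
      have "real (P i b) - \<pi> i / real c = (real (c * P i b) - \<pi> i) / real c"
        using assms by (simp add: field_simps)
      also have "\<dots> \<le> utility N (\<lambda>i b. c * P i b) \<pi> b / real c"
        using utility_ge[OF \<open>i < N\<close>, of "\<lambda>i b. c * P i b" b \<pi>] by (intro divide_right_mono) auto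
      finally show "real (P i b) - \<pi> i / real c \<le> utility N (\<lambda>i b. c * P i b) \<pi> b / real c" .
    qed simp
    then show "real c * utility N P (\<lambda>i. \<pi> i / real c) b \<le> utility N (\<lambda>i b. c * P i b) \<pi> b"
      using assms by (simp add: field_simps)
  qed
  then show ?thesis
    using assms by (simp add: dual_value_def sum_distrib_left distrib_left mult_ac)
qed

text \<open>Running the auction with all profits multiplied by a large constant makes its additive
  error negligible.\<close>

lemma fill_value_attained:
  assumes S: "S \<subseteq> {..<m}" and le: "(\<Sum>b\<in>S. k b) \<le> N"
  obtains w where "exact_fill N m k S w" "real (gain N P w) = fill_value N P k S"
proof -
  let ?n = "\<lambda>b. if b \<in> S then k b else 0"
  have "(\<Sum>b<m. ?n b) = (\<Sum>b\<in>S. k b)"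
    using S by (simp add: sum.If_cases Int_absorb1)
  with le have le': "(\<Sum>b<m. ?n b) \<le> N" by simp
  have ex: "\<exists>w. exact_fill N m k S w \<and>
      real c * fill_value N P k S \<le> real c * real (gain N P w) + real N" if c: "0 < c" for c
  proof -
    obtain w \<pi> where inv: "auction_inv N m (\<lambda>i b. c * P i b) ?n 0 w \<pi>"
      using auction_exists[OF le'] by blast
    have "real c * fill_value N P k S \<le> real c * dual_value N P k S (\<lambda>i. real (\<pi> i) / real c)"
      by (intro mult_left_mono fill_value_le) auto
    also have "\<dots> = dual_value N (\<lambda>i b. c * P i b) k S (\<lambda>i. real (\<pi> i))"
      using dual_value_scale[OF c] by simp
    also have "\<dots> \<le> real (gain N (\<lambda>i b. c * P i b) w + N)"
      by (rule auction_dual_le[OF inv S])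
    also have "gain N (\<lambda>i b. c * P i b) w = c * gain N P w"
      unfolding gain_def sum_distrib_left by (intro sum.cong) auto
    finally show ?thesis using auction_dual_le[OF inv S] by (intro exI[of _ w]) auto
  qed
  obtain w0 where "exact_fill N m k S w0" using ex[of 1] by auto
  then obtain w where w: "exact_fill N m k S w"
    and wmax: "\<And>w'. exact_fill N m k S w' \<Longrightarrow> gain N P w' \<le> gain N P w"
    using finite_maximal_fill[OF _ S, where P = P] by blast
  have bound: "fill_value N P k S \<le> real (gain N P w) + real N / real (Suc c)" for c
  proof -
    obtain w' where w': "exact_fill N m k S w'"
      "real (Suc c) * fill_value N P k S \<le> real (Suc c) * real (gain N P w') + real N"
      using ex[of "Suc c"] by blast
    have "real (gain N P w') \<le> real (gain N P w)" using wmax[OF w'(1)] by simp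
    then have "real (Suc c) * real (gain N P w') \<le> real (Suc c) * real (gain N P w)"
      by (intro mult_left_mono) auto
    then have "real (Suc c) * fill_value N P k S \<le> real (Suc c) * real (gain N P w) + real N"
      using w'(2) by linarith
    then show ?thesis by (simp add: field_simps)
  qed
  \<comment> \<open>\<open>w\<close> has maximal gain and does not depend on \<open>c\<close>; only
    the error \<open>N / Suc c\<close> varies, and it tends to 0.\<close>
  have "fill_value N P k S \<le> real (gain N P w)"
  proof (rule LIMSEQ_le_const)
    show "(\<lambda>c. real (gain N P w) + real N / real (Suc c)) \<longlonglongrightarrow> real (gain N P w)"
      using tendsto_add[OF tendsto_const[of "real (gain N P w)"]
          LIMSEQ_Suc[OF lim_const_over_n[of "real N"]]] by simp
  qed (use bound in blast)
  with gain_le_fill_value[OF w S, of P] have "real (gain N P w) = fill_value N P k S" by simp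
  with w show ?thesis using that by blast
qed

text \<open>The optimum is attained by a fill, whose gain is a multiple of \<open>N + 1\<close> just
  like the gain of the auction; two such numbers at distance at most \<open>N\<close>
  coincide.\<close>

lemma auction_exact:
  assumes inv: "auction_inv N m P (\<lambda>b. if b \<in> S then k b else 0) 0 w \<pi>"
    and S: "S \<subseteq> {..<m}" and le: "(\<Sum>b\<in>S. k b) \<le> N"
    and dvd: "\<And>i b. i < N \<Longrightarrow> b \<in> S \<Longrightarrow> Suc N dvd P i b"
  shows "real (gain N P w) = fill_value N P k S"
proof -
  have dvd_gain: "Suc N dvd gain N P v" if v: "exact_fill N m k S v" for v
    unfolding gain_def
  proof (intro dvd_sum)
    fix i assume "i \<in> {..<N}"
    then have i: "i < N" by simp
    show "Suc N dvd (if v i = 0 then 0 else P i (v i - 1))"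
    proof (cases "v i")
      case (Suc b)
      then have "b < m" using v i by (auto simp: exact_fill_def Suc_le_eq)
      moreover have "attendance N v b \<noteq> 0" using Suc i by (auto simp: attendance_def)
      ultimately have "b \<in> S" using v by (auto simp: exact_fill_def split: if_splits)
      then show ?thesis using dvd[OF i] Suc by simp
    qed simp
  qed
  note w = auction_dual_le[OF inv S]
  obtain v where v: "exact_fill N m k S v" "real (gain N P v) = fill_value N P k S"
    using fill_value_attained[OF S le] .
  have "real (gain N P v) \<le> real (gain N P w + N)"
    using v(2) fill_value_le[of "\<lambda>i. real (\<pi> i)" N P k S] w(2) by simp
  then have le1: "gain N P v \<le> gain N P w + N" by linarith
  have "real (gain N P w) \<le> real (gain N P v)"
    using gain_le_fill_value[OF w(1) S] v(2) by simp
  then have le2: "gain N P w \<le> gain N P v" by linarith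
  have "Suc N dvd gain N P v - gain N P w"
    using dvd_gain[OF v(1)] dvd_gain[OF w(1)] by (simp add: dvd_diff_nat)
  moreover have "gain N P v - gain N P w < Suc N" using le1 by linarith
  ultimately have "gain N P v - gain N P w = 0" using nat_dvd_not_less by blast
  then show ?thesis using le2 v(2) by simp
qed

section \<open>The auction program\<close>

text \<open>The program is written with the numbers of its arrays as constants. The auction keeps its
  assignment in the output array \<open>WHO\<close>, so the last run leaves the result in place.\<close>

declare One_nat_def [simp del]

abbreviation (input) "WHO \<equiv> 1 :: nat"
abbreviation (input) "SIZE \<equiv> 2 :: nat"
abbreviation (input) "PROFIT \<equiv> 3 :: nat"
abbreviation (input) "PRICE \<equiv> 4 :: nat"
abbreviation (input) "HOST \<equiv> 20 :: nat"
abbreviation (input) "SEAT \<equiv> 21 :: nat"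
abbreviation (input) "PUPIL \<equiv> 22 :: nat"
abbreviation (input) "BIDDER \<equiv> 23 :: nat"
abbreviation (input) "CHOICE \<equiv> 24 :: nat"
abbreviation (input) "EVICTED \<equiv> 25 :: nat"
abbreviation (input) "GAIN \<equiv> 26 :: nat"
abbreviation (input) "num_students \<equiv> Cell 0 (Const 0)"
abbreviation (input) "num_seminars \<equiv> Cell 0 (Const 1)"

lemma wp_Assign_Cell:
  "Q (store_upd a (aval e s) (aval (Cell a' e') s) s) \<Longrightarrow> wp X (Assign a e (Cell a' e')) Q s"
  by (intro wp_Assign) (simp_all add: bounded_store_def)

text \<open>The profit matrix is stored row by row. \<open>c\<close> carries the shift by one used
  in \<open>WHO\<close> and \<open>BIDDER\<close>.\<close>

definition profit_cell :: "aexp \<Rightarrow> aexp \<Rightarrow> aexp" where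
  "profit_cell i c = Cell PROFIT (Add (Mul i num_seminars) (Sub c (Const 1)))"

text \<open>Prices are moved to the opposite sides of the comparison, since a profit minus a price
  may be negative.\<close>

definition find_best :: com where
  "find_best = Seq (Set CHOICE (Const 0)) (For PUPIL num_students
     (If (Sub (Add (profit_cell (Var PUPIL) (Var BIDDER)) (Cell PRICE (Var CHOICE)))
              (Add (profit_cell (Var CHOICE) (Var BIDDER)) (Cell PRICE (Var PUPIL))))
       (Set CHOICE (Var PUPIL)) Skip))"

text \<open>Taking a free student copies 0 to \<open>BIDDER\<close>, which ends the loop of
  bids.\<close>

definition bid :: com where
  "bid = Seq find_best (Seq (Set EVICTED (Cell WHO (Var CHOICE)))
     (Seq (Assign WHO (Var CHOICE) (Var BIDDER))
     (Seq (Assign PRICE (Var CHOICE) (Add (Cell PRICE (Var CHOICE)) (Const 1)))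
          (Set BIDDER (Var EVICTED)))))"

definition reset_auction :: com where
  "reset_auction = For PUPIL num_students
     (Seq (Assign WHO (Var PUPIL) (Const 0)) (Assign PRICE (Var PUPIL) (Const 0)))"

definition assign_places :: com where
  "assign_places = For SEAT (Cell SIZE (Var HOST))
     (Seq (Set BIDDER (Add (Var HOST) (Const 1))) (While (Var BIDDER) bid))"

definition assign_seminars :: "nat \<Rightarrow> com" where
  "assign_seminars arr = For HOST num_seminars (If (Cell arr (Var HOST)) assign_places Skip)"

definition sum_gain :: com where
  "sum_gain = Seq (Set GAIN (Const 0)) (For PUPIL num_students (If (Cell WHO (Var PUPIL))
     (Set GAIN (Add (Var GAIN) (profit_cell (Var PUPIL) (Cell WHO (Var PUPIL))))) Skip))"

definition auction :: "nat \<Rightarrow> com" where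
  "auction arr = Seq reset_auction (Seq (assign_seminars arr) sum_gain)"

abbreviation "auction_writes \<equiv> {WHO, PRICE, HOST, SEAT, PUPIL, BIDDER, CHOICE, EVICTED, GAIN} :: nat set"

section \<open>Verification of the auction program\<close>

lemma reads_profit_cell [simp]: "reads (profit_cell i c) = {0, PROFIT} \<union> reads i \<union> reads c"
  by (auto simp: profit_cell_def)

lemma aval_profit_cell [simp]:
  "aval (profit_cell i c) s = s PROFIT (aval i s * s 0 1 + (aval c s - 1))"
  by (simp add: profit_cell_def)

abbreviation profits_of :: "store \<Rightarrow> profits" where
  "profits_of s \<equiv> \<lambda>i b. s PROFIT (i * s 0 1 + b)"

lemma writes_find_best [simp]: "writes find_best = {PUPIL, CHOICE}"
  by (auto simp: find_best_def)

lemma writes_bid [simp]: "writes bid = {WHO, PRICE, PUPIL, BIDDER, CHOICE, EVICTED}"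
  by (auto simp: bid_def)

lemma writes_reset_auction [simp]: "writes reset_auction = {WHO, PRICE, PUPIL}"
  by (auto simp: reset_auction_def)

lemma writes_assign_places [simp]:
  "writes assign_places = {WHO, PRICE, SEAT, PUPIL, BIDDER, CHOICE, EVICTED}"
  by (auto simp: assign_places_def)

lemma writes_assign_seminars [simp]:
  "writes (assign_seminars arr) = {WHO, PRICE, HOST, SEAT, PUPIL, BIDDER, CHOICE, EVICTED}"
  by (auto simp: assign_seminars_def)

lemma writes_sum_gain [simp]: "writes sum_gain = {PUPIL, GAIN}"
  by (auto simp: sum_gain_def)

lemma writes_auction [simp]: "writes (auction arr) = auction_writes"
  by (auto simp: auction_def)

lemma wp_find_best:
  assumes cur: "s BIDDER 0 = Suc b" and N: "0 < s 0 0" "s 0 0 \<le> X"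
    and Q: "\<And>s'. agree_off {PUPIL, CHOICE} s s' \<Longrightarrow> s' CHOICE 0 < s 0 0 \<Longrightarrow>
      (\<And>j. j < s 0 0 \<Longrightarrow> profits_of s j b + s PRICE (s' CHOICE 0)
        \<le> profits_of s (s' CHOICE 0) b + s PRICE j) \<Longrightarrow> Q s'"
  shows "wp X find_best Q s"
  unfolding find_best_def
proof (rule wp_Seq, rule wp_Assign, goal_cases)
  case 2
  let ?I = "\<lambda>k s'. s' CHOICE 0 < s 0 0 \<and> (\<forall>j<k. profits_of s j b + s PRICE (s' CHOICE 0)
        \<le> profits_of s (s' CHOICE 0) b + s PRICE j)"
  show ?case
  proof (rule wp_For[where I = ?I and n = "s 0 0"], goal_cases)
    case (6 k t)
    then have eq: "t 0 = s 0" "t PROFIT = s PROFIT" "t PRICE = s PRICE" "t BIDDER = s BIDDER"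
      by (auto simp: agree_off_def)
    show ?case
    proof (rule wp_If, goal_cases)
      case 1
      then have lt: "profits_of s (t CHOICE 0) b + s PRICE k < profits_of s k b + s PRICE (t CHOICE 0)"
        using 6 eq cur by simp
      have "profits_of s j b + s PRICE k \<le> profits_of s k b + s PRICE j" if "j < Suc k" for j
      proof (cases "j = k")
        case False
        then have "profits_of s j b + s PRICE (t CHOICE 0) \<le> profits_of s (t CHOICE 0) b + s PRICE j"
          using 6(4) that by simp
        then show ?thesis using lt by linarith
      qed simp
      then show ?case
        using 6(1,2) le_imp_less_power[of k X] N by (intro wp_Assign) auto
    next
      case 2
      then show ?case
        using 6 eq cur by (intro wp_Skip) (auto simp: less_Suc_eq)
    qed
  next
    case (7 t)
    then show ?case by (intro Q) (auto simp: agree_off_def split: if_splits)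
  qed (use N in auto)
qed simp

text \<open>The bound on the sum of the prices gives the loop variant and at the same time keeps
  every single price below \<open>2 ^ X\<close>.\<close>

lemma wp_bid:
  assumes N: "N = s 0 0" and m: "m = s 0 1" and P: "P = profits_of s"
    and inv: "auction_inv N m P n (s BIDDER 0) (s WHO) (s PRICE)" and cur: "s BIDDER 0 \<noteq> 0"
    and le: "(\<Sum>b<m. n b) \<le> N"
    and bound: "\<And>i b. i < N \<Longrightarrow> b < m \<Longrightarrow> n b \<noteq> 0 \<Longrightarrow> P i b \<le> p"
    and X: "N * Suc p \<le> X"
  shows "wp X bid (\<lambda>s'. auction_inv N m P n (s' BIDDER 0) (s' WHO) (s' PRICE) \<and>
    N * Suc p - (\<Sum>i<N. s' PRICE i) < N * Suc p - (\<Sum>i<N. s PRICE i)) s"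
proof -
  obtain b where b: "s BIDDER 0 = Suc b" using cur not0_implies_Suc by blast
  \<comment> \<open>The free student also shows \<open>N > 0\<close>, so that student 0 is a
    legitimate first choice.\<close>
  obtain f where f: "f < N" "s PRICE f = 0"
    using auction_free_student[OF inv[unfolded b] le] by blast
  have "N * 1 \<le> N * Suc p" by (intro mult_le_mono2) simp
  then have NX: "N \<le> X" using X by simp
  show ?thesis
    unfolding bid_def
  proof (rule wp_Seq, rule wp_find_best[where s = s and b = b], goal_cases)
    case (4 t)
    define i where "i = t CHOICE 0"
    have eq: "t WHO = s WHO" "t PRICE = s PRICE" "t BIDDER = s BIDDER"
      using 4(1) by (auto simp: agree_off_def)
    have i: "i < N" and best: "\<And>j. j < N \<Longrightarrow> P j b + s PRICE i \<le> P i b + s PRICE j"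
      using 4 N by (auto simp: i_def P)
    have inv': "auction_inv N m P n (s WHO i) ((s WHO)(i := Suc b)) ((s PRICE)(i := Suc (s PRICE i)))"
      using auction_inv_bid[OF inv[unfolded b] le i best] by simp
    have sum: "(\<Sum>j<N. ((s PRICE)(i := Suc (s PRICE i))) j) = Suc (\<Sum>j<N. s PRICE j)"
      using i by (simp add: sum.remove[of "{..<N}" i])
    have sum_le: "(\<Sum>j<N. ((s PRICE)(i := Suc (s PRICE i))) j) \<le> N * Suc p"
      using auction_price_sum_le[OF inv'] bound by blast
    have "Suc (s PRICE i) \<le> Suc (\<Sum>j<N. s PRICE j)"
      using i by (intro Suc_leI le_imp_less_Suc member_le_sum) auto
    then have "Suc (s PRICE i) \<le> X" using sum sum_le X by linarith
    then have price: "Suc (s PRICE i) < 2 ^ X" by (rule le_imp_less_power)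
    show ?case
      apply (rule wp_Seq, rule wp_Assign_Cell)
      apply (rule wp_Seq, rule wp_Assign_Cell)
      apply (rule wp_Seq, rule wp_Assign, use price in \<open>simp add: eq flip: i_def\<close>)
      apply (rule wp_Assign_Cell)
      using inv' sum sum_le by (simp add: eq b flip: i_def Suc_eq_plus1)
  qed (use b f N NX in auto)
qed

lemma wp_assign_places:
  assumes N: "N = s 0 0" and m: "m = s 0 1" and P: "P = profits_of s"
    and b: "s HOST 0 = b" "b < m"
    and inv: "auction_inv N m P n 0 (s WHO) (s PRICE)" 
    and n0: "n b = 0" and le: "(\<Sum>b'<m. (n(b := s SIZE b)) b') \<le> N"
    and bound: "\<And>i b'. i < N \<Longrightarrow> b' < m \<Longrightarrow> n b' \<noteq> 0 \<or> b' = b \<Longrightarrow> P i b' \<le> p"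
    and X: "N * Suc p \<le> X" "m \<le> X"
    and Q: "\<And>s'. agree_off {WHO, PRICE, SEAT, PUPIL, BIDDER, CHOICE, EVICTED} s s' \<Longrightarrow>
      auction_inv N m P (n(b := s SIZE b)) 0 (s' WHO) (s' PRICE) \<Longrightarrow> Q s'"
  shows "wp X assign_places Q s"
proof -
  have "N * 1 \<le> N * Suc p" by (intro mult_le_mono2) simp
  then have NX: "N \<le> X" using X by simp
  have "s SIZE b \<le> (\<Sum>b'<m. (n(b := s SIZE b)) b')"
    using b member_le_sum[of b "{..<m}" "n(b := s SIZE b)"] by simp
  then have kX: "s SIZE b \<le> X" using le NX by linarith
  let ?I = "\<lambda>j s'. auction_inv N m P (n(b := j)) 0 (s' WHO) (s' PRICE)"
  show ?thesis
    unfolding assign_places_def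
  proof (rule wp_For[where I = ?I and n = "s SIZE b"], goal_cases)
    case (6 j t)
    then have eq: "t 0 = s 0" "t PROFIT = s PROFIT" "t HOST = s HOST"
      by (auto simp: agree_off_def)
    have le': "(\<Sum>b'<m. (n(b := Suc j)) b') \<le> N"
    proof -
      have "(\<Sum>b'<m. (n(b := Suc j)) b') \<le> (\<Sum>b'<m. (n(b := s SIZE b)) b')"
        using 6(1) by (intro sum_mono) auto
      then show ?thesis using le by linarith
    qed
    have inv': "auction_inv N m P (n(b := Suc j)) (Suc b) (t WHO) (t PRICE)"
      using auction_inv_open[OF 6(4) b(2)] by simp
    show ?case
    proof (rule wp_Seq, rule wp_Assign)
      show "aval (Add (Var HOST) (Const 1)) t < 2 ^ X"
        using le_imp_less_power[of "Suc b" X] b X(2) by (simp add: eq)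
      show "wp X (While (Var BIDDER) bid) (\<lambda>s'. ?I (Suc j) (store_upd SEAT 0 (Suc j) s'))
         (store_upd BIDDER (aval (Const 0) t) (aval (Add (Var HOST) (Const 1)) t) t)"
      proof (rule wp_While[where I = "\<lambda>s'. auction_inv N m P (n(b := Suc j)) (s' BIDDER 0) (s' WHO) (s' PRICE)"
            and \<mu> = "\<lambda>s'. N * Suc p - (\<Sum>i<N. s' PRICE i)"], goal_cases)
        case (3 u)
        then have "u 0 = s 0" "u PROFIT = s PROFIT" using eq by (auto simp: agree_off_def)
        then show ?case
          using 3 N m P bound
          by (intro wp_bid[OF _ _ _ 3(2) _ le' _ X(1)]) (auto split: if_splits)
      qed (use inv' eq b X in \<open>auto simp flip: Suc_eq_plus1\<close>)
    qed
  next
    case (7 t)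
    then show ?case by (intro Q) (auto simp: insert_commute)
  qed (use b inv n0 kX in \<open>auto simp: fun_upd_idem\<close>)
qed

text \<open>\<open>?n b\<close> opens all places of the seminars of \<open>S\<close> below
  \<open>b\<close>. The assumption \<open>N * Suc p \<le> X\<close> bounds the number of bids, the
  prices and the gain alike.\<close>

lemma wp_auction:
  assumes N: "N = s 0 0" and m: "m = s 0 1" and P: "P = profits_of s" and k: "k = s SIZE"
    and S: "S = {b. b < m \<and> s arr b \<noteq> 0}"
    and arr: "arr \<notin> auction_writes"
    and le: "sum k S \<le> N"
    and bound: "\<And>i b. i < N \<Longrightarrow> b \<in> S \<Longrightarrow> P i b \<le> p"
    and dvd: "\<And>i b. i < N \<Longrightarrow> b \<in> S \<Longrightarrow> Suc N dvd P i b"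
    and X: "N * Suc p \<le> X" "m \<le> X"
    and Q: "\<And>s'. agree_off auction_writes s s' \<Longrightarrow>
      exact_fill N m k S (s' WHO) \<Longrightarrow> s' GAIN 0 = gain N P (s' WHO) \<Longrightarrow>
      real (s' GAIN 0) = fill_value N P k S \<Longrightarrow> Q s'"
  shows "wp X (auction arr) Q s"
proof -
  have "N * 1 \<le> N * Suc p" by (intro mult_le_mono2) simp
  then have NX: "N \<le> X" using X by simp
  have S_sub: "S \<subseteq> {..<m}" using S by auto
  let ?n = "\<lambda>b b'. if b' \<in> S \<and> b' < b then k b' else 0"
  have 1: "wp X reset_auction (\<lambda>s'. auction_inv N m P (?n 0) 0 (s' WHO) (s' PRICE)) s"
    unfolding reset_auction_def
  proof (rule wp_For[where I = "\<lambda>k s'. \<forall>i<k. s' WHO i = 0 \<and> s' PRICE i = 0" and n = N], goal_cases)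
    case (6 k t)
    then show ?case
      by (intro wp_Seq wp_Assign) (auto simp: less_Suc_eq)
  next
    case (7 t)
    show ?case by (rule auction_inv_cong[OF auction_inv_start]) (use 7 in auto)
  qed (use N NX in auto)
  have 2: "wp X (assign_seminars arr) (\<lambda>s'. auction_inv N m P (?n m) 0 (s' WHO) (s' PRICE)) s'"
    if s': "agree_off {WHO, PRICE, PUPIL} s s'" "auction_inv N m P (?n 0) 0 (s' WHO) (s' PRICE)" for s'
    unfolding assign_seminars_def
  proof (rule wp_For[where I = "\<lambda>b s'. auction_inv N m P (?n b) 0 (s' WHO) (s' PRICE)" and n = m],
      goal_cases)
    case (6 b t)
    have "agree_off auction_writes s t"
      using s'(1) 6(3) by (auto simp: agree_off_def)
    then have eq: "t 0 = s 0" "t PROFIT = s PROFIT" "t SIZE = k" "t arr = s arr"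
      using arr k by (auto simp: agree_off_def)
    show ?case
    proof (rule wp_If)
      assume "aval (Cell arr (Var HOST)) t \<noteq> 0"
      then have b: "b \<in> S" using S 6 eq by auto
      have n: "(?n b)(b := t SIZE b) = ?n (Suc b)" using b eq by (auto simp: less_Suc_eq)
      have "(\<Sum>b'<m. ?n (Suc b) b') \<le> (\<Sum>b'<m. if b' \<in> S then k b' else 0)"
        by (intro sum_mono) auto
      also have "\<dots> \<le> N" using S_sub le by (simp add: sum.If_cases Int_absorb1)
      finally have le': "(\<Sum>b'<m. ((?n b)(b := t SIZE b)) b') \<le> N" by (simp only: n)
      show "wp X assign_places (\<lambda>s'. auction_inv N m P (?n (Suc b)) 0 (store_upd HOST 0 (Suc b) s' WHO) (store_upd HOST 0 (Suc b) s' PRICE)) t"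
      proof (rule wp_assign_places[OF _ _ _ 6(2,1,4) _ le', where p = p], goal_cases)
        case (5 i b')
        then show ?case using bound b by (auto split: if_splits)
      next
        case (8 u)
        then show ?case unfolding n by simp
      qed (use N m P eq X in auto)
    next
      assume "aval (Cell arr (Var HOST)) t = 0"
      then have "b \<notin> S" using S 6 eq by auto
      then have "?n (Suc b) = ?n b" by (auto simp: less_Suc_eq)
      then show "wp X Skip (\<lambda>s'. auction_inv N m P (?n (Suc b)) 0 (store_upd HOST 0 (Suc b) s' WHO) (store_upd HOST 0 (Suc b) s' PRICE)) t"
        using 6(4) by (intro wp_Skip) simp
    qed
  qed (use m X s' arr in \<open>auto simp: agree_off_def\<close>)
  have 3: "wp X sum_gain (\<lambda>s'. s' WHO = s'' WHO \<and> s' GAIN 0 = gain N P (s'' WHO)) s''"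
    if s'': "agree_off {WHO, PRICE, HOST, SEAT, PUPIL, BIDDER, CHOICE, EVICTED} s s''"
      and inv: "auction_inv N m P (?n m) 0 (s'' WHO) (s'' PRICE)" for s''
  proof -
    let ?g = "\<lambda>i. if s'' WHO i = 0 then 0 else P i (s'' WHO i - 1)"
    have g: "?g i \<le> p" if i: "i < N" for i
    proof (cases "s'' WHO i")
      case (Suc b)
      then have "b < m" using inv i by (auto simp: auction_inv_def Suc_le_eq)
      moreover have "attendance N (s'' WHO) b \<noteq> 0" using Suc i by (auto simp: attendance_def)
      ultimately have "b \<in> S" using inv by (auto simp: auction_inv_def split: if_splits)
      then show ?thesis using bound[OF i] Suc by simp
    qed simp
    have eq: "s'' 0 = s 0" "s'' PROFIT = s PROFIT" using s'' by (auto simp: agree_off_def)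
    show ?thesis
      unfolding sum_gain_def
    proof (rule wp_Seq, rule wp_Assign)
      show "wp X (For PUPIL num_students (If (Cell WHO (Var PUPIL))
         (Set GAIN (Add (Var GAIN) (profit_cell (Var PUPIL) (Cell WHO (Var PUPIL))))) Skip))
         (\<lambda>s'. s' WHO = s'' WHO \<and> s' GAIN 0 = gain N P (s'' WHO))
         (store_upd GAIN (aval (Const 0) s'') (aval (Const 0) s'') s'')"
      proof (rule wp_For[where I = "\<lambda>j s'. s' GAIN 0 = (\<Sum>i<j. ?g i)" and n = N], goal_cases)
        case (6 j t)
        have eq': "t 0 = s 0" "t PROFIT = s PROFIT" "t WHO = s'' WHO"
          using 6(3) eq by (auto simp: agree_off_def)
        show ?case
        proof (rule wp_If)
          assume "aval (Cell WHO (Var PUPIL)) t \<noteq> 0"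
          then have nz: "s'' WHO j \<noteq> 0" using 6 eq' by simp
          have "(\<Sum>i<Suc j. ?g i) \<le> (\<Sum>i<Suc j. Suc p)"
            using 6(1) by (intro sum_mono le_SucI g) auto
          also have "\<dots> = Suc j * Suc p" by simp
          also have "\<dots> \<le> N * Suc p" using 6(1) by (intro mult_le_mono1) simp
          finally have "(\<Sum>i<Suc j. ?g i) < 2 ^ X" using X le_imp_less_power le_trans by blast
          then show "wp X (Set GAIN (Add (Var GAIN) (profit_cell (Var PUPIL) (Cell WHO (Var PUPIL)))))
            (\<lambda>s'. store_upd PUPIL 0 (Suc j) s' GAIN 0 = (\<Sum>i<Suc j. ?g i)) t"
            using nz 6 eq' P m by (intro wp_Assign) auto
        next
          assume "aval (Cell WHO (Var PUPIL)) t = 0"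
          then show "wp X Skip (\<lambda>s'. store_upd PUPIL 0 (Suc j) s' GAIN 0 = (\<Sum>i<Suc j. ?g i)) t"
            using 6 eq' by (intro wp_Skip) simp
        qed
      next
        case (7 t)
        then show ?case by (auto simp: agree_off_def gain_def)
      qed (use N NX eq in auto)
    qed simp
  qed
  show ?thesis
    unfolding auction_def
  proof (rule wp_Seq, rule wp_conseq[OF 1], rule wp_Seq, rule wp_conseq[OF 2])
    fix s1 assume s1: "agree_off (writes reset_auction) s s1"
      "auction_inv N m P (?n 0) 0 (s1 WHO) (s1 PRICE)"
    then show "agree_off {WHO, PRICE, PUPIL} s s1"
      "auction_inv N m P (?n 0) 0 (s1 WHO) (s1 PRICE)" by simp_all
    fix s2 assume s2: "agree_off (writes (assign_seminars arr)) s1 s2"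
      "auction_inv N m P (?n m) 0 (s2 WHO) (s2 PRICE)"
    have inv: "auction_inv N m P (\<lambda>b. if b \<in> S then k b else 0) 0 (s2 WHO) (s2 PRICE)"
      by (rule auction_inv_cong[OF s2(2)]) auto
    show "wp X sum_gain Q s2"
    proof (rule wp_conseq[OF 3])
      show "agree_off {WHO, PRICE, HOST, SEAT, PUPIL, BIDDER, CHOICE, EVICTED} s s2"
        "auction_inv N m P (?n m) 0 (s2 WHO) (s2 PRICE)"
        using s1(1) s2 by (simp_all add: agree_off_def)
      fix s3 assume s3: "agree_off (writes sum_gain) s2 s3"
        "s3 WHO = s2 WHO \<and> s3 GAIN 0 = gain N P (s2 WHO)"
      show "Q s3"
      proof (rule Q)
        show "agree_off auction_writes s s3"
          using s1(1) s2(1) s3(1) by (simp add: agree_off_def)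
        show "exact_fill N m k S (s3 WHO)"
          using auction_dual_le(1)[OF inv S_sub] s3(2) by simp
        show "s3 GAIN 0 = gain N P (s3 WHO)" using s3(2) by simp
        show "real (s3 GAIN 0) = fill_value N P k S"
          using auction_exact[OF inv S_sub le dvd] s3(2) by simp
      qed
    qed
  qed
qed

section \<open>The greedy program\<close>

abbreviation (input) "OPEN \<equiv> 5 :: nat"
abbreviation (input) "BEST_OPEN \<equiv> 6 :: nat"
abbreviation (input) "SEM \<equiv> 8 :: nat"
abbreviation (input) "SEED \<equiv> 12 :: nat"
abbreviation (input) "TOTAL \<equiv> 13 :: nat"
abbreviation (input) "VALUE \<equiv> 14 :: nat"
abbreviation (input) "ROUND \<equiv> 15 :: nat"
abbreviation (input) "CAND \<equiv> 16 :: nat"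
abbreviation (input) "CAND_GAIN \<equiv> 17 :: nat"
abbreviation (input) "BEST_VALUE \<equiv> 18 :: nat"

text \<open>The 1 makes the truncated difference nonzero also when \<open>e\<close> uses up the
  budget exactly.\<close>

definition fit_test :: "aexp \<Rightarrow> aexp" where
  "fit_test e = Sub (Add num_students (Const 1)) e"

text \<open>\<open>CAND = 0\<close> stands for no candidate, and the first summand then accepts the
  seminar whatever its gain. A marginal of 0 would never win the strict comparison, yet the greedy
  run must go on until nothing fits.\<close>

definition compare_marginal :: com where
  "compare_marginal =
     If (Add (Sub (Const 1) (Var CAND))
          (Sub (Mul (Sub (Var GAIN) (Var VALUE)) (Cell SIZE (Sub (Var CAND) (Const 1))))
               (Mul (Var CAND_GAIN) (Cell SIZE (Var SEM)))))
       (Seq (Set CAND (Add (Var SEM) (Const 1))) (Set CAND_GAIN (Sub (Var GAIN) (Var VALUE)))) Skip"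

definition choose_best :: com where
  "choose_best = Seq (Set CAND (Const 0)) (Seq (Set CAND_GAIN (Const 0))
     (For SEM num_seminars (If (Cell OPEN (Var SEM)) Skip
       (If (fit_test (Add (Var TOTAL) (Cell SIZE (Var SEM))))
         (Seq (Assign OPEN (Var SEM) (Const 1)) (Seq (auction OPEN)
           (Seq (Assign OPEN (Var SEM) (Const 0)) compare_marginal)))
         Skip))))"

definition greedy_step :: com where
  "greedy_step = Seq choose_best (If (Var CAND)
     (Seq (Assign OPEN (Sub (Var CAND) (Const 1)) (Const 1))
     (Seq (Set TOTAL (Add (Var TOTAL) (Cell SIZE (Sub (Var CAND) (Const 1)))))
          (Set VALUE (Add (Var VALUE) (Var CAND_GAIN))))) Skip)"

text \<open>Opens the three digits of \<open>SEED\<close> to the base of the number of seminars.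
  \<open>TOTAL\<close> is summed over the flags, so that a repeated digit counts once.\<close>

definition seed :: com where
  "seed = Seq (For SEM num_seminars (Assign OPEN (Var SEM) (Const 0)))
     (Seq (Assign OPEN (Div (Var SEED) (Mul num_seminars num_seminars)) (Const 1))
     (Seq (Assign OPEN (Sub (Div (Var SEED) num_seminars)
         (Mul (Div (Var SEED) (Mul num_seminars num_seminars)) num_seminars)) (Const 1))
     (Seq (Assign OPEN (Sub (Var SEED) (Mul (Div (Var SEED) num_seminars) num_seminars)) (Const 1))
     (Seq (Set TOTAL (Const 0))
       (For SEM num_seminars (If (Cell OPEN (Var SEM))
         (Set TOTAL (Add (Var TOTAL) (Cell SIZE (Var SEM)))) Skip))))))"

definition save_if_better :: com where
  "save_if_better = If (Sub (Var VALUE) (Var BEST_VALUE)) (Seq (Set BEST_VALUE (Var VALUE))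
     (For SEM num_seminars (Assign BEST_OPEN (Var SEM) (Cell OPEN (Var SEM))))) Skip"

definition try_seed :: com where
  "try_seed = Seq seed (If (fit_test (Var TOTAL))
     (Seq (auction OPEN) (Seq (Set VALUE (Var GAIN))
       (Seq (For ROUND num_seminars greedy_step) save_if_better))) Skip)"

definition optimise :: com where
  "optimise = Seq (For SEED (Mul (Mul num_seminars num_seminars) num_seminars) try_seed)
     (auction BEST_OPEN)"

section \<open>Verification of the greedy program\<close>

lemma wp_Assign_Sub_Cell:
  "Q (store_upd a (aval e s) (aval (Sub (Cell a' e') f) s) s) \<Longrightarrow>
    wp X (Assign a e (Sub (Cell a' e') f)) Q s"
  by (intro wp_Assign) (simp_all add: bounded_store_def less_imp_diff_less)

lemma aval_fit_test: "aval (fit_test e) s \<noteq> 0 \<longleftrightarrow> aval e s \<le> s 0 0"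
  by (simp add: fit_test_def) linarith

lemma writes_compare_marginal [simp]: "writes compare_marginal = {CAND, CAND_GAIN}"
  by (auto simp: compare_marginal_def)

lemma writes_choose_best [simp]: "writes choose_best = {CAND, CAND_GAIN, SEM, OPEN} \<union> auction_writes"
  by (auto simp: choose_best_def)

lemma writes_greedy_step [simp]:
  "writes greedy_step = {CAND, CAND_GAIN, SEM, OPEN, TOTAL, VALUE} \<union> auction_writes"
  by (auto simp: greedy_step_def)

lemma writes_seed [simp]: "writes seed = {SEM, OPEN, TOTAL}"
  by (auto simp: seed_def)

lemma writes_save_if_better [simp]: "writes save_if_better = {BEST_VALUE, SEM, BEST_OPEN}"
  by (auto simp: save_if_better_def)

lemma writes_try_seed [simp]:
  "writes try_seed = {CAND, CAND_GAIN, SEM, OPEN, TOTAL, VALUE, ROUND, BEST_VALUE, BEST_OPEN} \<union> auction_writes"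
  by (auto simp: try_seed_def)

lemma agree_offD: "agree_off A s s' \<Longrightarrow> a \<notin> A \<Longrightarrow> s' a = s a"
  by (simp add: agree_off_def)

text \<open>Profits are constrained only where \<open>k b \<le> N\<close>, as only there they are
  rounded. \<open>k_le\<close> keeps the total size of a seed small before it is tested against the
  budget.\<close>

locale greedy_program =
  fixes N m :: nat and P :: profits and k :: "nat \<Rightarrow> nat" and p X :: nat
  assumes k_pos: "b < m \<Longrightarrow> 0 < k b"
    and k_le: "b < m \<Longrightarrow> k b \<le> Suc N"
    and P_le: "i < N \<Longrightarrow> b < m \<Longrightarrow> k b \<le> N \<Longrightarrow> P i b \<le> p"
    and P_dvd: "i < N \<Longrightarrow> b < m \<Longrightarrow> k b \<le> N \<Longrightarrow> Suc N dvd P i b"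
    and X: "N * Suc p \<le> X" "m \<le> X" "m * m * m \<le> X" "m * Suc N \<le> X"
begin

sublocale budgeted_submodular m k N "fill_value N P k"
proof
  fix A C :: "nat set"
  assume C: "C \<subseteq> {..<m}"
  then have fin: "finite C" using finite_subset by blast
  show "A \<subseteq> C \<Longrightarrow> fill_value N P k A \<le> fill_value N P k C"
    using fin by (intro fill_value_mono)
  assume "A \<subseteq> {..<m}"
  then have "finite A" using finite_subset by blast
  with fin show "fill_value N P k (A \<union> C) + fill_value N P k (A \<inter> C)
      \<le> fill_value N P k A + fill_value N P k C"
    by (intro fill_value_submodular)
qed (auto simp: k_pos fill_value_empty)

abbreviation "F \<equiv> fill_value N P k"

lemma mem_size_le: "S \<subseteq> {..<m} \<Longrightarrow> cost S \<le> N \<Longrightarrow> b \<in> S \<Longrightarrow> k b \<le> N"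
  using member_le_sum[of b S k] finite_subset[of S "{..<m}"] by fastforce

text \<open>The constant price \<open>p\<close> makes all utilities vanish and has the sum
  \<open>N * p\<close>. The bound keeps the register of the current value below
  \<open>2 ^ X\<close>.\<close>

lemma F_le:
  assumes "S \<subseteq> {..<m}" "cost S \<le> N"
  shows "F S \<le> real (N * p)"
proof -
  have "utility N P (\<lambda>_. real p) b \<le> 0" if "b \<in> S" for b
    using P_le mem_size_le[OF assms that] that assms(1) by (intro utility_le) auto
  then have "(\<Sum>b\<in>S. real (k b) * utility N P (\<lambda>_. real p) b) \<le> 0"
    by (intro sum_nonpos mult_nonneg_nonpos) auto
  then show ?thesis
    using fill_value_le[of "\<lambda>_. real p" N P k S] by (simp add: dual_value_def)
qed

definition ready :: "store \<Rightarrow> bool" where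
  "ready s \<longleftrightarrow> s 0 0 = N \<and> s 0 1 = m \<and> s SIZE = k \<and> (\<lambda>i b. s PROFIT (i * m + b)) = P"

lemma ready_cong: "ready s \<Longrightarrow> agree_off A s s' \<Longrightarrow> A \<inter> {0, SIZE, PROFIT} = {} \<Longrightarrow> ready s'"
  using agree_offD[of A s s' 0] agree_offD[of A s s' SIZE] agree_offD[of A s s' PROFIT]
  by (simp add: ready_def)

definition chosen :: "nat \<Rightarrow> store \<Rightarrow> nat set" where
  "chosen arr s = {b. b < m \<and> s arr b \<noteq> 0}"

lemma chosen_subset: "chosen arr s \<subseteq> {..<m}"
  by (auto simp: chosen_def)

lemma wp_auction_ready:
  assumes r: "ready s" and arr: "arr \<notin> auction_writes" and le: "cost (chosen arr s) \<le> N"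
    and Q: "\<And>s'. agree_off auction_writes s s' \<Longrightarrow>
      exact_fill N m k (chosen arr s) (s' WHO) \<Longrightarrow> s' GAIN 0 = gain N P (s' WHO) \<Longrightarrow>
      real (s' GAIN 0) = F (chosen arr s) \<Longrightarrow> Q s'"
  shows "wp X (auction arr) Q s"
proof (rule wp_auction[where N = N and m = m and P = P and k = k and S = "chosen arr s" and p = p])
  fix i b assume "i < N" "b \<in> chosen arr s"
  then show "P i b \<le> p" "Suc N dvd P i b"
    using P_le P_dvd mem_size_le[OF chosen_subset le] by (auto simp: chosen_def)
qed (use r arr le X Q in \<open>auto simp: ready_def chosen_def\<close>)

definition greedy_state :: "nat set \<Rightarrow> store \<Rightarrow> bool" where
  "greedy_state S s \<longleftrightarrow> ready s \<and> chosen OPEN s = S \<and> s TOTAL 0 = cost S \<and> cost S \<le> N \<and>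
     real (s VALUE 0) = F S"

definition scanned :: "nat set \<Rightarrow> nat \<Rightarrow> store \<Rightarrow> bool" where
  "scanned S j s \<longleftrightarrow>
     (if s CAND 0 = 0 then s CAND_GAIN 0 = 0 \<and> (\<forall>b<j. \<not> fits S b)
      else (\<exists>b. s CAND 0 = Suc b \<and> b < j \<and> fits S b \<and> real (s CAND_GAIN 0) = marginal S b \<and>
        (\<forall>b'<j. fits S b' \<longrightarrow> marginal S b' * real (k b) \<le> marginal S b * real (k b'))))"

lemma wp_compare_marginal:
  assumes s: "scanned S b s" "greedy_state S s" "s SEM 0 = b" and fit: "fits S b"
    and val: "real (s GAIN 0) = F (insert b S)"
    and Q: "\<And>s'. agree_off {CAND, CAND_GAIN} s s' \<Longrightarrow> scanned S (Suc b) s' \<Longrightarrow> Q s'"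
  shows "wp X compare_marginal Q s"
proof -
  have b: "b < m" "b \<notin> S" using fit by (auto simp: fits_def)
  have S: "S \<subseteq> {..<m}" using s(2) chosen_subset by (auto simp: greedy_state_def)
  have k: "s SIZE = k" and cv: "real (s VALUE 0) = F S" using s(2) by (auto simp: greedy_state_def ready_def)
  have "F S \<le> F (insert b S)" using marginal_nonneg[OF b(1) S] by simp
  \<comment> \<open>By monotonicity the truncated difference of \<open>GAIN\<close> and
    \<open>VALUE\<close> is the true marginal.\<close>
  then have "s VALUE 0 \<le> s GAIN 0" using cv val by linarith
  then have marg: "real (s GAIN 0 - s VALUE 0) = marginal S b" using cv val by simp
  show ?thesis
    unfolding compare_marginal_def
  proof (rule wp_If)
    let ?cond = "Add (Sub (Const 1) (Var CAND))
          (Sub (Mul (Sub (Var GAIN) (Var VALUE)) (Cell SIZE (Sub (Var CAND) (Const 1))))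
               (Mul (Var CAND_GAIN) (Cell SIZE (Var SEM))))"
    {
      assume c: "aval ?cond s \<noteq> 0"
      have dom: "marginal S b' * real (k b) \<le> marginal S b * real (k b')"
        if b': "b' < Suc b" "fits S b'" for b'
      proof (cases "b' = b")
        case False
        then have lt: "b' < b" using b' by simp
        show ?thesis
        proof (cases "s CAND 0")
          case 0
          then show ?thesis using s(1) b' lt by (auto simp: scanned_def)
        next
          case (Suc b0)
          then have b0: "fits S b0" "real (s CAND_GAIN 0) = marginal S b0"
            "marginal S b' * real (k b0) \<le> marginal S b0 * real (k b')"
            using s(1) b' lt by (auto simp: scanned_def)
          have "s CAND_GAIN 0 * k b < (s GAIN 0 - s VALUE 0) * k b0"
            using c Suc k s(3) by simp
          then have "real (s CAND_GAIN 0) * real (k b) < real (s GAIN 0 - s VALUE 0) * real (k b0)"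
            by (metis of_nat_less_iff of_nat_mult)
          then have b1: "marginal S b0 * real (k b) \<le> marginal S b * real (k b0)"
            using marg b0 by simp
          have pos: "0 < real (k b0)" using b0(1) k_pos by (simp add: fits_def)
          have "marginal S b' * real (k b0) * real (k b) \<le> marginal S b0 * real (k b') * real (k b)"
            using b0(3) by (intro mult_right_mono) auto
          also have "\<dots> = marginal S b0 * real (k b) * real (k b')" by simp
          also have "\<dots> \<le> marginal S b * real (k b0) * real (k b')"
            using b1 by (intro mult_right_mono) auto
          finally have "marginal S b' * real (k b) * real (k b0) \<le> marginal S b * real (k b') * real (k b0)"
            by (simp add: mult_ac)
          then show ?thesis using pos by simp
        qed
      qed simp
      let ?s' = "store_upd CAND_GAIN 0 (s GAIN 0 - s VALUE 0) (store_upd CAND 0 (Suc b) s)"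
      have "scanned S (Suc b) ?s'"
        using marg fit dom by (auto simp: scanned_def simp del: of_nat_diff)
      then have "Q ?s'" by (intro Q) (auto simp: agree_off_def)
      then show "wp X (Seq (Set CAND (Add (Var SEM) (Const 1))) (Set CAND_GAIN (Sub (Var GAIN) (Var VALUE)))) Q s"
        using le_imp_less_power[of "Suc b" X] b X s(3)
        by (intro wp_Seq wp_Assign[of _ _ "Add (Var SEM) (Const 1)"] wp_Assign_Sub_Cell)
          (simp_all flip: Suc_eq_plus1)
    next
      assume c: "aval ?cond s = 0"
      then obtain b0 where b0: "s CAND 0 = Suc b0" using not0_implies_Suc by fastforce
      then have "(s GAIN 0 - s VALUE 0) * k b0 \<le> s CAND_GAIN 0 * k b" using c k s(3) by simp
      then have "real (s GAIN 0 - s VALUE 0) * real (k b0) \<le> real (s CAND_GAIN 0) * real (k b)"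
        by (metis of_nat_le_iff of_nat_mult)
      then have "scanned S (Suc b) s"
        using s(1) b0 marg by (auto simp: scanned_def less_Suc_eq)
      then show "wp X Skip Q s" by (intro wp_Skip Q) (auto simp: agree_off_def)
    }
  qed
qed

lemma wp_choose_best:
  assumes s: "greedy_state S s"
    and Q: "\<And>s'. agree_off ({CAND, CAND_GAIN, SEM, OPEN} \<union> auction_writes) s s' \<Longrightarrow> greedy_state S s' \<Longrightarrow>
      scanned S m s' \<Longrightarrow> Q s'"
  shows "wp X choose_best Q s"
proof -
  \<comment> \<open>Each trial resets its flag, so \<open>OPEN\<close> as a whole is unchanged at
    the end of every round although the body writes to it.\<close>
  let ?I = "\<lambda>j t. t OPEN = s OPEN \<and> scanned S j t"
  show ?thesis
    unfolding choose_best_def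
  proof (intro wp_Seq wp_Assign, goal_cases)
    case 3
    let ?s = "store_upd CAND_GAIN (aval (Const 0) (store_upd CAND (aval (Const 0) s) (aval (Const 0) s) s))
       (aval (Const 0) (store_upd CAND (aval (Const 0) s) (aval (Const 0) s) s))
       (store_upd CAND (aval (Const 0) s) (aval (Const 0) s) s)"
    show ?case
    proof (rule wp_For[where I = ?I and n = m], goal_cases)
      case (6 b t)
      let ?post = "\<lambda>s'. ?I (Suc b) (store_upd SEM 0 (Suc b) s')"
      have off: "agree_off ({CAND, CAND_GAIN, SEM, OPEN} \<union> auction_writes) s t"
        using 6(3) by (auto simp: agree_off_def)
      have same: "t 0 = s 0" "t SIZE = s SIZE" "t PROFIT = s PROFIT" "t TOTAL = s TOTAL" "t VALUE = s VALUE"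
        using off by (auto simp: agree_off_def)
      then have t: "greedy_state S t"
        using s 6(4) by (auto simp: greedy_state_def ready_def chosen_def)
      then have S: "chosen OPEN t = S" "ready t" "t TOTAL 0 = cost S"
        by (auto simp: greedy_state_def)
      show ?case
      proof (rule wp_If)
        assume "aval (Cell OPEN (Var SEM)) t \<noteq> 0"
        then have "b \<in> S" using S 6 by (auto simp: chosen_def)
        then have "\<not> fits S b" by (simp add: fits_def)
        then have "scanned S (Suc b) t" using 6(4) by (auto simp: scanned_def less_Suc_eq)
        then show "wp X Skip ?post t"
          using 6(4) by (intro wp_Skip) (auto simp: scanned_def)
      next
        assume zero: "aval (Cell OPEN (Var SEM)) t = 0"
        then have b: "b \<notin> S" "t OPEN b = 0" using S 6 by (auto simp: chosen_def)
        show "wp X (If (fit_test (Add (Var TOTAL) (Cell SIZE (Var SEM))))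
         (Seq (Assign OPEN (Var SEM) (Const 1)) (Seq (auction OPEN)
           (Seq (Assign OPEN (Var SEM) (Const 0)) compare_marginal)))
         Skip) ?post t"
        proof (rule wp_If)
          assume "aval (fit_test (Add (Var TOTAL) (Cell SIZE (Var SEM)))) t \<noteq> 0"
          then have le: "cost S + k b \<le> N"
            unfolding aval_fit_test using S 6 by (auto simp: ready_def)
          have fit: "fits S b" using b 6(1) le by (simp add: fits_def)
          have finS: "finite S" using S chosen_subset finite_subset by blast
          let ?t = "store_upd OPEN b 1 t"
          have ch: "chosen OPEN ?t = insert b S" using S(1) 6(1) by (auto simp: chosen_def)
          show "wp X (Seq (Assign OPEN (Var SEM) (Const 1)) (Seq (auction OPEN)
             (Seq (Assign OPEN (Var SEM) (Const 0)) compare_marginal)))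
             ?post t"
          proof (rule wp_Seq, rule wp_Assign)
            have X1: "1 \<le> X" using 6(1) X(2) by linarith
            show "aval (Const 1) t < 2 ^ X" using le_imp_less_power[OF X1] by simp
            have "wp X (Seq (auction OPEN) (Seq (Assign OPEN (Var SEM) (Const 0)) compare_marginal))
              ?post ?t"
            proof (rule wp_Seq, rule wp_auction_ready)
              show "ready ?t" using S(2) by (simp add: ready_def)
              show "cost (chosen OPEN ?t) \<le> N" unfolding ch using le b finS by simp
              fix u assume u: "agree_off auction_writes ?t u"
                "real (u GAIN 0) = F (chosen OPEN ?t)"
              let ?u = "store_upd OPEN b 0 u"
              have eq: "u 0 = t 0" "u SIZE = t SIZE" "u PROFIT = t PROFIT" "u TOTAL = t TOTAL" "u VALUE = t VALUE"
                "u OPEN = (t OPEN)(b := 1)" "u SEM = t SEM" "u CAND = t CAND" "u CAND_GAIN = t CAND_GAIN"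
                using u(1) by (auto simp: agree_off_def)
              have ins: "?u OPEN = t OPEN" using eq b by (auto simp: fun_eq_iff)
              have "wp X compare_marginal ?post ?u"
              proof (rule wp_compare_marginal[OF _ _ _ fit])
                show "scanned S b ?u" using 6(4) eq by (simp add: scanned_def)
                show "greedy_state S ?u"
                  using t eq ins by (simp add: greedy_state_def ready_def chosen_def)
                show "?u SEM 0 = b" using eq 6(2) by simp
                show "real (?u GAIN 0) = F (insert b S)" using u(2) ch by simp
                fix v assume "agree_off {CAND, CAND_GAIN} ?u v" "scanned S (Suc b) v"
                then show "?I (Suc b) (store_upd SEM 0 (Suc b) v)"
                  using ins 6(4) by (auto simp: agree_off_def scanned_def)
              qed
              then show "wp X (Seq (Assign OPEN (Var SEM) (Const 0)) compare_marginal)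
                  ?post u"
                using eq 6(2) by (intro wp_Seq wp_Assign) auto
            qed simp
            then show "wp X (Seq (auction OPEN) (Seq (Assign OPEN (Var SEM) (Const 0)) compare_marginal))
              ?post
              (store_upd OPEN (aval (Var SEM) t) (aval (Const 1) t) t)"
              using 6(2) by simp
          qed
        next
          assume "aval (fit_test (Add (Var TOTAL) (Cell SIZE (Var SEM)))) t = 0"
          then have "\<not> cost S + k b \<le> N"
            using aval_fit_test[of "Add (Var TOTAL) (Cell SIZE (Var SEM))" t] S 6 by (auto simp: ready_def)
          then have "\<not> fits S b" by (simp add: fits_def)
          then have "scanned S (Suc b) t" using 6(4) by (auto simp: scanned_def less_Suc_eq)
          then show "wp X Skip ?post t"
            using 6(4) by (intro wp_Skip) (auto simp: scanned_def)
        qed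
      qed
    next
      case (7 t)
      have off: "agree_off ({CAND, CAND_GAIN, SEM, OPEN} \<union> auction_writes) s t"
        using 7(1) by (auto simp: agree_off_def)
      then have "greedy_state S t"
        using s 7(2) by (auto simp: greedy_state_def ready_def chosen_def agree_off_def)
      then show ?case using Q off 7(2) by blast
    qed (use s X in \<open>auto simp: greedy_state_def ready_def scanned_def\<close>)
  qed auto
qed

lemma wp_greedy_step:
  assumes s: "greedy_state S s"
    and Q: "\<And>s' S'. agree_off (writes greedy_step) s s' \<Longrightarrow> greedy_state S' s' \<Longrightarrow>
      (\<exists>b. best_fit S b \<and> S' = insert b S) \<or> S' = S \<and> (\<forall>b. \<not> fits S b) \<Longrightarrow> Q s'"
  shows "wp X greedy_step Q s"
proof -
  have *: "wp X greedy_step (\<lambda>s'. \<exists>S'. greedy_state S' s' \<and>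
      ((\<exists>b. best_fit S b \<and> S' = insert b S) \<or> S' = S \<and> (\<forall>b. \<not> fits S b))) s"
    (is "wp X greedy_step ?Q s")
    unfolding greedy_step_def
  proof (rule wp_Seq, rule wp_choose_best[OF s], rule wp_If)
    fix t assume t: "greedy_state S t" "scanned S m t"
    {
      assume "aval (Var CAND) t \<noteq> 0"
      then obtain b where b: "t CAND 0 = Suc b" "fits S b" "real (t CAND_GAIN 0) = marginal S b"
        and best: "\<And>b'. fits S b' \<Longrightarrow> marginal S b' * real (k b) \<le> marginal S b * real (k b')"
        using t(2) by (auto simp: scanned_def fits_def)
      have bm: "b < m" "b \<notin> S" "cost S + k b \<le> N" using b(2) by (auto simp: fits_def)
      have sub: "insert b S \<subseteq> {..<m}" and fin: "finite S"
        using t(1) bm chosen_subset[of OPEN t] finite_subset[of S "{..<m}"] by (auto simp: greedy_state_def)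
      have cost: "cost (insert b S) = cost S + k b" using bm fin by simp
      have tt: "t TOTAL 0 = cost S" "t SIZE = k" "real (t VALUE 0) = F S"
        using t(1) by (auto simp: greedy_state_def ready_def)
      have val: "real (t VALUE 0 + t CAND_GAIN 0) = F (insert b S)"
        using b(3) tt by simp
      then have "t VALUE 0 + t CAND_GAIN 0 \<le> N * p" using F_le[OF sub] cost bm by linarith
      also have "\<dots> \<le> N * Suc p" by simp
      finally have cv: "t VALUE 0 + t CAND_GAIN 0 < 2 ^ X" using X le_imp_less_power le_trans by blast
      have "N * 1 \<le> N * Suc p" by (intro mult_le_mono2) simp
      then have tot: "cost S + k b < 2 ^ X" using bm X by (intro le_imp_less_power) simp
      have one: "1 < (2 :: nat) ^ X" using bm(1) X(2) by (intro le_imp_less_power) linarith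
      let ?t = "store_upd VALUE 0 (t VALUE 0 + t CAND_GAIN 0) (store_upd TOTAL 0 (cost S + k b) (store_upd OPEN b 1 t))"
      have "greedy_state (insert b S) ?t"
        using t(1) val cost bm by (auto simp: greedy_state_def ready_def chosen_def)
      moreover have "best_fit S b" using b(2) best by (simp add: best_fit_def)
      ultimately have "?Q ?t" by blast
      then show "wp X (Seq (Assign OPEN (Sub (Var CAND) (Const 1)) (Const 1))
        (Seq (Set TOTAL (Add (Var TOTAL) (Cell SIZE (Sub (Var CAND) (Const 1)))))
          (Set VALUE (Add (Var VALUE) (Var CAND_GAIN))))) ?Q t"
        using cv tot one tt b(1) by (intro wp_Seq wp_Assign) auto
    next
      assume "aval (Var CAND) t = 0"
      then have "\<not> fits S b" for b using t(2) by (auto simp: scanned_def fits_def)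
      then show "wp X Skip ?Q t" using t(1) by (intro wp_Skip) auto
    }
  qed
  show ?thesis by (rule wp_conseq[OF *]) (use Q in blast)
qed

text \<open>A round either adds a seminar or finds that nothing fits, and the latter persists. If it
  has not happened within \<open>m\<close> rounds, all \<open>m\<close> seminars are open and again
  nothing fits.\<close>

lemma wp_greedy:
  assumes s: "greedy_state Y s"
    and Q: "\<And>s' S. agree_off (insert ROUND (writes greedy_step)) s s' \<Longrightarrow> greedy_state S s' \<Longrightarrow>
      greedy Y S \<Longrightarrow> (\<And>b. \<not> fits S b) \<Longrightarrow> Q s'"
  shows "wp X (For ROUND num_seminars greedy_step) Q s"
proof (rule wp_For[where n = m and I = "\<lambda>j t. \<exists>S. greedy_state S t \<and> greedy Y S \<and>
      ((\<forall>b. \<not> fits S b) \<or> j \<le> card S)"], goal_cases)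
  case 5
  have "greedy_state Y (store_upd ROUND 0 0 s)"
    using s by (simp add: greedy_state_def ready_def chosen_def)
  then show ?case using greedy.refl by blast
next
  case (6 j t)
  then obtain S where S: "greedy_state S t" "greedy Y S" "(\<forall>b. \<not> fits S b) \<or> j \<le> card S"
    by blast
  have fin: "finite S" using S(1) chosen_subset finite_subset unfolding greedy_state_def by blast
  show ?case
  proof (rule wp_greedy_step[OF S(1)])
    fix u S' assume u: "greedy_state S' u"
      "(\<exists>b. best_fit S b \<and> S' = insert b S) \<or> S' = S \<and> (\<forall>b. \<not> fits S b)"
    have "greedy_state S' (store_upd ROUND 0 (Suc j) u)"
      using u(1) by (simp add: greedy_state_def ready_def chosen_def)
    moreover have "greedy Y S' \<and> ((\<forall>b. \<not> fits S' b) \<or> Suc j \<le> card S')"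
      using u(2) S(2,3) fin greedy.step[OF S(2)] by (auto simp: best_fit_def fits_def)
    ultimately show "\<exists>S. greedy_state S (store_upd ROUND 0 (Suc j) u) \<and> greedy Y S \<and>
      ((\<forall>b. \<not> fits S b) \<or> Suc j \<le> card S)" by blast
  qed
next
  case (7 t)
  then obtain S where S: "greedy_state S t" "greedy Y S" "(\<forall>b. \<not> fits S b) \<or> m \<le> card S"
    by blast
  have sub: "S \<subseteq> {..<m}" using S(1) chosen_subset unfolding greedy_state_def by blast
  have "\<not> fits S b" for b
  proof (cases "m \<le> card S")
    case True
    then have "S = {..<m}" using sub by (intro card_seteq) auto
    then show ?thesis by (simp add: fits_def)
  qed (use S(3) in blast)
  then show ?case using Q[OF 7(1) S(1,2)] by blast
qed (use s X in \<open>auto simp: greedy_state_def ready_def\<close>)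

text \<open>The digits of \<open>e\<close> in base \<open>m\<close>. Repeated digits give seeds of
  one or two seminars.\<close>

definition seed_set :: "nat \<Rightarrow> nat set" where
  "seed_set e = {e div (m * m), (e div m) mod m, e mod m}"

lemma seed_set_subset: "e < m * m * m \<Longrightarrow> seed_set e \<subseteq> {..<m}"
  by (cases "m = 0") (auto simp: seed_set_def div_less_iff_less_mult mult.assoc)

lemma seed_set_surj:
  assumes "y1 < m" "y2 < m" "y3 < m"
  obtains e where "e < m * m * m" "seed_set e = {y1, y2, y3}"
proof
  let ?e = "(y1 * m + y2) * m + y3"
  have "y1 * m + y2 < m * m"
    using assms by (metis add.commute add_less_cancel_left less_le_trans mult_Suc mult_le_mono1 Suc_leI)
  then show "?e < m * m * m"
    using assms(3) by (metis add.commute add_less_cancel_left less_le_trans mult_Suc mult_le_mono1 Suc_leI)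
  have 1: "?e div m = y1 * m + y2" "?e mod m = y3" using assms by auto
  have "?e div (m * m) = y1" using 1(1) assms by (simp add: div_mult2_eq)
  then show "seed_set ?e = {y1, y2, y3}" unfolding seed_set_def 1 using assms by simp
qed

lemma wp_seed:
  assumes r: "ready s" and e: "s SEED 0 < m * m * m"
    and Q: "\<And>s'. agree_off {SEM, OPEN, TOTAL} s s' \<Longrightarrow> chosen OPEN s' = seed_set (s SEED 0) \<Longrightarrow>
      s' TOTAL 0 = cost (seed_set (s SEED 0)) \<Longrightarrow> Q s'"
  shows "wp X seed Q s"
  unfolding seed_def
proof (rule wp_Seq, rule wp_For[where I = "\<lambda>j t. \<forall>b<j. t OPEN b = 0" and n = m], goal_cases)
  case (6 j t)
  then show ?case by (intro wp_Assign) (auto simp: less_Suc_eq)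
next
  case (7 t)
  have eq: "t 0 = s 0" "t SEED = s SEED" "t SIZE = k" and m: "s 0 1 = m"
    using 7(1) r by (auto simp: agree_off_def ready_def)
  let ?e = "s SEED 0"
  let ?t = "store_upd TOTAL 0 0 (store_upd OPEN (?e mod m) 1 (store_upd OPEN ((?e div m) mod m) 1
    (store_upd OPEN (?e div (m * m)) 1 t)))"
  have "m \<noteq> 0" using e by (cases "m = 0") auto
  then have one: "1 < (2::nat) ^ X" using X(2) by (intro le_imp_less_power) linarith
  have ch: "chosen OPEN ?t = seed_set ?e"
    using seed_set_subset[OF e] 7(2) by (auto simp: chosen_def seed_set_def)
  have "wp X (For SEM num_seminars (If (Cell OPEN (Var SEM))
         (Set TOTAL (Add (Var TOTAL) (Cell SIZE (Var SEM)))) Skip)) Q ?t"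
  proof (rule wp_For[where I = "\<lambda>j u. u TOTAL 0 = (\<Sum>b<j. if b \<in> seed_set ?e then k b else 0)" and n = m],
      goal_cases)
    case (6 j u)
    have u: "u OPEN = ?t OPEN" "u SIZE = k"
      using 6(3) eq by (auto simp: agree_off_def)
    have mem: "u OPEN j \<noteq> 0 \<longleftrightarrow> j \<in> seed_set ?e"
      unfolding u(1) ch[symmetric] using 6(1) by (simp add: chosen_def)
    \<comment> \<open>The seed may still exceed the budget here, so the register is bounded by way
      of \<open>k_le\<close>.\<close>
    have "(\<Sum>b<Suc j. if b \<in> seed_set ?e then k b else 0) \<le> (\<Sum>b<Suc j. Suc N)"
      using 6(1) k_le by (intro sum_mono) auto
    also have "\<dots> = Suc j * Suc N" by simp
    also have "\<dots> \<le> m * Suc N" using 6(1) by (intro mult_le_mono1) simp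
    finally have lt: "(\<Sum>b<Suc j. if b \<in> seed_set ?e then k b else 0) < 2 ^ X"
      using X(4) le_imp_less_power le_trans by blast
    show ?case
    proof (rule wp_If)
      assume "aval (Cell OPEN (Var SEM)) u \<noteq> 0"
      then have "j \<in> seed_set ?e" using mem 6(2) by simp
      then show "wp X (Set TOTAL (Add (Var TOTAL) (Cell SIZE (Var SEM))))
          (\<lambda>s'. store_upd SEM 0 (Suc j) s' TOTAL 0 = (\<Sum>b<Suc j. if b \<in> seed_set ?e then k b else 0)) u"
        using 6 u lt by (intro wp_Assign) auto
    next
      assume "aval (Cell OPEN (Var SEM)) u = 0"
      then have "j \<notin> seed_set ?e" using mem 6(2) by simp
      then show "wp X Skip
          (\<lambda>s'. store_upd SEM 0 (Suc j) s' TOTAL 0 = (\<Sum>b<Suc j. if b \<in> seed_set ?e then k b else 0)) u"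
        using 6(4) by (intro wp_Skip) auto
    qed
  next
    case (7 u)
    have "u OPEN = ?t OPEN" using 7(1) by (auto simp: agree_off_def)
    then have "chosen OPEN u = seed_set ?e" using ch by (simp add: chosen_def)
    moreover have "agree_off {SEM, OPEN, TOTAL} s u"
      using 7(1) \<open>agree_off (insert SEM (writes (Assign OPEN (Var SEM) (Const 0)))) s t\<close>
      by (auto simp: agree_off_def)
    ultimately show ?case
      using 7(2) seed_set_subset[OF e] by (intro Q) (auto simp: sum.If_cases Int_absorb1)
  qed (use eq m X in auto)
  then show ?case
    using one by (intro wp_Seq wp_Assign)
      (simp_all add: eq m div_mult2_eq minus_div_mult_eq_mod)
qed (use r X in \<open>auto simp: ready_def\<close>)

text \<open>Every seed within the budget is represented by some completed greedy run; any such run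
  will do, as \<open>greedy_ratio\<close> covers all of them.\<close>

definition best_so_far :: "nat \<Rightarrow> store \<Rightarrow> bool" where
  "best_so_far j s \<longleftrightarrow> cost (chosen BEST_OPEN s) \<le> N \<and> real (s BEST_VALUE 0) = F (chosen BEST_OPEN s) \<and>
     (\<forall>e<j. cost (seed_set e) \<le> N \<longrightarrow>
       (\<exists>S. greedy (seed_set e) S \<and> (\<forall>b. \<not> fits S b) \<and> F S \<le> F (chosen BEST_OPEN s)))"

lemma wp_save_if_better:
  assumes s: "greedy_state S s" and best: "best_so_far e s"
    and greedy: "greedy (seed_set e) S" "\<And>b. \<not> fits S b"
    and Q: "\<And>s'. agree_off {BEST_VALUE, SEM, BEST_OPEN} s s' \<Longrightarrow> best_so_far (Suc e) s' \<Longrightarrow> Q s'"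
  shows "wp X save_if_better Q s"
  unfolding save_if_better_def
proof (rule wp_If)
  have cv: "real (s VALUE 0) = F S" "chosen OPEN s = S" "cost S \<le> N" "s 0 1 = m"
    using s by (auto simp: greedy_state_def ready_def)
  {
    assume "aval (Sub (Var VALUE) (Var BEST_VALUE)) s \<noteq> 0"
    then have less: "F (chosen BEST_OPEN s) \<le> F S"
      using cv best by (simp add: best_so_far_def flip: cv(1))
    show "wp X (Seq (Set BEST_VALUE (Var VALUE)) (For SEM num_seminars (Assign BEST_OPEN (Var SEM) (Cell OPEN (Var SEM))))) Q s"
    proof (rule wp_Seq, rule wp_Assign_Cell,
        rule wp_For[where I = "\<lambda>j t. \<forall>b<j. t BEST_OPEN b = s OPEN b" and n = m], goal_cases)
      case (6 j t)
      then have "t OPEN = s OPEN" by (auto simp: agree_off_def)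
      with 6 show ?case by (intro wp_Assign_Cell) (auto simp: less_Suc_eq)
    next
      case (7 t)
      have "chosen BEST_OPEN t = S" using 7(2) cv(2) by (auto simp: chosen_def)
      moreover have "t BEST_VALUE 0 = s VALUE 0" using 7(1) by (auto simp: agree_off_def)
      moreover have "\<exists>S'. greedy (seed_set e') S' \<and> (\<forall>b. \<not> fits S' b) \<and> F S' \<le> F S"
        if e': "e' < Suc e" "cost (seed_set e') \<le> N" for e'
      proof (cases "e' = e")
        case False
        then obtain S' where "greedy (seed_set e') S'" "\<forall>b. \<not> fits S' b" "F S' \<le> F (chosen BEST_OPEN s)"
          using best e' unfolding best_so_far_def by (meson less_SucE)
        then show ?thesis using less by fastforce
      qed (use greedy in blast)
      ultimately have "best_so_far (Suc e) t"
        using cv unfolding best_so_far_def by simp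
      moreover have "agree_off {BEST_VALUE, SEM, BEST_OPEN} s t" using 7(1) by (auto simp: agree_off_def)
      ultimately show ?case by (rule Q[rotated])
    qed (use cv X in auto)
  next
    assume "aval (Sub (Var VALUE) (Var BEST_VALUE)) s = 0"
    then have "F S \<le> F (chosen BEST_OPEN s)"
      using cv best by (simp add: best_so_far_def flip: cv(1))
    then have "best_so_far (Suc e) s"
      using best greedy unfolding best_so_far_def by (auto simp: less_Suc_eq)
    then show "wp X Skip Q s" by (intro wp_Skip Q) (auto simp: agree_off_def)
  }
qed

lemma best_so_far_cong:
  "best_so_far j s \<Longrightarrow> s' BEST_OPEN = s BEST_OPEN \<Longrightarrow> s' BEST_VALUE = s BEST_VALUE \<Longrightarrow> best_so_far j s'"
  by (simp add: best_so_far_def chosen_def)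

lemma wp_try_seed:
  assumes r: "ready s" and best: "best_so_far e s" and e: "s SEED 0 = e" "e < m * m * m"
  shows "wp X try_seed (\<lambda>s'. best_so_far (Suc e) s') s"
  unfolding try_seed_def
proof (rule wp_Seq, rule wp_seed[OF r])
  fix t assume t: "agree_off {SEM, OPEN, TOTAL} s t" "chosen OPEN t = seed_set (s SEED 0)"
    "t TOTAL 0 = cost (seed_set (s SEED 0))"
  have rt: "ready t" by (rule ready_cong[OF r t(1)]) simp
  have bt: "best_so_far e t" by (rule best_so_far_cong[OF best]) (use t(1) in \<open>auto simp: agree_off_def\<close>)
  show "wp X (If (fit_test (Var TOTAL)) (Seq (auction OPEN) (Seq (Set VALUE (Var GAIN))
       (Seq (For ROUND num_seminars greedy_step) save_if_better))) Skip) (best_so_far (Suc e)) t"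
  proof (rule wp_If)
    assume "aval (fit_test (Var TOTAL)) t \<noteq> 0"
    then have le: "cost (seed_set e) \<le> N"
      unfolding aval_fit_test using t(3) rt e by (simp add: ready_def)
    show "wp X (Seq (auction OPEN) (Seq (Set VALUE (Var GAIN))
       (Seq (For ROUND num_seminars greedy_step) save_if_better))) (best_so_far (Suc e)) t"
    proof (rule wp_Seq, rule wp_auction_ready[OF rt])
      show "cost (chosen OPEN t) \<le> N" using le t(2) e by simp
      fix u assume u: "agree_off auction_writes t u" "real (u GAIN 0) = F (chosen OPEN t)"
      let ?u = "store_upd VALUE 0 (u GAIN 0) u"
      have ru: "ready u" by (rule ready_cong[OF rt u(1)]) simp
      have "greedy_state (seed_set e) ?u"
        using ru u t le e by (auto simp: greedy_state_def ready_def chosen_def agree_off_def)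
      moreover have "best_so_far e ?u"
        by (rule best_so_far_cong[OF bt]) (use u(1) in \<open>auto simp: agree_off_def\<close>)
      ultimately have "wp X (Seq (For ROUND num_seminars greedy_step) save_if_better) (best_so_far (Suc e)) ?u"
      proof (intro wp_Seq, elim wp_greedy)
        fix v S assume v: "agree_off (insert ROUND (writes greedy_step)) ?u v" "greedy_state S v"
          "greedy (seed_set e) S" "\<And>b. \<not> fits S b" and "best_so_far e ?u"
        then have "best_so_far e v"
          by (elim best_so_far_cong) (auto simp: agree_off_def)
        then show "wp X save_if_better (best_so_far (Suc e)) v"
          using v by (intro wp_save_if_better) auto
      qed
      then show "wp X (Seq (Set VALUE (Var GAIN)) (Seq (For ROUND num_seminars greedy_step) save_if_better))
          (best_so_far (Suc e)) u"
        by (intro wp_Seq[of _ "Set VALUE (Var GAIN)"] wp_Assign_Cell) simp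
    qed simp
  next
    assume "aval (fit_test (Var TOTAL)) t = 0"
    then have "\<not> cost (seed_set e) \<le> N"
      using aval_fit_test[of "Var TOTAL" t] t(3) rt e by (auto simp: ready_def)
    then show "wp X Skip (best_so_far (Suc e)) t"
      using bt by (intro wp_Skip) (auto simp: best_so_far_def less_Suc_eq)
  qed
qed (use e in simp)

text \<open>A nonempty competitor \<open>U\<close> has a triple of its own from
  \<open>seed_triple\<close>. The enumeration has tried this triple, so \<open>greedy_ratio\<close>
  applies to a completed run that the recorded best value dominates.\<close>

lemma wp_optimise:
  assumes r: "ready s" and init: "\<And>b. s BEST_OPEN b = 0" "s BEST_VALUE 0 = 0"
  shows "wp X optimise (\<lambda>s'. \<exists>S\<subseteq>{..<m}. cost S \<le> N \<and> exact_fill N m k S (s' WHO) \<and>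
    (\<forall>U\<subseteq>{..<m}. cost U \<le> N \<longrightarrow>
      (1 - exp (-1) + 1 / (100 * (real N + 1))) * F U \<le> real (gain N P (s' WHO)))) s"
  unfolding optimise_def
proof (rule wp_Seq, rule wp_For[where I = best_so_far and n = "m * m * m"], goal_cases)
  case 5
  then show ?case using init by (simp add: best_so_far_def chosen_def fill_value_empty)
next
  case (6 e t)
  have "ready t" by (rule ready_cong[OF r 6(3)]) simp
  then have "wp X try_seed (best_so_far (Suc e)) t" using 6 by (intro wp_try_seed) auto
  then show ?case by (rule wp_conseq) (auto intro: best_so_far_cong)
next
  case (7 t)
  have rt: "ready t" by (rule ready_cong[OF r 7(1)]) simp
  show ?case
  proof (rule wp_auction_ready[OF rt], goal_cases)
    case (3 u)
    let ?S = "chosen BEST_OPEN t"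
    have "(1 - exp (-1) + 1 / (100 * (real N + 1))) * F U \<le> F ?S"
      if U: "U \<subseteq> {..<m}" "cost U \<le> N" for U
    proof (cases "U = {}")
      case True
      then show ?thesis by (simp add: fill_value_empty fill_value_nonneg)
    next
      case False
      obtain y1 y2 y3 where y: "y1 \<in> U" "y2 \<in> U" "y3 \<in> U"
        "\<And>r. r \<in> U \<Longrightarrow> marginal {y1, y2, y3} r \<le> F {y1, y2, y3} / 3"
        using seed_triple[OF U(1) False] by blast
      obtain e where e: "e < m * m * m" "seed_set e = {y1, y2, y3}"
        using seed_set_surj[of y1 y2 y3] y U by blast
      have sub: "seed_set e \<subseteq> U" using e y by auto
      have "cost (seed_set e) \<le> cost U"
        using sum_mono2[OF finite_subset[OF U(1)] sub, where f = k] by simp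
      then obtain S where S: "greedy (seed_set e) S" "\<And>b. \<not> fits S b" "F S \<le> F ?S"
        using 7(2) e(1) U(2) unfolding best_so_far_def by fastforce
      have "(1 - exp (-1) + 1 / (100 * (real N + 1))) * F U \<le> F S"
        using y(4) by (intro greedy_ratio[OF sub U _ S(1,2)]) (simp add: e(2))
      with S(3) show ?thesis by linarith
    qed
    then show ?case
      using 3 7(2) chosen_subset by (intro exI[of _ ?S]) (auto simp: best_so_far_def)
  qed (use 7(2) in \<open>auto simp: best_so_far_def\<close>)
qed (use r X in \<open>auto simp: ready_def\<close>)

end

section \<open>Reading the input and rounding the profits\<close>

abbreviation (input) "PTR \<equiv> 7 :: nat"
abbreviation (input) "PAIR \<equiv> 9 :: nat"
abbreviation (input) "MAX_NUM \<equiv> 10 :: nat"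
abbreviation (input) "MAX_DEN \<equiv> 11 :: nat"

text \<open>A block holds the cardinality and then the elements in increasing order. As 0 is among
  them, a second element is the positive size, found at offset 2.\<close>

definition read_sizes :: com where
  "read_sizes = Seq (Set PTR (Add (Const 2) (Mul (Const 2) (Mul num_students num_seminars))))
     (For SEM num_seminars
       (Seq (Assign SIZE (Var SEM) (Add num_students (Const 1)))
       (Seq (If (Sub (Cell 0 (Var PTR)) (Const 1))
              (If (fit_test (Cell 0 (Add (Var PTR) (Const 2))))
                (Assign SIZE (Var SEM) (Cell 0 (Add (Var PTR) (Const 2)))) Skip) Skip)
            (Set PTR (Add (Var PTR) (Add (Cell 0 (Var PTR)) (Const 1)))))))"

definition column :: aexp where
  "column = Sub (Var PAIR) (Mul (Div (Var PAIR) num_seminars) num_seminars)"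

definition numerator :: aexp where
  "numerator = Cell 0 (Add (Const 2) (Mul (Const 2) (Var PAIR)))"

definition denominator :: aexp where
  "denominator = Cell 0 (Add (Const 3) (Mul (Const 2) (Var PAIR)))"

text \<open>Seminars that cannot be opened are left out: a huge profit there would set the scale and
  could round all relevant profits to 0.\<close>

definition find_max_profit :: com where
  "find_max_profit = Seq (Set MAX_NUM (Const 0)) (Seq (Set MAX_DEN (Const 1))
     (For PAIR (Mul num_students num_seminars)
       (If (fit_test (Cell SIZE column))
         (If (Sub (Mul numerator (Var MAX_DEN)) (Mul (Var MAX_NUM) denominator))
           (Seq (Set MAX_NUM numerator) (Set MAX_DEN denominator)) Skip) Skip)))"

text \<open>Profits are rounded down to multiples of a fraction \<open>1 / resolution N\<close> of the largest one. The
  total relative error \<open>N / resolution N\<close> must stay below the surplus \<open>1 / (100 * (N + 1))\<close> of the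
  greedy algorithm.\<close>

definition resolution :: "nat \<Rightarrow> nat" where
  "resolution N = 100 * ((N + 1) * (N + 1))"

definition resolution_exp :: aexp where
  "resolution_exp = Mul (Const 100)
     (Mul (Add num_students (Const 1)) (Add num_students (Const 1)))"

text \<open>The factor \<open>N + 1\<close> outside the division produces the multiples that make
  the auction exact. If all eligible profits are 0, the division by 0 yields 0.\<close>

definition round_profits :: com where
  "round_profits = For PAIR (Mul num_students num_seminars)
     (If (fit_test (Cell SIZE column))
       (Assign PROFIT (Var PAIR) (Mul (Add num_students (Const 1))
         (Div (Mul (Mul numerator (Var MAX_DEN)) resolution_exp) (Mul denominator (Var MAX_NUM))))) Skip)"

text \<open>Without seminars the input consists of the two counts alone. The number of students can
  then be exponential in the input size, so no loop over the students may be run.\<close>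

definition sap_program :: com where
  "sap_program = If num_seminars
     (Seq read_sizes (Seq find_max_profit (Seq round_profits optimise))) Skip"

section \<open>Verification of reading and rounding\<close>

lemma writes_read_sizes [simp]: "writes read_sizes = {PTR, SEM, SIZE}"
  by (auto simp: read_sizes_def)

lemma writes_find_max_profit [simp]: "writes find_max_profit = {MAX_NUM, MAX_DEN, PAIR}"
  by (auto simp: find_max_profit_def)

lemma writes_round_profits [simp]: "writes round_profits = {PAIR, PROFIT}"
  by (auto simp: round_profits_def)

lemma aval_column [simp]: "aval column s = s PAIR 0 mod s 0 1"
  by (simp add: column_def minus_div_mult_eq_mod)

lemma aval_resolution_exp [simp]: "aval resolution_exp s = resolution (s 0 0)"
  by (simp add: resolution_exp_def resolution_def)

lemma aval_numerator [simp]: "aval numerator s = s 0 (2 + 2 * s PAIR 0)"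
  by (simp add: numerator_def)

lemma aval_denominator [simp]: "aval denominator s = s 0 (3 + 2 * s PAIR 0)"
  by (simp add: denominator_def)

locale encoded_input =
  fixes N m :: nat and num den :: "nat \<Rightarrow> nat \<Rightarrow> nat" and K :: "nat \<Rightarrow> nat set"
    and ptr :: "nat \<Rightarrow> nat" and s0 :: store and X :: nat
  assumes m_pos: "0 < m"
    and counts: "s0 0 0 = N" "s0 0 1 = m"
    and cells: "i < N \<Longrightarrow> b < m \<Longrightarrow> s0 0 (2 + 2 * (i * m + b)) = num i b"
      "i < N \<Longrightarrow> b < m \<Longrightarrow> s0 0 (3 + 2 * (i * m + b)) = den i b"
    and ptr_0: "ptr 0 = 2 + 2 * (N * m)"
    and ptr_Suc: "b < m \<Longrightarrow> ptr (Suc b) = ptr b + card (K b) + 1"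
    and ptr_le: "b \<le> m \<Longrightarrow> ptr b \<le> X"
    and ptr_card: "b < m \<Longrightarrow> s0 0 (ptr b) = card (K b)"
    and ptr_Max: "b < m \<Longrightarrow> card (K b) = 2 \<Longrightarrow> s0 0 (ptr b + 2) = Max (K b)"
    and K: "b < m \<Longrightarrow> 0 \<in> K b" "b < m \<Longrightarrow> finite (K b)" "b < m \<Longrightarrow> card (K b) \<le> 2"
    and den_pos: "i < N \<Longrightarrow> b < m \<Longrightarrow> 0 < den i b"
    and other: "a \<noteq> 0 \<Longrightarrow> s0 a j = 0"
    and X_large: "200 * (N + m + 1) ^ 4 \<le> X"
begin

text \<open>A seminar that cannot be opened gets the size \<open>N + 1\<close>, so that it never fits.\<close>

definition k :: "nat \<Rightarrow> nat" where
  "k b = (if b < m then if card (K b) = 2 \<and> Max (K b) \<le> N then Max (K b) else Suc N else 0)"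

definition p :: nat where
  "p = (N + 1) * resolution N"

text \<open>The dominant quantity is \<open>N * Suc p\<close> with
  \<open>p = 100 * (N + 1) ^ 3\<close>, of degree four. This explains the fourth power in
  \<open>X_large\<close>, whose constant leaves slack over the 101 obtained here.\<close>

lemma X_bounds: "N * Suc p \<le> X" "m \<le> X" "m * m * m \<le> X" "m * Suc N \<le> X" "N * m \<le> X" "Suc N \<le> X" "p \<le> X"
proof -
  let ?y = "N + m + 1"
  have y: "1 \<le> ?y" by simp
  have pw: "?y ^ j \<le> ?y ^ 4" if "j \<le> 4" for j using that y by (intro power_increasing) auto
  have "p = 100 * ((N + 1) * (N + 1) * (N + 1))" by (simp add: p_def resolution_def algebra_simps)
  also have "\<dots> \<le> 100 * (?y * ?y * ?y)" by (intro mult_le_mono) auto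
  finally have p: "p \<le> 100 * ?y ^ 3" by (simp only: power3_eq_cube)
  then have p4: "p \<le> 100 * ?y ^ 4" using pw[of 3] by linarith
  have "Suc p \<le> 101 * ?y ^ 3" using p one_le_power[OF y, of 3] by linarith
  then have "N * Suc p \<le> ?y * (101 * ?y ^ 3)" by (intro mult_le_mono) auto
  also have "\<dots> = 101 * ?y ^ 4" by (simp add: power_Suc[symmetric] del: power_Suc)
  finally show "N * Suc p \<le> X" using X_large by linarith
  have "m * m * m \<le> ?y ^ 3" unfolding power3_eq_cube by (intro mult_le_mono) auto
  then show "m * m * m \<le> X" using pw[of 3] X_large by linarith
  have "m * Suc N \<le> ?y ^ 2" unfolding power2_eq_square by (intro mult_le_mono) auto
  then show "m * Suc N \<le> X" using pw[of 2] X_large by linarith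
  have "N * m \<le> ?y ^ 2" unfolding power2_eq_square by (intro mult_le_mono) auto
  then show "N * m \<le> X" using pw[of 2] X_large by linarith
  show "m \<le> X" "Suc N \<le> X" using pw[of 1] X_large by simp_all
  show "p \<le> X" using p4 X_large by linarith
qed

lemma K_cases:
  assumes "b < m"
  obtains "card (K b) = 1" "K b = {0}"
    | "card (K b) = 2" "K b = {0, Max (K b)}" "0 < Max (K b)"
proof (cases "K b = {0}")
  case True
  then show ?thesis using that(1) by simp
next
  case False
  have c: "card (K b - {0}) \<le> 1" "finite (K b)" "0 \<in> K b"
    using K[OF assms] by auto
  obtain x where x: "x \<in> K b" "x \<noteq> 0" using False K(1)[OF assms] by auto
  have "K b - {0} = {x}"
  proof (rule ccontr)
    assume "K b - {0} \<noteq> {x}"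
    then have "{x} \<subset> K b - {0}" using x by auto
    then have "card {x} < card (K b - {0})" using c(2) by (intro psubset_card_mono) auto
    then show False using c(1) by simp
  qed
  then have "K b = {0, x}" using c(3) by auto
  then show ?thesis using that(2) x(2) by simp
qed

lemma k_pos: "b < m \<Longrightarrow> 0 < k b"
  by (cases b rule: K_cases) (auto simp: k_def)

lemma wp_read_sizes:
  assumes s: "s 0 = s0 0" "\<And>j. s SIZE j = 0"
    and Q: "\<And>s'. agree_off {PTR, SEM, SIZE} s s' \<Longrightarrow> s' SIZE = k \<Longrightarrow> Q s'"
  shows "wp X read_sizes Q s"
  unfolding read_sizes_def
proof (rule wp_Seq, rule wp_Assign)
  let ?I = "\<lambda>j t. t PTR 0 = ptr j \<and> (\<forall>b. t SIZE b = (if b < j then k b else 0))"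
  show "aval (Add (Const 2) (Mul (Const 2) (Mul num_students num_seminars))) s < 2 ^ X"
    using le_imp_less_power[OF ptr_le[of 0]] by (simp add: s counts ptr_0)
  let ?s = "store_upd PTR (aval (Const 0) s)
      (aval (Add (Const 2) (Mul (Const 2) (Mul num_students num_seminars))) s) s"
  show "wp X (For SEM num_seminars
       (Seq (Assign SIZE (Var SEM) (Add num_students (Const 1)))
       (Seq (If (Sub (Cell 0 (Var PTR)) (Const 1))
              (If (fit_test (Cell 0 (Add (Var PTR) (Const 2))))
                (Assign SIZE (Var SEM) (Cell 0 (Add (Var PTR) (Const 2)))) Skip) Skip)
            (Set PTR (Add (Var PTR) (Add (Cell 0 (Var PTR)) (Const 1))))))) Q ?s"
  proof (rule wp_For[where I = ?I and n = m], goal_cases)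
    case (6 b t)
    have t: "t 0 = s0 0" using 6(3) s(1) by (auto simp: agree_off_def)
    have ptrb: "t PTR 0 = ptr b" using 6(4) by simp
    let ?t = "store_upd SIZE b (Suc N) t"
    let ?next = "Set PTR (Add (Var PTR) (Add (Cell 0 (Var PTR)) (Const 1)))"
    let ?post = "\<lambda>s'. ?I (Suc b) (store_upd SEM 0 (Suc b) s')"
    have advance: "wp X ?next
      ?post u"
      if u: "u 0 = s0 0" "u PTR = t PTR" "u SIZE = (t SIZE)(b := k b)" for u
    proof (rule wp_Assign)
      have eq: "aval (Add (Var PTR) (Add (Cell 0 (Var PTR)) (Const 1))) u = ptr (Suc b)"
        using u ptrb ptr_card[OF 6(1)] ptr_Suc[OF 6(1)] by simp
      then show "aval (Add (Var PTR) (Add (Cell 0 (Var PTR)) (Const 1))) u < 2 ^ X"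
        using le_imp_less_power[OF ptr_le[of "Suc b"]] 6(1) by simp
      show "?I (Suc b) (store_upd SEM 0 (Suc b) (store_upd PTR (aval (Const 0) u)
        (aval (Add (Var PTR) (Add (Cell 0 (Var PTR)) (Const 1))) u) u))"
        unfolding eq using u 6(4) by (auto simp: less_Suc_eq)
    qed
    have "wp X (Seq (If (Sub (Cell 0 (Var PTR)) (Const 1))
              (If (fit_test (Cell 0 (Add (Var PTR) (Const 2))))
                (Assign SIZE (Var SEM) (Cell 0 (Add (Var PTR) (Const 2)))) Skip) Skip)
            ?next)
          ?post ?t"
    proof (rule wp_Seq, rule wp_If)
      assume "aval (Sub (Cell 0 (Var PTR)) (Const 1)) ?t \<noteq> 0"
      then have "1 < card (K b)" using t ptrb ptr_card[OF 6(1)] by simp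
      then have two: "card (K b) = 2" using K(3)[OF 6(1)] by simp
      note Max = ptr_Max[OF 6(1) two]
      show "wp X (If (fit_test (Cell 0 (Add (Var PTR) (Const 2))))
                (Assign SIZE (Var SEM) (Cell 0 (Add (Var PTR) (Const 2)))) Skip)
        (wp X ?next ?post) ?t"
      proof (rule wp_If)
        assume "aval (fit_test (Cell 0 (Add (Var PTR) (Const 2)))) ?t \<noteq> 0"
        then have "Max (K b) \<le> N"
          unfolding aval_fit_test using t ptrb Max counts by simp
        then have "k b = Max (K b)" using 6(1) two by (simp add: k_def)
        then show "wp X (Assign SIZE (Var SEM) (Cell 0 (Add (Var PTR) (Const 2))))
          (wp X ?next ?post) ?t"
          using t ptrb Max 6(2) by (intro wp_Assign_Cell advance) auto
      next
        assume "aval (fit_test (Cell 0 (Add (Var PTR) (Const 2)))) ?t = 0"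
        then have "\<not> Max (K b) \<le> N"
          using aval_fit_test[of "Cell 0 (Add (Var PTR) (Const 2))" ?t] t ptrb Max counts by simp
        then have "k b = Suc N" using 6(1) by (simp add: k_def)
        then show "wp X Skip (wp X ?next ?post) ?t"
          using t by (intro wp_Skip advance) auto
      qed
    next
      assume "aval (Sub (Cell 0 (Var PTR)) (Const 1)) ?t = 0"
      then have "card (K b) \<noteq> 2" using t ptrb ptr_card[OF 6(1)] by simp
      then have "k b = Suc N" using 6(1) by (simp add: k_def)
      then show "wp X Skip (wp X ?next ?post) ?t"
        using t by (intro wp_Skip advance) auto
    qed
    then show ?case
      using 6(2) t counts le_imp_less_power[OF X_bounds(6)]
      by (intro wp_Seq[of _ "Assign SIZE (Var SEM) (Add num_students (Const 1))"] wp_Assign)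
        (simp_all flip: Suc_eq_plus1)
  next
    case (7 t)
    have "t SIZE = k" using 7(2) by (auto simp: k_def)
    moreover have "agree_off {PTR, SEM, SIZE} s t" using 7(1) by (auto simp: agree_off_def)
    ultimately show ?case by (intro Q)
  qed (use s counts X_bounds ptr_0 in auto)
qed

definition eligible :: "nat \<Rightarrow> nat \<Rightarrow> bool" where
  "eligible i b \<longleftrightarrow> i < N \<and> b < m \<and> k b \<le> N"

text \<open>\<open>x / y\<close> is the largest profit of an eligible pair, or 0.\<close>

definition max_ratio :: "nat \<Rightarrow> nat \<Rightarrow> bool" where
  "max_ratio x y \<longleftrightarrow> 0 < y \<and> (\<forall>i b. eligible i b \<longrightarrow> num i b * y \<le> x * den i b) \<and>
     (x = 0 \<or> (\<exists>i b. eligible i b \<and> x = num i b \<and> y = den i b))"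

lemma cell_index:
  assumes "l < N * m"
  shows "l div m < N" "l mod m < m" "(l div m) * m + l mod m = l"
  using assms m_pos by (auto simp: div_less_iff_less_mult)

lemma cell_values:
  assumes "l < N * m"
  shows "s0 0 (2 + 2 * l) = num (l div m) (l mod m)" "s0 0 (3 + 2 * l) = den (l div m) (l mod m)"
  using cells[OF cell_index(1,2)[OF assms]] unfolding cell_index(3)[OF assms] by simp_all

lemma wp_find_max_profit:
  assumes s: "s 0 = s0 0" "s SIZE = k"
    and Q: "\<And>s'. agree_off {MAX_NUM, MAX_DEN, PAIR} s s' \<Longrightarrow> max_ratio (s' MAX_NUM 0) (s' MAX_DEN 0) \<Longrightarrow> Q s'"
  shows "wp X find_max_profit Q s"
  unfolding find_max_profit_def
proof (intro wp_Seq wp_Assign, goal_cases)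
  case 1
  show ?case by simp
next
  case 2
  show ?case using le_imp_less_power[of 1 X] X_bounds(6) by simp
next
  case 3
  let ?I = "\<lambda>j t. 0 < t MAX_DEN 0 \<and>
    (\<forall>l<j. k (l mod m) \<le> N \<longrightarrow>
       num (l div m) (l mod m) * t MAX_DEN 0 \<le> t MAX_NUM 0 * den (l div m) (l mod m)) \<and>
    (t MAX_NUM 0 = 0 \<or> (\<exists>i b. eligible i b \<and> t MAX_NUM 0 = num i b \<and> t MAX_DEN 0 = den i b))"
  show ?case
  proof (rule wp_For[where I = ?I and n = "N * m"], goal_cases)
    case (6 l t)
    have t: "t 0 = s0 0" "t SIZE = k" using 6(3) s by (auto simp: agree_off_def)
    let ?n = "num (l div m) (l mod m)" and ?d = "den (l div m) (l mod m)"
    have val: "aval numerator t = ?n" "aval denominator t = ?d" "aval (Cell SIZE column) t = k (l mod m)"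
      using cell_values[OF 6(1)] 6(2) t counts by simp_all
    have d: "0 < ?d" using den_pos cell_index[OF 6(1)] by blast
    show ?case
    proof (rule wp_If)
      assume "aval (fit_test (Cell SIZE column)) t \<noteq> 0"
      then have el: "k (l mod m) \<le> N" unfolding aval_fit_test val using t counts by simp
      show "wp X (If (Sub (Mul numerator (Var MAX_DEN)) (Mul (Var MAX_NUM) denominator))
           (Seq (Set MAX_NUM numerator) (Set MAX_DEN denominator)) Skip)
           (\<lambda>s'. ?I (Suc l) (store_upd PAIR 0 (Suc l) s')) t"
      proof (rule wp_If)
        assume "aval (Sub (Mul numerator (Var MAX_DEN)) (Mul (Var MAX_NUM) denominator)) t \<noteq> 0"
        then have less: "t MAX_NUM 0 * ?d < ?n * t MAX_DEN 0" using val by simp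
        have dom: "num (l' div m) (l' mod m) * ?d \<le> ?n * den (l' div m) (l' mod m)"
          if l': "l' < Suc l" "k (l' mod m) \<le> N" for l'
        proof (cases "l' = l")
          case False
          let ?n' = "num (l' div m) (l' mod m)" and ?d' = "den (l' div m) (l' mod m)"
          have "?n' * t MAX_DEN 0 \<le> t MAX_NUM 0 * ?d'" using 6(4) l' False by auto
          \<comment> \<open>Transitivity of the comparison of fractions; the positive
            \<open>MAX_DEN\<close> cancels.\<close>
          then have "(?n' * ?d) * t MAX_DEN 0 \<le> (t MAX_NUM 0 * ?d) * ?d'"
            using mult_le_mono1[of "?n' * t MAX_DEN 0" _ ?d] by (simp add: mult_ac)
          also have "\<dots> \<le> (?n * t MAX_DEN 0) * ?d'" using less by (intro mult_le_mono1) simp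
          finally have "(?n' * ?d) * t MAX_DEN 0 \<le> (?n * ?d') * t MAX_DEN 0" by (simp add: mult_ac)
          then show ?thesis using 6(4) by simp
        qed simp
        have "eligible (l div m) (l mod m)"
          using el cell_index[OF 6(1)] by (simp add: eligible_def)
        then have "?I (Suc l) (store_upd PAIR 0 (Suc l) (store_upd MAX_DEN 0 ?d (store_upd MAX_NUM 0 ?n t)))"
          using dom d by auto
        then have *: "?I (Suc l) (store_upd PAIR 0 (Suc l) (store_upd MAX_DEN 0 (aval denominator t)
            (store_upd MAX_NUM 0 (aval numerator t) t)))"
          unfolding val by simp
        show "wp X (Seq (Set MAX_NUM numerator) (Set MAX_DEN denominator))
           (\<lambda>s'. ?I (Suc l) (store_upd PAIR 0 (Suc l) s')) t"
          using * unfolding numerator_def denominator_def by (intro wp_Seq wp_Assign_Cell) simp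
      next
        assume "aval (Sub (Mul numerator (Var MAX_DEN)) (Mul (Var MAX_NUM) denominator)) t = 0"
        then have "?n * t MAX_DEN 0 \<le> t MAX_NUM 0 * ?d" using val by simp
        then show "wp X Skip (\<lambda>s'. ?I (Suc l) (store_upd PAIR 0 (Suc l) s')) t"
          using 6(4) by (intro wp_Skip) (auto simp: less_Suc_eq)
      qed
    next
      assume "aval (fit_test (Cell SIZE column)) t = 0"
      then have "\<not> k (l mod m) \<le> N"
        using aval_fit_test[of "Cell SIZE column" t] val t counts by simp
      then show "wp X Skip (\<lambda>s'. ?I (Suc l) (store_upd PAIR 0 (Suc l) s')) t"
        using 6(4) by (intro wp_Skip) (auto simp: less_Suc_eq)
    qed
  next
    case (7 t)
    have "agree_off {MAX_NUM, MAX_DEN, PAIR} s t" using 7(1) by (auto simp: agree_off_def)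
    moreover have "num i b * t MAX_DEN 0 \<le> t MAX_NUM 0 * den i b" if "eligible i b" for i b
    proof -
      have ib: "i < N" "b < m" "k b \<le> N" using that by (auto simp: eligible_def)
      have "i * m + b < N * m"
      proof -
        have "i * m + b < Suc i * m" using ib by simp
        also have "\<dots> \<le> N * m" using ib by (intro mult_le_mono1) simp
        finally show ?thesis .
      qed
      moreover have "(i * m + b) div m = i" "(i * m + b) mod m = b" using ib by auto
      ultimately show ?thesis using 7(2) ib(3) by metis
    qed
    ultimately show ?case using 7(2) by (intro Q) (auto simp: max_ratio_def)
  qed (use s counts X_bounds in \<open>auto simp: numerator_def denominator_def column_def fit_test_def\<close>)
qed

definition rounded :: "nat \<Rightarrow> nat \<Rightarrow> nat \<Rightarrow> nat \<Rightarrow> nat" where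
  "rounded x y i b = (N + 1) * ((num i b * y * resolution N) div (den i b * x))"

lemma rounded_le:
  assumes "max_ratio x y" "eligible i b"
  shows "rounded x y i b \<le> p"
proof -
  have le: "num i b * y \<le> den i b * x"
    using assms by (auto simp: max_ratio_def mult.commute)
  have "(num i b * y * resolution N) div (den i b * x) \<le> resolution N"
  proof (cases "den i b * x = 0")
    case False
    have "(num i b * y * resolution N) div (den i b * x) \<le>
        (den i b * x * resolution N) div (den i b * x)"
      using le by (intro div_le_mono mult_le_mono1)
    then show ?thesis using False by simp
  qed auto
  then show ?thesis unfolding rounded_def p_def by (rule mult_le_mono2)
qed

lemma Suc_dvd_rounded: "Suc N dvd rounded x y i b"
  unfolding rounded_def Suc_eq_plus1 by (rule dvd_triv_left)

lemma wp_round_profits: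
  assumes s: "s 0 = s0 0" "s SIZE = k" and max: "max_ratio (s MAX_NUM 0) (s MAX_DEN 0)"
    and Q: "\<And>s'. agree_off {PAIR, PROFIT} s s' \<Longrightarrow>
      (\<And>i b. eligible i b \<Longrightarrow> s' PROFIT (i * m + b) = rounded (s MAX_NUM 0) (s MAX_DEN 0) i b) \<Longrightarrow> Q s'"
  shows "wp X round_profits Q s"
  unfolding round_profits_def
proof (rule wp_For[where n = "N * m" and I = "\<lambda>j t. \<forall>l<j. k (l mod m) \<le> N \<longrightarrow>
      t PROFIT l = rounded (s MAX_NUM 0) (s MAX_DEN 0) (l div m) (l mod m)"], goal_cases)
  case (6 l t)
  have t: "t 0 = s0 0" "t SIZE = k" "t MAX_NUM = s MAX_NUM" "t MAX_DEN = s MAX_DEN"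
    using 6(3) s by (auto simp: agree_off_def)
  let ?r = "rounded (s MAX_NUM 0) (s MAX_DEN 0) (l div m) (l mod m)"
  let ?e = "Mul (Add num_students (Const 1))
         (Div (Mul (Mul numerator (Var MAX_DEN)) resolution_exp) (Mul denominator (Var MAX_NUM)))"
  have val: "aval ?e t = ?r" "aval (Cell SIZE column) t = k (l mod m)"
    using cell_values[OF 6(1)] 6(2) t counts by (simp_all add: rounded_def)
  show ?case
  proof (rule wp_If)
    assume "aval (fit_test (Cell SIZE column)) t \<noteq> 0"
    then have "k (l mod m) \<le> N" unfolding aval_fit_test val using t counts by simp
    then have "eligible (l div m) (l mod m)"
      using cell_index[OF 6(1)] by (simp add: eligible_def)
    \<comment> \<open>Only the rounded profit is stored; the much larger products inside the
      expression never occupy a cell.\<close>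
    then have "?r \<le> X" using rounded_le[OF max] X_bounds(7) le_trans by blast
    then have "aval ?e t < 2 ^ X" unfolding val by (rule le_imp_less_power)
    moreover have "aval (Var PAIR) t = l" using 6(2) by simp
    ultimately show "wp X (Assign PROFIT (Var PAIR) ?e) (\<lambda>s'. \<forall>l'<Suc l. k (l' mod m) \<le> N \<longrightarrow>
      store_upd PAIR 0 (Suc l) s' PROFIT l' = rounded (s MAX_NUM 0) (s MAX_DEN 0) (l' div m) (l' mod m)) t"
      using 6(4) val(1) by (intro wp_Assign) (auto simp: less_Suc_eq simp del: aval.simps)
  next
    assume "aval (fit_test (Cell SIZE column)) t = 0"
    then have "\<not> k (l mod m) \<le> N"
      using aval_fit_test[of "Cell SIZE column" t] val(2) t counts by simp
    then show "wp X Skip (\<lambda>s'. \<forall>l'<Suc l. k (l' mod m) \<le> N \<longrightarrow>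
      store_upd PAIR 0 (Suc l) s' PROFIT l' = rounded (s MAX_NUM 0) (s MAX_DEN 0) (l' div m) (l' mod m)) t"
      using 6(4) by (intro wp_Skip) (auto simp: less_Suc_eq)
  qed
next
  case (7 t)
  have "t PROFIT (i * m + b) = rounded (s MAX_NUM 0) (s MAX_DEN 0) i b" if "eligible i b" for i b
  proof -
    have ib: "i < N" "b < m" "k b \<le> N" using that by (auto simp: eligible_def)
    have "i * m + b < Suc i * m" using ib by simp
    also have "\<dots> \<le> N * m" using ib by (intro mult_le_mono1) simp
    finally have "i * m + b < N * m" .
    moreover have "(i * m + b) div m = i" "(i * m + b) mod m = b" using ib by auto
    ultimately show ?thesis using 7(2) ib(3) by metis
  qed
  then show ?case using 7(1) by (intro Q) (auto simp: agree_off_def)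
qed (use s counts X_bounds in \<open>auto simp: numerator_def denominator_def column_def fit_test_def resolution_exp_def\<close>)

lemma wp_sap_program:
  "wp X sap_program (\<lambda>s'. \<exists>x y P S. max_ratio x y \<and>
     (\<forall>i b. eligible i b \<longrightarrow> P i b = rounded x y i b) \<and>
     S \<subseteq> {..<m} \<and> sum k S \<le> N \<and> exact_fill N m k S (s' WHO) \<and>
     (\<forall>U\<subseteq>{..<m}. sum k U \<le> N \<longrightarrow>
        (1 - exp (-1) + 1 / (100 * (real N + 1))) * fill_value N P k U \<le> real (gain N P (s' WHO)))) s0"
  (is "wp X sap_program ?Q s0")
  unfolding sap_program_def
proof (rule wp_If)
  show "wp X (Seq read_sizes (Seq find_max_profit (Seq round_profits optimise))) ?Q s0"
  proof (rule wp_Seq, rule wp_read_sizes)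
    fix s1 assume s1: "agree_off {PTR, SEM, SIZE} s0 s1" "s1 SIZE = k"
    show "wp X (Seq find_max_profit (Seq round_profits optimise)) ?Q s1"
    proof (rule wp_Seq, rule wp_find_max_profit)
      show "s1 0 = s0 0" using s1 by (simp add: agree_off_def)
      fix s2 assume s2: "agree_off {MAX_NUM, MAX_DEN, PAIR} s1 s2" "max_ratio (s2 MAX_NUM 0) (s2 MAX_DEN 0)"
      show "wp X (Seq round_profits optimise) ?Q s2"
      proof (rule wp_Seq, rule wp_round_profits[where s = s2])
        show "s2 0 = s0 0" "s2 SIZE = k" "max_ratio (s2 MAX_NUM 0) (s2 MAX_DEN 0)"
          using s1 s2 by (simp_all add: agree_off_def)
        fix s3 assume s3: "agree_off {PAIR, PROFIT} s2 s3"
          "\<And>i b. eligible i b \<Longrightarrow> s3 PROFIT (i * m + b) = rounded (s2 MAX_NUM 0) (s2 MAX_DEN 0) i b"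
        let ?P = "\<lambda>i b. s3 PROFIT (i * m + b)"
        \<comment> \<open>The rounded profits exist only from this store on, so the greedy argument
          is instantiated inside the program proof.\<close>
        interpret greedy_program N m ?P k p X
        proof
          fix i b assume "i < N" "b < m" "k b \<le> N"
          then have el: "eligible i b" by (simp add: eligible_def)
          show "?P i b \<le> p" "Suc N dvd ?P i b"
            unfolding s3(2)[OF el] by (rule rounded_le[OF s2(2) el], rule Suc_dvd_rounded)
        qed (use k_pos X_bounds in \<open>auto simp: k_def\<close>)
        have eq: "s3 0 = s0 0" "s3 SIZE = k" "s3 BEST_OPEN = s0 BEST_OPEN" "s3 BEST_VALUE = s0 BEST_VALUE"
          using s1 s2 s3(1) by (simp_all add: agree_off_def)
        then have "ready s3" using counts by (simp add: ready_def)
        moreover have "s3 BEST_OPEN b = 0" "s3 BEST_VALUE 0 = 0" for b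
          unfolding eq by (rule other; simp)+
        ultimately show "wp X optimise ?Q s3"
        proof (intro wp_conseq[OF wp_optimise])
          fix s' assume "\<exists>S\<subseteq>{..<m}. sum k S \<le> N \<and> exact_fill N m k S (s' WHO) \<and>
            (\<forall>U\<subseteq>{..<m}. sum k U \<le> N \<longrightarrow>
              (1 - exp (-1) + 1 / (100 * (real N + 1))) * fill_value N ?P k U \<le> real (gain N ?P (s' WHO)))"
          then obtain S where S: "S \<subseteq> {..<m}" "sum k S \<le> N" "exact_fill N m k S (s' WHO)"
            "\<forall>U\<subseteq>{..<m}. sum k U \<le> N \<longrightarrow>
              (1 - exp (-1) + 1 / (100 * (real N + 1))) * fill_value N ?P k U \<le> real (gain N ?P (s' WHO))"
            by (elim exE conjE)
          show "?Q s'"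
            by (rule exI[of _ "s2 MAX_NUM 0"], rule exI[of _ "s2 MAX_DEN 0"], rule exI[of _ ?P], rule exI[of _ S])
              (intro conjI allI impI s2(2) s3(2) S)
        qed
      qed
    qed (use s1 in simp)
  qed (use other in auto)
qed (use counts m_pos in simp)

end

section \<open>Correctness of the program\<close>

context encoded_input
begin

definition fill_profit :: "(nat \<Rightarrow> nat) \<Rightarrow> real" where
  "fill_profit w = (\<Sum>i<N. if w i = 0 then 0 else real (num i (w i - 1)) / real (den i (w i - 1)))"

lemma fill_eligible:
  assumes fill: "exact_fill N m k S w" "S \<subseteq> {..<m}" "sum k S \<le> N" and i: "i < N" "w i \<noteq> 0"
  shows "eligible i (w i - 1)"
proof -
  obtain b where b: "w i = Suc b" using i(2) not0_implies_Suc by blast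
  then have "b < m" using fill(1) i by (auto simp: exact_fill_def Suc_le_eq)
  moreover have "attendance N w b \<noteq> 0" using b i by (auto simp: attendance_def)
  ultimately have "b \<in> S" using fill(1) by (auto simp: exact_fill_def split: if_splits)
  then have "k b \<le> sum k S" using fill(2) finite_subset by (intro member_le_sum) auto
  then show ?thesis using b i \<open>b < m\<close> fill(3) by (simp add: eligible_def)
qed

text \<open>For all prices, the utility of one place of \<open>b\<close> and the price of student
  \<open>i\<close> already cover \<open>P i b\<close>, and \<open>k b\<close> is at least 1. Arguing
  in the dual avoids exhibiting a fill of \<open>{b}\<close>.\<close>

lemma profit_le_fill_value:
  assumes "i < N" "b < m"
  shows "real (P i b) \<le> fill_value N P k {b}"
proof (rule le_fill_value)
  fix \<pi> :: "nat \<Rightarrow> real" assume \<pi>: "\<And>i. 0 \<le> \<pi> i"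
  have "real (P i b) \<le> 1 * utility N P \<pi> b + \<pi> i"
    using utility_ge[OF assms(1), of P b \<pi>] by simp
  also have "\<dots> \<le> real (k b) * utility N P \<pi> b + (\<Sum>i<N. \<pi> i)"
    using k_pos[OF assms(2)] assms(1) \<pi>
    by (intro add_mono mult_right_mono utility_nonneg member_le_sum) (auto simp: Suc_leI)
  finally show "real (P i b) \<le> dual_value N P k {b} \<pi>" by (simp add: dual_value_def)
qed

text \<open>\<open>\<sigma>\<close> is the scale from true to rounded profits. Rounding down loses
  less than one unit of the quotient, hence at most \<open>N + 1\<close> after the
  multiplication.\<close>

lemma rounding_error:
  assumes max: "max_ratio x y" "x \<noteq> 0" and el: "eligible i b"
  defines "\<sigma> \<equiv> (real N + 1) * real (resolution N) * real y / real x"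
  shows "real (rounded x y i b) \<le> \<sigma> * (real (num i b) / real (den i b))"
    "\<sigma> * (real (num i b) / real (den i b)) - (real N + 1) \<le> real (rounded x y i b)"
proof -
  let ?a = "num i b * y * resolution N" and ?b = "den i b * x"
  have den: "0 < den i b" using el den_pos by (simp add: eligible_def)
  then have b': "0 < ?b" using max(2) by simp
  then have b: "0 < real ?b" by (simp only: of_nat_0_less_iff)
  have eq: "\<sigma> * (real (num i b) / real (den i b)) = (real N + 1) * (real ?a / real ?b)"
    by (simp add: \<sigma>_def field_simps)
  have P: "real (rounded x y i b) = (real N + 1) * real (?a div ?b)"
    by (simp add: rounded_def)
  have "real (?a div ?b) \<le> real ?a / real ?b" by (rule of_nat_div_le_of_nat)
  then show "real (rounded x y i b) \<le> \<sigma> * (real (num i b) / real (den i b))"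
    unfolding eq P by (intro mult_left_mono) auto
  have "?a \<le> Suc (?a div ?b) * ?b"
    using dividend_less_div_times[OF b', of ?a] by simp
  then have "real ?a \<le> (real (?a div ?b) + 1) * real ?b"
    by (metis of_nat_Suc of_nat_le_iff of_nat_mult add.commute)
  then have "real ?a / real ?b \<le> real (?a div ?b) + 1"
    using b by (simp only: pos_divide_le_eq)
  then have "(real N + 1) * (real ?a / real ?b) \<le> (real N + 1) * (real (?a div ?b) + 1)"
    by (intro mult_left_mono) auto
  then show "\<sigma> * (real (num i b) / real (den i b)) - (real N + 1) \<le> real (rounded x y i b)"
    unfolding eq P distrib_left by (simp only: mult_1_right diff_le_eq)
qed

text \<open>The value found is at least a constant fraction of the largest eligible profit, so the
  rounding errors cost a factor of only \<open>1 + N / resolution N\<close>.\<close>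

lemma rounded_ratio:
  assumes max: "max_ratio x y" and P: "\<And>i b. eligible i b \<Longrightarrow> P i b = rounded x y i b"
    and w: "exact_fill N m k S w" "S \<subseteq> {..<m}" "sum k S \<le> N"
    and good: "\<And>U. U \<subseteq> {..<m} \<Longrightarrow> sum k U \<le> N \<Longrightarrow>
      (1 - exp (-1) + 1 / (100 * (real N + 1))) * fill_value N P k U \<le> real (gain N P w)"
    and v: "exact_fill N m k U v" "U \<subseteq> {..<m}" "sum k U \<le> N"
  shows "(1 - exp (-1)) * fill_profit v \<le> fill_profit w"
proof (cases "x = 0")
  case True
  have zero: "num i b = 0" if "eligible i b" for i b
  proof -
    have "num i b * y \<le> 0" "0 < y" using max that True by (auto simp: max_ratio_def)
    then show ?thesis by simp
  qed
  have "fill_profit v = 0"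
    unfolding fill_profit_def using fill_eligible[OF v] zero by (intro sum.neutral) auto
  moreover have "0 \<le> fill_profit w" unfolding fill_profit_def by (intro sum_nonneg) auto
  ultimately show ?thesis by simp
next
  case False
  define C where "C = 1 - exp (-1) + 1 / (100 * (real N + 1))"
  define T where "T = real (resolution N)"
  define \<sigma> where "\<sigma> = (real N + 1) * real (resolution N) * real y / real x"
  define G where "G = real (gain N P w)"
  have T: "T = 100 * ((real N + 1) * (real N + 1))" by (simp add: T_def resolution_def)
  have T_pos: "0 < T" unfolding T by (intro mult_pos_pos) auto
  have y: "0 < y" using max by (simp add: max_ratio_def)
  have \<sigma>_pos: "0 < \<sigma>" unfolding \<sigma>_def using T_pos y False by (simp add: T_def)
  have e: "exp (-1) \<le> (1 :: real)" by simp
  have C: "0 \<le> C" unfolding C_def using e by (intro add_nonneg_nonneg) auto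
  note err = rounding_error[OF max False, folded \<sigma>_def]
  have up: "G \<le> \<sigma> * fill_profit w"
    unfolding G_def gain_def fill_profit_def sum_distrib_left of_nat_sum
  proof (intro sum_mono)
    fix i assume "i \<in> {..<N}"
    then show "real (if w i = 0 then 0 else P i (w i - 1)) \<le>
        \<sigma> * (if w i = 0 then 0 else real (num i (w i - 1)) / real (den i (w i - 1)))"
      using err(1)[OF fill_eligible[OF w]] P[OF fill_eligible[OF w]] by auto
  qed
  \<comment> \<open>Each of the \<open>N\<close> students loses at most \<open>N + 1\<close> by
    rounding.\<close>
  have "\<sigma> * fill_profit v - (real N + 1) * real N =
      (\<Sum>i<N. \<sigma> * (if v i = 0 then 0 else real (num i (v i - 1)) / real (den i (v i - 1))) - (real N + 1))"
    unfolding fill_profit_def sum_distrib_left sum_subtractf by simp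
  also have "\<dots> \<le> (\<Sum>i<N. real (if v i = 0 then 0 else P i (v i - 1)))"
  proof (intro sum_mono)
    fix i assume "i \<in> {..<N}"
    then show "\<sigma> * (if v i = 0 then 0 else real (num i (v i - 1)) / real (den i (v i - 1))) - (real N + 1)
        \<le> real (if v i = 0 then 0 else P i (v i - 1))"
      using err(2)[OF fill_eligible[OF v]] P[OF fill_eligible[OF v]] by auto
  qed
  also have "\<dots> = real (gain N P v)" by (simp add: gain_def)
  also have "\<dots> \<le> fill_value N P k U" by (rule gain_le_fill_value[OF v(1,2)])
  finally have "C * (\<sigma> * fill_profit v - (real N + 1) * real N) \<le> C * fill_value N P k U"
    using C by (rule mult_left_mono)
  also have "\<dots> \<le> G" unfolding G_def C_def by (rule good[OF v(2,3)])
  finally have low: "C * (\<sigma> * fill_profit v) - C * ((real N + 1) * real N) \<le> G"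
    by (simp only: right_diff_distrib)
  obtain i b where ib: "eligible i b" "x = num i b" "y = den i b"
    using max False by (auto simp: max_ratio_def)
  have "0 < x * y" using False y by simp
  \<comment> \<open>The pair of largest profit has ratio 1 to the maximum, so it is rounded without
    loss.\<close>
  then have "P i b = (N + 1) * resolution N"
    unfolding P[OF ib(1)] rounded_def ib(2,3)[symmetric]
    by (simp add: mult.commute[of y x] del: add_mult_distrib)
  then have "(real N + 1) * T = real (P i b)" by (simp add: T_def)
  also have "\<dots> \<le> fill_value N P k {b}"
    using ib(1) by (intro profit_le_fill_value) (auto simp: eligible_def)
  finally have "C * ((real N + 1) * T) \<le> C * fill_value N P k {b}"
    using C by (rule mult_left_mono)
  also have "\<dots> \<le> G"
    unfolding G_def C_def using ib(1) by (intro good) (auto simp: eligible_def)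
  \<comment> \<open>Multiplication by \<open>N / T\<close> turns the lower bound on \<open>G\<close>
    into a bound on the rounding loss in terms of \<open>G\<close>.\<close>
  finally have "C * ((real N + 1) * T) * (real N / T) \<le> G * (real N / T)"
    using T_pos by (intro mult_right_mono) auto
  then have "C * ((real N + 1) * real N) \<le> G * (real N / T)" using T_pos by simp
  with low have "C * (\<sigma> * fill_profit v) \<le> G * (1 + real N / T)"
    by (simp only: distrib_left mult_1_right)
  moreover have "(1 - exp (-1)) * (1 + real N / T) * (\<sigma> * fill_profit v) \<le> C * (\<sigma> * fill_profit v)"
  proof (rule mult_right_mono)
    \<comment> \<open>Here the surplus \<open>1 / (100 * (N + 1))\<close> contained in
      \<open>C\<close> is spent.\<close>
    show "(1 - exp (-1)) * (1 + real N / T) \<le> C"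
    proof -
      have "real N / T \<le> (real N + 1) / T" using T_pos by (intro divide_right_mono) auto
      also have "\<dots> = 1 / (100 * (real N + 1))" unfolding T by (simp add: divide_eq_eq)
      finally have "real N / T \<le> 1 / (100 * (real N + 1))" .
      moreover have "(1 - exp (-1)) * (real N / T) \<le> 1 * (real N / T)"
        using T_pos by (intro mult_right_mono) auto
      ultimately have "(1 - exp (-1)) * (real N / T) \<le> 1 / (100 * (real N + 1))" by linarith
      then show ?thesis unfolding C_def distrib_left by simp
    qed
    have "0 \<le> fill_profit v" unfolding fill_profit_def by (intro sum_nonneg) auto
    then show "0 \<le> \<sigma> * fill_profit v" using \<sigma>_pos by simp
  qed
  ultimately have "(1 - exp (-1)) * (1 + real N / T) * (\<sigma> * fill_profit v) \<le> G * (1 + real N / T)"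
    by linarith
  then have "((1 - exp (-1)) * (\<sigma> * fill_profit v)) * (1 + real N / T) \<le> G * (1 + real N / T)"
    by (simp only: mult_ac)
  moreover have "0 < 1 + real N / T" using T_pos by (simp add: add_pos_nonneg)
  ultimately have "(1 - exp (-1)) * (\<sigma> * fill_profit v) \<le> G"
    by (simp only: mult_le_cancel_right_pos)
  with up have "\<sigma> * ((1 - exp (-1)) * fill_profit v) \<le> \<sigma> * fill_profit w"
    by (simp only: mult_ac)
  then show ?thesis using \<sigma>_pos by simp
qed

end

section \<open>Positions in the encoded input\<close>

lemma length_concat_uniform:
  "(\<And>ys. ys \<in> set xss \<Longrightarrow> length ys = c) \<Longrightarrow> length (concat xss) = length xss * c"
  by (induction xss) auto

lemma nth_concat_uniform:
  assumes "\<And>ys. ys \<in> set xss \<Longrightarrow> length ys = c" "i < length xss" "j < c"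
  shows "concat xss ! (i * c + j) = xss ! i ! j"
  using assms
proof (induction xss arbitrary: i)
  case (Cons xs xss)
  then show ?case by (cases i) (auto simp: nth_append add.assoc)
qed simp

lemma nth_concat_map:
  assumes "b < length bs" "j < length (f (bs ! b))"
  shows "concat (map f bs) ! (length (concat (map f (take b bs))) + j) = f (bs ! b) ! j"
proof -
  have "concat (map f bs) = concat (map f (take b bs)) @ f (bs ! b) @ concat (map f (drop (Suc b) bs))"
    using id_take_nth_drop[OF assms(1)] by (metis concat.simps(2) concat_append list.simps(9) map_append)
  then show ?thesis using assms(2) by (simp add: nth_append)
qed

lemma length_encode_rat [simp]: "length (encode_rat r) = 2"
  by (simp add: encode_rat_def split: prod.split)

lemma encode_rat:
  assumes "0 \<le> r"
  shows "0 < encode_rat r ! 1" "real_of_rat r = real (encode_rat r ! 0) / real (encode_rat r ! 1)"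
proof -
  obtain n d where q: "quotient_of r = (n, d)" by force
  have d: "0 < d" using quotient_of_denom_pos[OF q] .
  have r: "r = of_int n / of_int d" using quotient_of_div[OF q] .
  then have n: "0 \<le> n" using assms d by (simp add: zero_le_divide_iff)
  show "0 < encode_rat r ! 1" using d q by (simp add: encode_rat_def)
  show "real_of_rat r = real (encode_rat r ! 0) / real (encode_rat r ! 1)"
    using n d unfolding r by (simp add: encode_rat_def q[unfolded r] of_rat_divide)
qed

lemma length_encode_set: "length (encode_set K) = card K + 1"
  by (simp add: encode_set_def)

text \<open>Position 0 holds the cardinality, so the two sorted elements are at positions 1 and
  2.\<close>

lemma encode_set_Max:
  assumes "card K = 2"
  shows "encode_set K ! 2 = Max K"
proof -
  have fin: "finite K" using assms card.infinite by force
  let ?xs = "sorted_list_of_set K"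
  have len: "length ?xs = 2" using assms by simp
  then obtain x y where xs: "?xs = [x, y]"
    by (metis (no_types, lifting) One_nat_def Suc_length_conv length_0_conv numeral_2_eq_2)
  have "K = {x, y}" using fin xs by (metis set_sorted_list_of_set list.set(1,2))
  moreover have "x \<le> y" using sorted_sorted_list_of_set[of K] xs by simp
  ultimately show ?thesis unfolding encode_set_def xs by (simp add: numeral_2_eq_2)
qed

text \<open>Every entry has bit length at least 1, even if it is 0. Through the length of the list
  this bounds the numbers of students and seminars.\<close>

lemma length_le_input_size: "length xs \<le> input_size xs"
  unfolding input_size_def
proof (induction xs)
  case (Cons x xs)
  then show ?case using bit_length_pos[of x] by simp
qed simp

lemma bounded_initial_store:
  assumes "input_size xs \<le> X"
  shows "bounded_store X (initial_store xs)"
  unfolding bounded_store_def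
proof (intro allI)
  fix a j
  have "x < 2 ^ X" if "x \<in> set xs" for x
  proof -
    have "bit_length x \<le> input_size xs"
      unfolding input_size_def using that by (intro member_le_sum_list) auto
    then have "(2::nat) ^ bit_length x \<le> 2 ^ X" using assms by (intro power_increasing) auto
    then show ?thesis using less_power_bit_length[of x] by linarith
  qed
  then show "initial_store xs a j < 2 ^ X" by (auto simp: initial_store_def)
qed

section \<open>Assignments and their output arrays\<close>

lemma outputs_cell:
  assumes "outputs_assignment js bs s A" "j < length js"
  shows "A (js ! j) = None \<and> s 1 j = 0 \<or>
    (\<exists>b<length bs. A (js ! j) = Some (bs ! b) \<and> s 1 j = Suc b)"
proof -
  have "case A (js ! j) of None \<Rightarrow> s 1 j = 0
      | Some b \<Rightarrow> \<exists>k<length bs. bs ! k = b \<and> s 1 j = Suc k"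
    using assms unfolding outputs_assignment_def by blast
  then show ?thesis by (auto split: option.splits)
qed

lemma outputs_attendance:
  assumes out: "outputs_assignment js bs s A" and dist: "distinct js" "distinct bs"
    and b: "b < length bs"
  shows "card {i. A i = Some (bs ! b)} = attendance (length js) (s 1) b"
proof -
  have iff: "A (js ! j) = Some (bs ! b) \<longleftrightarrow> s 1 j = Suc b" if "j < length js" for j
    using outputs_cell[OF out that] nth_eq_iff_index_eq[OF dist(2) b] by auto
  have "{i. A i = Some (bs ! b)} = (!) js ` {j\<in>{..<length js}. s 1 j = Suc b}"
  proof (intro equalityI subsetI)
    fix x assume x: "x \<in> {i. A i = Some (bs ! b)}"
    then have "x \<in> set js" using out by (auto simp: outputs_assignment_def)
    then obtain j where "j < length js" "x = js ! j" by (metis in_set_conv_nth)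
    then show "x \<in> (!) js ` {j\<in>{..<length js}. s 1 j = Suc b}" using x iff by auto
  qed (use iff in auto)
  moreover have "inj_on ((!) js) {j\<in>{..<length js}. s 1 j = Suc b}"
    using dist(1) by (intro inj_on_nth) auto
  ultimately show ?thesis by (simp add: card_image attendance_def)
qed

lemma outputs_profit:
  assumes out: "outputs_assignment js bs s A" and dist: "distinct js"
  shows "assignment_profit S A =
    (\<Sum>j<length js. if s 1 j = 0 then 0 else profit S (js ! j) (bs ! (s 1 j - 1)))"
proof -
  let ?g = "\<lambda>i. case A i of None \<Rightarrow> 0 | Some b \<Rightarrow> profit S i b"
  have "assignment_profit S A = (\<Sum>i\<in>dom A. ?g i)"
    unfolding assignment_profit_def by (intro sum.cong) auto
  also have "\<dots> = (\<Sum>i\<in>set js. ?g i)"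
    using out by (intro sum.mono_neutral_left) (auto simp: outputs_assignment_def split: option.split)
  also have "\<dots> = (\<Sum>j<length js. ?g (js ! j))"
    using sum.reindex_bij_betw[OF bij_betw_nth[OF dist refl refl], of ?g] by simp
  also have "\<dots> = (\<Sum>j<length js. if s 1 j = 0 then 0 else profit S (js ! j) (bs ! (s 1 j - 1)))"
  proof (intro sum.cong refl)
    fix j assume "j \<in> {..<length js}"
    then have "j < length js" by simp
    from outputs_cell[OF out this]
    show "?g (js ! j) = (if s 1 j = 0 then 0 else profit S (js ! j) (bs ! (s 1 j - 1)))"
      by auto
  qed
  finally show ?thesis .
qed

lemma outputs_le:
  assumes "outputs_assignment js bs s A" "j < length js"
  shows "s 1 j \<le> length bs"
  using outputs_cell[OF assms] by auto

lemma the_inv_into_nth: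
  assumes "distinct xs" "j < length xs"
  shows "the_inv_into {..<length xs} ((!) xs) (xs ! j) = j"
  using assms by (intro the_inv_into_f_f inj_on_nth) auto

lemma outputs_exists:
  assumes "distinct js" "\<And>j. j < length js \<Longrightarrow> s 1 j \<le> length bs"
  obtains A where "outputs_assignment js bs s A" "dom A \<subseteq> set js" "ran A \<subseteq> set bs"
proof
  let ?pos = "the_inv_into {..<length js} ((!) js)"
  let ?A = "\<lambda>x. if x \<in> set js \<and> s 1 (?pos x) \<noteq> 0 then Some (bs ! (s 1 (?pos x) - 1)) else None"
  have pos: "?pos (js ! j) = j" if "j < length js" for j
    using the_inv_into_nth[OF assms(1) that] .
  have less: "s 1 j - 1 < length bs" if "j < length js" "s 1 j \<noteq> 0" for j
    using assms(2)[OF that(1)] that(2) by simp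
  show "dom ?A \<subseteq> set js" by (auto split: if_splits)
  show "ran ?A \<subseteq> set bs"
  proof
    fix b assume "b \<in> ran ?A"
    then obtain x where x: "x \<in> set js" "s 1 (?pos x) \<noteq> 0" "b = bs ! (s 1 (?pos x) - 1)"
      by (auto simp: ran_def split: if_splits)
    from x(1) obtain j where "j < length js" "x = js ! j" by (metis in_set_conv_nth)
    then show "b \<in> set bs" using x pos less by simp
  qed
  show "outputs_assignment js bs s ?A"
    unfolding outputs_assignment_def using pos less \<open>dom ?A \<subseteq> set js\<close>
    by (auto intro!: exI[of _ "s 1 _ - 1"])
qed

text \<open>Lets an optimal assignment be treated as a fill too. The store is made up for this
  purpose and belongs to no run.\<close>

lemma outputs_represent:
  assumes "distinct bs" "dom A \<subseteq> set js" "ran A \<subseteq> set bs"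
  obtains s where "outputs_assignment js bs s A"
proof
  let ?pos = "the_inv_into {..<length bs} ((!) bs)"
  let ?s = "\<lambda>(a :: nat) j. case A (js ! j) of None \<Rightarrow> 0 | Some b \<Rightarrow> Suc (?pos b)"
  have "\<exists>k<length bs. bs ! k = b \<and> ?s 1 j = Suc k" if "A (js ! j) = Some b" for j b
  proof -
    have "b \<in> set bs" using that assms(3) by (auto simp: ran_def)
    then obtain k where "k < length bs" "b = bs ! k" by (metis in_set_conv_nth)
    then show ?thesis using that the_inv_into_nth[OF assms(1)] by auto
  qed
  then show "outputs_assignment js bs ?s A"
    using assms(2) by (auto simp: outputs_assignment_def split: option.split)
qed

lemma max_profit_attained:
  assumes "sap_instance S"
  obtains A where "feasible S A" "assignment_profit S A = max_profit S"
proof -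
  have "max_profit S \<in> assignment_profit S ` {A. feasible S A}"
    unfolding max_profit_def using finite_feasible[OF assms] feasible_empty[OF assms]
    by (intro Max_in) auto
  then show ?thesis using that by auto
qed

text \<open>\<open>2 * z + 1\<close> bounds the numbers of students and seminars plus 1; the summand
  \<open>z\<close> covers the bits of the input cells and the pointers into the input.\<close>

definition size_bound :: "nat \<Rightarrow> nat" where
  "size_bound z = 200 * (2 * z + 1) ^ 4 + z"

lemma is_poly_size_bound: "is_poly size_bound"
  unfolding size_bound_def[abs_def] by (intro is_poly_add is_poly_mult is_poly_power is_poly_const is_poly_id)

section \<open>The encoded instance as input of the program\<close>

locale sap_encoding =
  fixes S :: "('i, 'b) sap" and js bs
  assumes inst: "sap_instance S"
    and two: "\<And>b. b \<in> seminars S \<Longrightarrow> finite (allowed S b) \<and> card (allowed S b) \<le> 2"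
    and js: "distinct js" "set js = students S" and bs: "distinct bs" "set bs = seminars S"
    and nonempty: "bs \<noteq> []"
begin

abbreviation "input \<equiv> encode_sap js bs S"

definition blocks :: "nat \<Rightarrow> nat" where
  "blocks b = length (concat (map (\<lambda>b. encode_set (allowed S b)) (take b bs)))"

definition pr :: "nat \<Rightarrow> nat \<Rightarrow> nat list" where
  "pr i b = encode_rat (profit S (js ! i) (bs ! b))"

abbreviation "matrix \<equiv> concat (map (\<lambda>i. concat (map (\<lambda>b. encode_rat (profit S i b)) bs)) js)"

lemma length_row: "length (concat (map (\<lambda>b. encode_rat (profit S i b)) bs)) = length bs * 2"
proof -
  have "length (concat (map (\<lambda>b. encode_rat (profit S i b)) bs)) =
      length (map (\<lambda>b. encode_rat (profit S i b)) bs) * 2"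
    by (rule length_concat_uniform) auto
  then show ?thesis by (simp only: length_map)
qed

lemma length_matrix: "length matrix = length js * (length bs * 2)"
proof -
  have "length matrix =
      length (map (\<lambda>i. concat (map (\<lambda>b. encode_rat (profit S i b)) bs)) js) * (length bs * 2)"
    by (rule length_concat_uniform) (use length_row in auto)
  then show ?thesis by (simp only: length_map)
qed

lemma nth_matrix:
  assumes "i < length js" "b < length bs" "c < 2"
  shows "input ! (2 + (i * (length bs * 2) + (b * 2 + c))) = pr i b ! c"
proof -
  have lt: "b * 2 + c < length bs * 2" using assms by linarith
  have "i * (length bs * 2) + (b * 2 + c) < Suc i * (length bs * 2)" using lt by simp
  also have "\<dots> \<le> length js * (length bs * 2)" using assms(1) by (intro mult_le_mono1) simp
  finally have "input ! (2 + (i * (length bs * 2) + (b * 2 + c))) =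
      matrix ! (i * (length bs * 2) + (b * 2 + c))"
    by (simp add: encode_sap_def nth_append length_matrix)
  also have "\<dots> = map (\<lambda>i. concat (map (\<lambda>b. encode_rat (profit S i b)) bs)) js ! i ! (b * 2 + c)"
    by (rule nth_concat_uniform) (use length_row assms(1) lt in auto)
  also have "\<dots> = concat (map (\<lambda>b. encode_rat (profit S (js ! i) b)) bs) ! (b * 2 + c)"
    using assms(1) by simp
  also have "\<dots> = map (\<lambda>b. encode_rat (profit S (js ! i) b)) bs ! b ! c"
    by (rule nth_concat_uniform) (use assms in auto)
  also have "\<dots> = pr i b ! c" using assms by (simp add: pr_def)
  finally show ?thesis .
qed

definition ptr :: "nat \<Rightarrow> nat" where
  "ptr b = 2 + 2 * (length js * length bs) + blocks b"

lemma blocks_Suc: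
  "b < length bs \<Longrightarrow> blocks (Suc b) = blocks b + card (allowed S (bs ! b)) + 1"
  by (simp add: blocks_def take_Suc_conv_app_nth length_encode_set)

lemma blocks_ge: "b \<le> length bs \<Longrightarrow> b \<le> blocks b"
proof (induction b)
  case (Suc b)
  then show ?case using blocks_Suc[of b] by simp
qed simp

lemma length_input: "length input = ptr (length bs)"
  by (simp add: encode_sap_def ptr_def blocks_def length_matrix)

lemma blocks_mono: "b \<le> length bs \<Longrightarrow> blocks b \<le> blocks (length bs)"
proof -
  have "concat (map f bs) = concat (map f (take b bs)) @ concat (map f (drop b bs))" for f :: "'b \<Rightarrow> nat list"
    by (metis append_take_drop_id concat_append map_append)
  then have "length (concat (map f (take b bs))) \<le> length (concat (map f bs))" for f :: "'b \<Rightarrow> nat list"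
    by (metis length_append le_add1)
  then show ?thesis unfolding blocks_def by simp
qed

lemma nth_blocks:
  assumes "b < length bs" "j < card (allowed S (bs ! b)) + 1"
  shows "input ! (ptr b + j) = encode_set (allowed S (bs ! b)) ! j"
  using nth_concat_map[OF assms(1), of j "\<lambda>b. encode_set (allowed S b)"] assms(2)
  by (simp add: encode_sap_def ptr_def blocks_def length_matrix nth_append length_encode_set mult_ac)

lemma ptr_less:
  assumes "b < length bs" "j < card (allowed S (bs ! b)) + 1"
  shows "ptr b + j < length input"
  using assms blocks_mono[of "Suc b"] blocks_Suc[of b] by (simp add: length_input ptr_def)

definition X :: nat where
  "X = size_bound (input_size input)"

lemma X_ge: "input_size input \<le> X"
  by (simp add: X_def size_bound_def)

sublocale encoded_input "length js" "length bs" "\<lambda>i b. pr i b ! 0" "\<lambda>i b. pr i b ! 1"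
  "\<lambda>b. allowed S (bs ! b)" ptr "initial_store input" X
proof
  have len: "ptr (length bs) \<le> input_size input"
    using length_le_input_size[of input] by (simp add: length_input)
  have two': "2 < length input" using nonempty blocks_ge[of "length bs"]
    by (simp add: length_input ptr_def) (metis add_gr_0 gr0I length_0_conv less_le_trans le_zero_eq)
  show "initial_store input 0 0 = length js" "initial_store input 0 1 = length bs"
    using two' by (auto simp: initial_store_def encode_sap_def)
  fix i b
  assume i: "i < length js" and b: "b < length bs"
  have lt: "i * length bs + b < length js * length bs"
  proof -
    have "i * length bs + b < Suc i * length bs" using b by simp
    also have "\<dots> \<le> length js * length bs" using i by (intro mult_le_mono1) simp
    finally show ?thesis .
  qed
  have idx: "2 + 2 * (i * length bs + b) = 2 + (i * (length bs * 2) + (b * 2 + 0))"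
    "3 + 2 * (i * length bs + b) = 2 + (i * (length bs * 2) + (b * 2 + 1))" by simp_all
  show "initial_store input 0 (2 + 2 * (i * length bs + b)) = pr i b ! 0"
    using nth_matrix[OF i b, of 0] lt unfolding idx(1)[symmetric]
    by (simp add: initial_store_def length_input ptr_def)
  show "initial_store input 0 (3 + 2 * (i * length bs + b)) = pr i b ! 1"
    using nth_matrix[OF i b, of 1] lt unfolding idx(2)[symmetric]
    by (simp add: initial_store_def length_input ptr_def)
  have "0 \<le> profit S (js ! i) (bs ! b)"
    using inst js bs i b nth_mem by (fastforce simp: sap_instance_def)
  then show "0 < pr i b ! 1" unfolding pr_def by (rule encode_rat(1))
next
  fix b assume b: "b < length bs"
  then have mem: "bs ! b \<in> seminars S" using bs(2) nth_mem[OF b] by simp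
  show "ptr (Suc b) = ptr b + card (allowed S (bs ! b)) + 1"
    using blocks_Suc[OF b] by (simp add: ptr_def)
  show "initial_store input 0 (ptr b) = card (allowed S (bs ! b))"
    using nth_blocks[OF b, of 0] ptr_less[OF b, of 0] by (simp add: initial_store_def encode_set_def)
  show "0 \<in> allowed S (bs ! b)" using inst mem by (simp add: sap_instance_def)
  show "finite (allowed S (bs ! b))" "card (allowed S (bs ! b)) \<le> 2" using two[OF mem] by auto
  show "initial_store input 0 (ptr b + 2) = Max (allowed S (bs ! b))"
    if "card (allowed S (bs ! b)) = 2"
    using nth_blocks[OF b, of 2] ptr_less[OF b, of 2] that encode_set_Max[OF that]
    by (simp add: initial_store_def)
next
  fix b assume "b \<le> length bs"
  then have "ptr b \<le> length input" using blocks_mono by (simp add: length_input ptr_def)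
  then show "ptr b \<le> X" using X_ge length_le_input_size[of input] by linarith
next
  have m: "length bs \<le> input_size input"
    using blocks_ge[of "length bs"] length_le_input_size[of input] by (simp add: length_input ptr_def)
  \<comment> \<open>There is at least one seminar, so the profit matrix has an entry for every
    student, and the input is at least as long as there are students.\<close>
  have "length js * 1 \<le> length js * length bs"
    using nonempty by (intro mult_le_mono2) (cases bs; simp)
  then have "length js \<le> input_size input"
    using length_le_input_size[of input] unfolding length_input ptr_def by linarith
  with m have "length js + length bs + 1 \<le> 2 * input_size input + 1" by simp
  then have "(length js + length bs + 1) ^ 4 \<le> (2 * input_size input + 1) ^ 4"
    by (intro power_mono) auto
  then show "200 * (length js + length bs + 1) ^ 4 \<le> X"
    unfolding X_def size_bound_def by linarith
qed (use nonempty in \<open>auto simp: ptr_def blocks_def initial_store_def\<close>)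

lemma real_profit_eq_fill_profit:
  assumes "outputs_assignment js bs s A"
  shows "real_of_rat (assignment_profit S A) = fill_profit (s 1)"
  unfolding outputs_profit[OF assms js(1)] fill_profit_def of_rat_sum
proof (intro sum.cong refl)
  fix i assume "i \<in> {..<length js}"
  then have i: "i < length js" by simp
  show "real_of_rat (if s 1 i = 0 then 0 else profit S (js ! i) (bs ! (s 1 i - 1))) =
    (if s 1 i = 0 then 0 else real (pr i (s 1 i - 1) ! 0) / real (pr i (s 1 i - 1) ! 1))"
  proof (cases "s 1 i = 0")
    case False
    then have "s 1 i - 1 < length bs" using outputs_le[OF assms i] by simp
    then have "0 \<le> profit S (js ! i) (bs ! (s 1 i - 1))"
      using inst js bs i nth_mem by (fastforce simp: sap_instance_def)
    then show ?thesis using encode_rat(2) False by (simp add: pr_def)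
  qed simp
qed

text \<open>The budget rules out the fictitious size \<open>N + 1\<close> for seminars in
  \<open>U\<close>, so their attendance is the positive allowable number; elsewhere it is 0, which
  is allowed as well.\<close>

lemma exact_fill_imp_feasible:
  assumes out: "outputs_assignment js bs s A" and A: "dom A \<subseteq> set js" "ran A \<subseteq> set bs"
    and fill: "exact_fill (length js) (length bs) k U (s 1)"
    and U: "U \<subseteq> {..<length bs}" "sum k U \<le> length js"
  shows "feasible S A"
  unfolding feasible_def
proof (intro conjI ballI)
  show "seminar_assignment S A" using A js bs by (simp add: seminar_assignment_def)
  fix b' assume "b' \<in> seminars S"
  then obtain b where b: "b < length bs" "b' = bs ! b" using bs by (metis in_set_conv_nth)
  have card: "card {i. A i = Some b'} = (if b \<in> U then k b else 0)"
    using outputs_attendance[OF out js(1) bs(1) b(1)] fill b by (simp add: exact_fill_def)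
  show "card {i. A i = Some b'} \<in> allowed S b'"
  proof (cases "b \<in> U")
    case True
    then have "k b \<le> sum k U" using U(1) finite_subset by (intro member_le_sum) auto
    then have "k b \<le> length js" using U(2) by simp
    then have "k b = Max (allowed S b')"
      using b by (auto simp: k_def split: if_splits)
    moreover have "Max (allowed S b') \<in> allowed S b'"
      unfolding b(2) using K(1,2)[OF b(1)] by (intro Max_in) auto
    ultimately show ?thesis using card True by simp
  next
    case False
    then have "card {i. A i = Some b'} = 0" using card by simp
    then show ?thesis unfolding b(2) using K(1)[OF b(1)] by simp
  qed
qed

text \<open>\<open>U\<close> is the set of attended seminars. A positive attendance must be the
  larger of the two allowable numbers, and it is at most the number of students, so it equals
  \<open>k\<close>.\<close>

lemma feasible_imp_exact_fill:
  assumes out: "outputs_assignment js bs s A" and feas: "feasible S A"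
  obtains U where "U \<subseteq> {..<length bs}" "sum k U \<le> length js"
    "exact_fill (length js) (length bs) k U (s 1)"
proof
  let ?att = "attendance (length js) (s 1)"
  let ?U = "{b. b < length bs \<and> ?att b \<noteq> 0}"
  have att_le: "?att b \<le> length js" for b
    using card_mono[of "{..<length js}" "{i\<in>{..<length js}. s 1 i = Suc b}"]
    by (auto simp: attendance_def)
  have att: "?att b = k b" if b: "b \<in> ?U" for b
  proof -
    have bm: "b < length bs" using b by simp
    have "card {i. A i = Some (bs ! b)} \<in> allowed S (bs ! b)"
      using feas bs(2) nth_mem[OF bm] unfolding feasible_def by blast
    then have mem: "?att b \<in> allowed S (bs ! b)"
      unfolding outputs_attendance[OF out js(1) bs(1) bm] .
    have "card (allowed S (bs ! b)) = 2 \<and> ?att b = Max (allowed S (bs ! b))"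
    proof (cases rule: K_cases[OF bm])
      case 1
      then show ?thesis using mem b by simp
    next
      case 2
      have "?att b \<in> {0, Max (allowed S (bs ! b))}" using mem 2(2) by (rule subst[rotated])
      then show ?thesis using 2(1) b by simp
    qed
    then show ?thesis using att_le[of b] bm by (simp add: k_def)
  qed
  show "?U \<subseteq> {..<length bs}" by auto
  show "exact_fill (length js) (length bs) k ?U (s 1)"
    unfolding exact_fill_def using outputs_le[OF out] att by auto
  have "sum k ?U = sum ?att ?U" using att by (intro sum.cong) auto
  also have "\<dots> \<le> sum ?att {..<length bs}" by (intro sum_mono2) auto
  also have "\<dots> = card {i\<in>{..<length js}. s 1 i \<noteq> 0}"
    using outputs_le[OF out] by (rule sum_attendance)
  also have "\<dots> \<le> length js"
    using card_mono[of "{..<length js}" "{i\<in>{..<length js}. s 1 i \<noteq> 0}"] by auto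
  finally show "sum k ?U \<le> length js" .
qed

text \<open>The output and an optimal assignment both become fills within the budget, where
  \<open>rounded_ratio\<close> compares their true profits.\<close>

lemma sap_program_approximates:
  "\<exists>t s A. run sap_program (initial_store input) t s \<and> t \<le> com_cost X sap_program \<and>
     outputs_assignment js bs s A \<and> feasible S A \<and>
     (1 - exp (-1)) * real_of_rat (max_profit S) \<le> real_of_rat (assignment_profit S A)"
proof -
  obtain t s x y P U where run: "run sap_program (initial_store input) t s"
    "t \<le> com_cost X sap_program" and max: "max_ratio x y"
    and P: "\<forall>i b. eligible i b \<longrightarrow> P i b = rounded x y i b"
    and U: "U \<subseteq> {..<length bs}" "sum k U \<le> length js"
    and fill: "exact_fill (length js) (length bs) k U (s 1)"
    and good: "\<forall>V\<subseteq>{..<length bs}. sum k V \<le> length js \<longrightarrow>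
        (1 - exp (-1) + 1 / (100 * (real (length js) + 1))) * fill_value (length js) P k V
          \<le> real (gain (length js) P (s 1))"
    using wp_sap_program[unfolded wp_def, rule_format, OF bounded_initial_store[OF X_ge]]
    by (elim exE conjE) (rule that; assumption)
  obtain A where A: "outputs_assignment js bs s A" "dom A \<subseteq> set js" "ran A \<subseteq> set bs"
    using outputs_exists[OF js(1), of s bs] fill by (auto simp: exact_fill_def)
  obtain A' where A': "feasible S A'" "assignment_profit S A' = max_profit S"
    using max_profit_attained[OF inst] .
  have "dom A' \<subseteq> set js" "ran A' \<subseteq> set bs"
    using A'(1) js bs by (auto simp: feasible_def seminar_assignment_def)
  then obtain s' where s': "outputs_assignment js bs s' A'"
    using outputs_represent[OF bs(1)] by blast
  obtain V where V: "V \<subseteq> {..<length bs}" "sum k V \<le> length js"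
    "exact_fill (length js) (length bs) k V (s' 1)"
    using feasible_imp_exact_fill[OF s' A'(1)] .
  have "(1 - exp (-1)) * fill_profit (s' 1) \<le> fill_profit (s 1)"
  proof (rule rounded_ratio[OF max _ fill U _ V(3,1,2)])
    show "P i b = rounded x y i b" if "eligible i b" for i b
      using P that by blast
    show "(1 - exp (-1) + 1 / (100 * (real (length js) + 1))) * fill_value (length js) P k W
        \<le> real (gain (length js) P (s 1))" if "W \<subseteq> {..<length bs}" "sum k W \<le> length js" for W
      using good that by blast
  qed
  then have "(1 - exp (-1)) * real_of_rat (max_profit S) \<le> real_of_rat (assignment_profit S A)"
    using real_profit_eq_fill_profit[OF A(1)] real_profit_eq_fill_profit[OF s'] A'(2) by simp
  then show ?thesis
    using run A(1) exact_fill_imp_feasible[OF A fill U] by blast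
qed

end

text \<open>The program halts at once, and array 1 of the initial store, all zero, already encodes
  the empty assignment, the only one there is.\<close>

lemma sap_program_no_seminars:
  assumes inst: "sap_instance S" and "enumerates [] (seminars S)"
  shows "\<exists>t s A. run sap_program (initial_store (encode_sap js [] S)) t s \<and>
     t \<le> com_cost (size_bound (input_size (encode_sap js [] S))) sap_program \<and>
     outputs_assignment js [] s A \<and> feasible S A \<and>
     (1 - exp (-1)) * real_of_rat (max_profit S) \<le> real_of_rat (assignment_profit S A)"
proof -
  let ?xs = "encode_sap js [] S" and ?s = "initial_store (encode_sap js [] S)"
  let ?X = "size_bound (input_size ?xs)"
  have "wp ?X sap_program (\<lambda>s. s = ?s) ?s"
    unfolding sap_program_def
    by (intro wp_If wp_Skip) (simp_all add: initial_store_def encode_sap_def)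
  moreover have "bounded_store ?X ?s"
    by (intro bounded_initial_store) (simp add: size_bound_def)
  ultimately have run: "\<exists>t. run sap_program ?s t ?s \<and> t \<le> com_cost ?X sap_program"
    unfolding wp_def by auto
  obtain A where A: "feasible S A" "assignment_profit S A = max_profit S"
    using max_profit_attained[OF inst] .
  have "ran A = {}"
    using A(1) assms(2) by (auto simp: feasible_def seminar_assignment_def enumerates_def)
  then have "A = Map.empty" by (auto simp: ran_def fun_eq_iff) (metis not_None_eq)
  then have "max_profit S = 0" using A(2) by (simp add: assignment_profit_def)
  moreover have "outputs_assignment js [] ?s Map.empty"
    by (simp add: outputs_assignment_def initial_store_def)
  moreover obtain t where "run sap_program ?s t ?s" "t \<le> com_cost ?X sap_program"
    using run by blast
  ultimately show ?thesis
    using feasible_empty[OF inst]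
    by (intro exI[of _ t] exI[of _ ?s] exI[of _ Map.empty]) (simp add: assignment_profit_def)
qed

theorem theorem3:
  "\<exists>(c :: com) (q :: nat poly).
     \<forall>(S :: (nat, nat) sap) js bs.
       sap_instance S \<and>
       (\<forall>b\<in>seminars S. finite (allowed S b) \<and> card (allowed S b) \<le> 2) \<and>
       enumerates js (students S) \<and> enumerates bs (seminars S) \<longrightarrow>
       (\<exists>t s A.
          run c (initial_store (encode_sap js bs S)) t s \<and>
          t \<le> poly q (input_size (encode_sap js bs S)) \<and>
          outputs_assignment js bs s A \<and>
          feasible S A \<and>
          real_of_rat (assignment_profit S A) \<ge> (1 - exp (-1)) * real_of_rat (max_profit S))"
proof -
  have "is_poly (\<lambda>z. com_cost (size_bound z) sap_program)"
    by (rule is_poly_compose[OF is_poly_com_cost is_poly_size_bound])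
  then obtain q where q: "\<And>z. com_cost (size_bound z) sap_program = poly q z"
    unfolding is_poly_def by blast
  show ?thesis
  proof (rule exI[of _ sap_program], rule exI[of _ q], intro allI impI, elim conjE)
    fix S :: "(nat, nat) sap" and js bs
    assume asm: "sap_instance S" "\<forall>b\<in>seminars S. finite (allowed S b) \<and> card (allowed S b) \<le> 2"
      "enumerates js (students S)" "enumerates bs (seminars S)"
    show "\<exists>t s A. run sap_program (initial_store (encode_sap js bs S)) t s \<and>
          t \<le> poly q (input_size (encode_sap js bs S)) \<and>
          outputs_assignment js bs s A \<and> feasible S A \<and>
          real_of_rat (assignment_profit S A) \<ge> (1 - exp (-1)) * real_of_rat (max_profit S)"
    proof (cases "bs = []")
      case True
      then show ?thesis
        using sap_program_no_seminars[OF asm(1), of js] asm(4) by (simp add: q)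
    next
      case False
      then interpret sap_encoding S js bs
        using asm by unfold_locales (auto simp: enumerates_def)
      show ?thesis using sap_program_approximates by (simp add: X_def q)
    qed
  qed
qed

end
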